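(* For every $n\ge 1$ the cellular boundary map $\partial:C_*(P_{n+1})\to C_*(P_{n+1})$ of the permutahedron is a coderivation with respect to $\Delta_P:C_*(P_{n+1})\to C_*(P_{n+1})\otimes C_*(P_{n+1})$, i.e. $$\Delta_P\,\partial=(\partial\otimes 1+1\otimes\partial)\,\Delta_P ,$$ where $(1\otimes\partial)(a\otimes b)=(-1)^{\dim a}a\otimes\partial b$.
   Context: **Permutahedra and chains.** Let $\underline{m}=\{1,\dots,m\}$. A partition of a finite set of positive integers is an ordered partition $U_1|\cdots|U_p$ into non-empty blocks. The permutahedron $P_{n+1}$ is the $n$-dimensional polytope whose $(n+1-p)$-dimensional faces are indexed by the partitions $U_1|\cdots|U_p$ of $\underline{n+1}$; the top cell is $\underline{n+1}$. $C_*(P_{n+1})$ is the free abelian group on faces. The face $U_1|\cdots|U_p$ is identified with $P_{\#U_1}\times\cdots\times P_{\#U_p}$, so its chains are $C_*(U_1)\otimes\cdots\otimes C_*(U_p)$, where $C_*(U)$ is the chain complex of the permutahedron on $U$ (faces are the partitions of $U$); tensors are written with bars. For disjoint $M,N$, $\mathrm{shuff}(M;N)$ is the sign of the permutation taking $M\cup N$ in increasing order to $M$ (increasing) followed by $N$ (increasing). The boundary is $$\partial(U_1|\cdots|U_p)=\sum_{k=1}^p\ \sum_{\varnothing\ne M\subsetneq U_k}(-1)^{m_1+\cdots+m_{k-1}+\#M}\,\mathrm{shuff}(M;U_k\setminus M)\;U_1|\cdots|U_{k-1}|M|U_k\setminus M|U_{k+1}|\cdots|U_p,\qquad m_i=\#U_i-1.$$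 **Matrices.** An ordered matrix is a $q\times p$ matrix of non-negative integers whose non-zero entries are exactly $1,\dots,p+q-1$, each occurring once, with no zero row or column, whose non-zero entries increase left to right in each row and top to bottom in each column. If $U_j$ (resp. $V_i$) is the set of non-zero entries of column $j$ (resp. row $i$, row 1 being the top row) of $O$, put $c(O)=U_1|\cdots|U_p$ and $r(O)=V_q|\cdots|V_1$, both partitions of $\underline{p+q-1}$. A step matrix is an ordered matrix in which the non-zero entries of each row lie in consecutive columns, the non-zero entries of each column lie in consecutive rows, and each diagonal $\{j-i=\text{const}\}$ (sub, main and super) contains exactly one non-zero entry. **Configuration matrices.** Let $E$ be a $q\times p$ step matrix with column sets $A_1,\dots,A_p$ and row sets $B_1,\dots,B_q$. Let $M_0=M_p=N_0=N_q=\varnothing$ and choose, successively, (possibly empty) proper subsets $M_j\subset A_j\cup M_{j-1}$ ($1\le j\le p-1$) with every element of $M_j$ larger than $\max A_{j+1}$, and proper subsets $N_i\subset B_i\cup N_{i-1}$ ($1\le i\le q-1$) with every element of $N_i$ larger than $\max B_{i+1}$. Starting with $E$, move the elements of $M_1$ one column to the right (within their rows), then those of $M_2$, ..., $M_{p-1}$; then move the elements of $N_1$ one row down (within their columns), then those of $N_2,\dots,N_{q-1}$. The resulting matrix $F$ (whose column sets are $U_j=(A_j\cup M_{j-1})\setminus M_j$ and row sets are $V_i=(B_i\cup N_{i-1})\setminus N_i$) is called a configuration matrix derived from $E$. Let $\mathcal C^{q\times p}$ be the set of $q\times p$ configuration matrices. **Signs.** For $u=U_1|\cdots|U_p$: $psgn(u)$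 is the sign of the permutation taking the increasing order on $\bigcup U_i$ to the concatenation of the blocks $U_1,\dots,U_p$, each increasing; $sgn_1(u)=(-1)^{\sum_{i=1}^{p-1}i\,\#U_{p-i}}psgn(u)$; $sgn_2(u)=(-1)^{\binom{p-1}{2}}sgn_1(u)$; $rsgn(u)=\prod_i(-1)^{\#U_i(\#U_i-1)/2}$. For $F\in\mathcal C^{q\times p}$ derived from the step matrix $E$, $$csgn(F)=(-1)^{\binom q2}\,rsgn(c(E))\cdot sgn_1(r(F))\cdot sgn_2(c(E))\cdot sgn_2(c(F)).$$ **The map $\Delta_P$.** For each $n\ge0$, $$\Delta_P(\underline{n+1})=\sum_{1\le q\le n+1}\ \sum_{F\in\mathcal C^{q\times(n-q+2)}}csgn(F)\;c(F)\otimes r(F).$$ On a finite set $U$ in place of $\underline{\#U}$, use the order-preserving relabelling. On proper faces use the comultiplicative extension $\Delta_P(U_1|\cdots|U_p)=\Delta_P(U_1)|\cdots|\Delta_P(U_p)$, where $(a\otimes b)|(a'\otimes b')=(-1)^{\dim a'\dim b}(a|a')\otimes(b|b')$. *)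

theory Defs
  imports
    "HOL-Library.Poly_Mapping"
    "HOL-Library.Disjoint_Sets"
    "HOL-Combinatorics.Permutations"
begin

section \<open>Ordered partitions and chains of the permutahedron\<close>

type_synonym face = "nat set list"
type_synonym chain = "face \<Rightarrow>\<^sub>0 int"

text \<open>The tensor product of two free abelian groups is represented as the free abelian group
  on the pairs of basis elements; \<open>(a, b)\<close> stands for \<open>a \<otimes> b\<close>.\<close>
type_synonym chain2 = "(face \<times> face) \<Rightarrow>\<^sub>0 int"

text \<open>The list \<open>[U\<^sub>1, \<dots>, U\<^sub>p]\<close> stands for \<open>U\<^sub>1|\<dots>|U\<^sub>p\<close>.\<close>
definition faces :: "nat set \<Rightarrow> face set" where
  "faces U = {u. distinct u \<and> partition_on U (set u)}"

definition perm_chains :: "nat set \<Rightarrow> chain set" where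
  "perm_chains U = {x. Poly_Mapping.keys x \<subseteq> faces U}"

definition fdim :: "face \<Rightarrow> nat" where
  "fdim u = (\<Sum>B\<leftarrow>u. card B - 1)"

text \<open>For a list \<open>xs\<close> without repetitions: the sign of the permutation taking the increasing
  order on the elements of \<open>xs\<close> to \<open>xs\<close>.\<close>
definition list_sign :: "nat list \<Rightarrow> int" where
  "list_sign xs =
     sign (THE \<pi>. \<pi> permutes set xs \<and> map \<pi> (sorted_list_of_set (set xs)) = xs)"

definition shuff :: "nat set \<Rightarrow> nat set \<Rightarrow> int" where
  "shuff M N = list_sign (sorted_list_of_set M @ sorted_list_of_set N)"

text \<open>Blocks are numbered from 0 here, so \<open>take k u\<close> consists of the blocks preceding \<open>u ! k\<close>.\<close>
definition bd_face :: "face \<Rightarrow> chain" where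
  "bd_face u = (\<Sum>k<length u. \<Sum>M\<in>{M. M \<noteq> {} \<and> M \<subset> u ! k}.
     frag_cmul ((-1) ^ (fdim (take k u) + card M) * shuff M (u ! k - M))
       (frag_of (take k u @ [M, u ! k - M] @ drop (Suc k) u)))"

definition bd :: "chain \<Rightarrow> chain" where
  "bd = frag_extend bd_face"

definition tensor :: "chain \<Rightarrow> chain \<Rightarrow> chain2" where
  "tensor x y = frag_extend (\<lambda>a. frag_extend (\<lambda>b. frag_of (a, b)) y) x"

definition bd_tensor_id :: "chain2 \<Rightarrow> chain2" where
  "bd_tensor_id = frag_extend (\<lambda>(a, b). tensor (bd (frag_of a)) (frag_of b))"

definition id_tensor_bd :: "chain2 \<Rightarrow> chain2" where
  "id_tensor_bd =
     frag_extend (\<lambda>(a, b). frag_cmul ((-1) ^ fdim a) (tensor (frag_of a) (bd (frag_of b))))"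


section \<open>Ordered matrices, step matrices and configuration matrices\<close>

text \<open>A \<open>q \<times> p\<close> matrix is a function whose value at \<open>i\<close> and \<open>j\<close> is the entry in row \<open>i\<close> and
  column \<open>j\<close>, for \<open>i \<in> {1..q}\<close> and \<open>j \<in> {1..p}\<close>. Requiring the value 0 at all other arguments
  makes the functions correspond one-to-one to matrices.\<close>
type_synonym mtx = "nat \<Rightarrow> nat \<Rightarrow> nat"

definition row_set :: "mtx \<Rightarrow> nat \<Rightarrow> nat set" where
  "row_set X i = {X i j |j. X i j \<noteq> 0}"

definition col_set :: "mtx \<Rightarrow> nat \<Rightarrow> nat set" where
  "col_set X j = {X i j |i. X i j \<noteq> 0}"

definition col_part :: "nat \<Rightarrow> mtx \<Rightarrow> face" where
  "col_part p X = map (col_set X) [1..<Suc p]"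

definition row_part :: "nat \<Rightarrow> mtx \<Rightarrow> face" where
  "row_part q X = map (row_set X) (rev [1..<Suc q])"

definition ordered_matrix :: "nat \<Rightarrow> nat \<Rightarrow> mtx \<Rightarrow> bool" where
  "ordered_matrix q p X \<longleftrightarrow>
     (\<forall>i j. X i j \<noteq> 0 \<longrightarrow> i \<in> {1..q} \<and> j \<in> {1..p}) \<and>
     bij_betw (\<lambda>(i, j). X i j) {(i, j). X i j \<noteq> 0} {1..p + q - 1} \<and>
     (\<forall>i\<in>{1..q}. row_set X i \<noteq> {}) \<and>
     (\<forall>j\<in>{1..p}. col_set X j \<noteq> {}) \<and>
     (\<forall>i j j'. j < j' \<and> X i j \<noteq> 0 \<and> X i j' \<noteq> 0 \<longrightarrow> X i j < X i j') \<and>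
     (\<forall>i i' j. i < i' \<and> X i j \<noteq> 0 \<and> X i' j \<noteq> 0 \<longrightarrow> X i j < X i' j)"

definition step_matrix :: "nat \<Rightarrow> nat \<Rightarrow> mtx \<Rightarrow> bool" where
  "step_matrix q p X \<longleftrightarrow>
     ordered_matrix q p X \<and>
     (\<forall>i j k j'. j \<le> k \<and> k \<le> j' \<and> X i j \<noteq> 0 \<and> X i j' \<noteq> 0 \<longrightarrow> X i k \<noteq> 0) \<and>
     (\<forall>i k i' j. i \<le> k \<and> k \<le> i' \<and> X i j \<noteq> 0 \<and> X i' j \<noteq> 0 \<longrightarrow> X k j \<noteq> 0) \<and>
     (\<forall>d\<in>{1 - int q..int p - 1}.
        \<exists>!z. X (fst z) (snd z) \<noteq> 0 \<and> int (snd z) - int (fst z) = d)"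

text \<open>The moves below are only applied to sets \<open>S\<close> of positive integers. For the moves occurring
  in \<open>derived_from\<close> the target positions are never occupied by elements outside \<open>S\<close>, so no entry
  is overwritten.\<close>
definition move_right :: "nat set \<Rightarrow> mtx \<Rightarrow> mtx" where
  "move_right S X = (\<lambda>i j.
     if X i (j - 1) \<in> S then X i (j - 1) else if X i j \<in> S then 0 else X i j)"

definition move_down :: "nat set \<Rightarrow> mtx \<Rightarrow> mtx" where
  "move_down S X = (\<lambda>i j.
     if X (i - 1) j \<in> S then X (i - 1) j else if X i j \<in> S then 0 else X i j)"

text \<open>\<open>F\<close> is a configuration matrix derived from \<open>E\<close>.\<close>
definition derived_from :: "nat \<Rightarrow> nat \<Rightarrow> mtx \<Rightarrow> mtx \<Rightarrow> bool" where
  "derived_from q p E F \<longleftrightarrow>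
     step_matrix q p E \<and>
     (\<exists>M N. M 0 = {} \<and> M p = {} \<and> N 0 = {} \<and> N q = {} \<and>
        (\<forall>j\<in>{1..<p}. M j \<subset> col_set E j \<union> M (j - 1) \<and>
                     (\<forall>x\<in>M j. Max (col_set E (j + 1)) < x)) \<and>
        (\<forall>i\<in>{1..<q}. N i \<subset> row_set E i \<union> N (i - 1) \<and>
                     (\<forall>x\<in>N i. Max (row_set E (i + 1)) < x)) \<and>
        F = fold (\<lambda>i. move_down (N i)) [1..<q]
              (fold (\<lambda>j. move_right (M j)) [1..<p] E))"

definition config_matrices :: "nat \<Rightarrow> nat \<Rightarrow> mtx set" where
  "config_matrices q p = {F. \<exists>E. derived_from q p E F}"


section \<open>Signs\<close>

definition psgn :: "face \<Rightarrow> int" where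
  "psgn u = list_sign (concat (map sorted_list_of_set u))"

text \<open>As lists are indexed from 0, \<open>u ! (length u - i - 1)\<close> is the block \<open>U\<^sub>p\<^sub>-\<^sub>i\<close>.\<close>
definition sgn1 :: "face \<Rightarrow> int" where
  "sgn1 u = (-1) ^ (\<Sum>i\<in>{1..<length u}. i * card (u ! (length u - i - 1))) * psgn u"

definition sgn2 :: "face \<Rightarrow> int" where
  "sgn2 u = (-1) ^ ((length u - 1) choose 2) * sgn1 u"

definition rsgn :: "face \<Rightarrow> int" where
  "rsgn u = (\<Prod>B\<leftarrow>u. (-1) ^ (card B * (card B - 1) div 2))"

text \<open>The step matrix from which a configuration matrix is derived is unique.\<close>
definition csgn :: "nat \<Rightarrow> nat \<Rightarrow> mtx \<Rightarrow> int" where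
  "csgn q p F = (let E = (THE E. derived_from q p E F) in
     (-1) ^ (q choose 2) * rsgn (col_part p E) * sgn1 (row_part q F) *
       sgn2 (col_part p E) * sgn2 (col_part p F))"


section \<open>The diagonal\<close>

text \<open>The value on the top cell \<open>{1..n+1}\<close>.\<close>
definition diag_top :: "nat \<Rightarrow> chain2" where
  "diag_top n = (\<Sum>q\<in>{1..n + 1}. \<Sum>F\<in>config_matrices q (n + 2 - q).
     frag_cmul (csgn q (n + 2 - q) F)
       (frag_of (col_part (n + 2 - q) F, row_part q F)))"

text \<open>The order-preserving bijection from \<open>{1..card U}\<close> to \<open>U\<close>.\<close>
definition order_label :: "nat set \<Rightarrow> nat \<Rightarrow> nat" where
  "order_label U i = sorted_list_of_set U ! (i - 1)"

definition relabel :: "(nat \<Rightarrow> nat) \<Rightarrow> face \<Rightarrow> face" where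
  "relabel f u = map (image f) u"

definition diag_block :: "nat set \<Rightarrow> chain2" where
  "diag_block U =
     frag_extend (\<lambda>(a, b). frag_of (relabel (order_label U) a, relabel (order_label U) b))
       (diag_top (card U - 1))"

text \<open>\<open>(a \<otimes> b)|(a' \<otimes> b') = (-1)\<^bsup>dim a' dim b\<^esup> (a|a') \<otimes> (b|b')\<close>, extended bilinearly.\<close>
definition bar :: "chain2 \<Rightarrow> chain2 \<Rightarrow> chain2" where
  "bar x y = frag_extend (\<lambda>(a, b). frag_extend (\<lambda>(a', b').
     frag_cmul ((-1) ^ (fdim a' * fdim b)) (frag_of (a @ a', b @ b'))) y) x"

text \<open>\<open>[] \<otimes> []\<close> is a unit for \<open>bar\<close>, which serves as the starting value of the iterated product.\<close>
definition diag_face :: "face \<Rightarrow> chain2" where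
  "diag_face u = foldr (\<lambda>U. bar (diag_block U)) u (frag_of ([], []))"

definition diag :: "chain \<Rightarrow> chain2" where
  "diag = frag_extend diag_face"

end

theory Submission
  imports Defs
begin

text \<open>
  The diagonal satisfies a recursion on the largest element. Let \<open>I\<close> insert \<open>m\<close> into each block of a
  face in turn (with signs), and put \<open>I\<close> of the empty face to be the face \<open>m\<close>. For \<open>m\<close> larger than all
  elements of \<open>S\<close>,
  \<open>\<Delta>(S \<union> {m}) = \<Sum> shuff(A; B) (1 \<otimes> I)\<Delta>(A) | (I \<otimes> 1)\<Delta>(B)\<close>, summed over all splittings of \<open>S\<close> into
  \<open>A\<close> and \<open>B\<close>, where \<open>\<Delta>({}) = 1\<close>. This reflects how the position of \<open>m\<close> divides a
  configuration matrix: the entries before \<open>m\<close> on the lattice path of the step matrix form a block at the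
  bottom left, those after \<open>m\<close> a block at the top right, and \<open>m\<close> lies in any row of the former and any
  column of the latter.

  Both \<open>1 \<otimes> I\<close> and \<open>I \<otimes> 1\<close> are signed derivations of the product \<open>|\<close>, and their commutators with the
  boundary are commutators with \<open>1 \<otimes> m\<close> and \<open>m \<otimes> 1\<close>. Expanding the boundary of the recursion and
  using the induction hypothesis for \<open>A\<close> and \<open>B\<close>, the threefold products in which \<open>m\<close> is
  inserted into the two outer factors cancel, and the others assemble to \<open>\<Delta>(\<partial>(S \<union> {m}))\<close>.
\<close>

section \<open>Signs and inversions\<close>

text \<open>Why \<open>m\<close> cuts a configuration in two: an entry may move right into a column,
  or down into a row, only if it exceeds every entry of the step matrix there, so nothing smaller
  than \<open>m\<close> enters the column or the row of \<open>m\<close>. The entries before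
  \<open>m\<close> on the path therefore keep to the columns of their block and those after
  \<open>m\<close> to the rows of theirs, while \<open>m\<close> itself meets no obstacle. Matrices
  and successive moves are awkward to cut, so a step matrix is replaced by the word of its entries
  along the path, which is an arbitrary permutation of them, and a configuration by two independent
  functions, the final column and the final row of each entry. Cutting a word at its maximum then
  gives an induction, and words make sense over any finite set of labels, as the recursion requires.
  Two points need separate arguments: a configuration determines its word, so that the sum over
  configuration matrices is a sum over words; and the prescribed sign is multiplicative up to the
  signs of the shuffle, of \<open>|\<close> and of the two insertions, a parity identity in the
  sizes, row numbers and column numbers of the two blocks.\<close>

definition crossings :: "nat set \<Rightarrow> nat set \<Rightarrow> nat" where
  "crossings A B = card {(a, b) \<in> A \<times> B. b < a}"

fun inversions :: "nat list \<Rightarrow> nat" where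
  "inversions [] = 0"
| "inversions (x # xs) = crossings {x} (set xs) + inversions xs"

lemma crossings_empty [simp]: "crossings {} B = 0" "crossings A {} = 0"
  by (simp_all add: crossings_def)

lemma crossings_Un_left:
  assumes "finite A" "finite B" "finite C" "A \<inter> B = {}"
  shows "crossings (A \<union> B) C = crossings A C + crossings B C"
proof -
  have "{(a, b) \<in> (A \<union> B) \<times> C. b < a} = {(a, b) \<in> A \<times> C. b < a} \<union> {(a, b) \<in> B \<times> C. b < a}"
    by auto
  moreover have "finite {(a, b) \<in> A \<times> C. b < a}" "finite {(a, b) \<in> B \<times> C. b < a}"
    using assms by (auto intro: finite_subset[of _ "A \<times> C"] finite_subset[of _ "B \<times> C"])
  ultimately show ?thesis
    unfolding crossings_def using assms by (subst card_Un_disjoint[symmetric]) auto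
qed

lemma crossings_Un_right:
  assumes "finite A" "finite B" "finite C" "B \<inter> C = {}"
  shows "crossings A (B \<union> C) = crossings A B + crossings A C"
proof -
  have "{(a, b) \<in> A \<times> (B \<union> C). b < a} = {(a, b) \<in> A \<times> B. b < a} \<union> {(a, b) \<in> A \<times> C. b < a}"
    by auto
  moreover have "finite {(a, b) \<in> A \<times> B. b < a}" "finite {(a, b) \<in> A \<times> C. b < a}"
    using assms by (auto intro: finite_subset[of _ "A \<times> B"] finite_subset[of _ "A \<times> C"])
  ultimately show ?thesis
    unfolding crossings_def using assms by (subst card_Un_disjoint[symmetric]) auto
qed

lemma crossings_insert_left_max:
  assumes "finite A" "finite B" "\<forall>x\<in>A \<union> B. x < m"
  shows "crossings (insert m A) B = card B + crossings A B"
proof -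
  have "{(a, b) \<in> {m} \<times> B. b < a} = {m} \<times> B" using assms by auto
  hence "crossings {m} B = card B"
    by (simp add: crossings_def card_cartesian_product_singleton)
  moreover have "crossings (insert m A) B = crossings {m} B + crossings A B"
    using crossings_Un_left[of "{m}" A B] assms by auto
  ultimately show ?thesis by simp
qed

lemma crossings_insert_right_max:
  assumes "\<forall>x\<in>A. x < m"
  shows "crossings A (insert m B) = crossings A B"
proof -
  have "{(a, b) \<in> A \<times> insert m B. b < a} = {(a, b) \<in> A \<times> B. b < a}" using assms by force
  thus ?thesis by (simp add: crossings_def)
qed

lemma crossings_insert_min:
  assumes "\<forall>y\<in>set xs. x < (y::nat)"
  shows "crossings {x} (set xs) = 0"
proof -
  have "{(a, b) \<in> {x} \<times> set xs. b < a} = {}" using assms by (auto simp: not_less less_imp_le)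
  thus ?thesis by (simp only: crossings_def card.empty)
qed

lemma crossings_image:
  assumes "strict_mono_on S f" "A \<subseteq> S" "B \<subseteq> S"
  shows "crossings (f ` A) (f ` B) = crossings A B"
proof -
  have lt: "f a < f b \<longleftrightarrow> a < b" if "a \<in> S" "b \<in> S" for a b
    using assms(1) that by (metis linorder_neqE_nat less_asym strict_mono_onD)
  have inj: "inj_on f S"
    using assms(1) by (rule strict_mono_on_imp_inj_on)
  have "{(a, b) \<in> f ` A \<times> f ` B. b < a} = map_prod f f ` {(a, b) \<in> A \<times> B. b < a}"
  proof (intro equalityI subsetI)
    fix z assume "z \<in> {(a, b) \<in> f ` A \<times> f ` B. b < a}"
    then obtain a b where ab: "z = (f a, f b)" "a \<in> A" "b \<in> B" "f b < f a" by auto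
    then have "(a, b) \<in> {(a, b) \<in> A \<times> B. b < a}" using lt assms by auto
    then show "z \<in> map_prod f f ` {(a, b) \<in> A \<times> B. b < a}" using ab by (auto intro!: image_eqI[of _ _ "(a,b)"])
  next
    fix z assume "z \<in> map_prod f f ` {(a, b) \<in> A \<times> B. b < a}"
    then show "z \<in> {(a, b) \<in> f ` A \<times> f ` B. b < a}" using lt assms by auto
  qed
  moreover have "inj_on (map_prod f f) {(a, b) \<in> A \<times> B. b < a}"
    by (rule inj_on_subset[OF map_prod_inj_on[OF inj inj]]) (use assms in auto)
  ultimately show ?thesis by (simp add: crossings_def card_image)
qed

lemma inversions_append:
  "distinct (xs @ ys) \<Longrightarrow>
   inversions (xs @ ys) = inversions xs + crossings (set xs) (set ys) + inversions ys"
proof (induction xs)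
  case (Cons x xs)
  have "crossings {x} (set xs \<union> set ys) = crossings {x} (set xs) + crossings {x} (set ys)"
    using Cons.prems by (intro crossings_Un_right) auto
  moreover have "crossings ({x} \<union> set xs) (set ys) = crossings {x} (set ys) + crossings (set xs) (set ys)"
    using Cons.prems by (intro crossings_Un_left) auto
  ultimately show ?case using Cons by simp
qed simp

lemma inversions_sorted:
  "sorted xs \<Longrightarrow> distinct xs \<Longrightarrow> inversions xs = 0"
proof (induction xs)
  case (Cons x xs)
  then have "crossings {x} (set xs) = 0"
    by (intro crossings_insert_min) (auto simp: order.strict_iff_order)
  with Cons show ?case by simp
qed simp

lemma unsorted_adjacent:
  "\<not> sorted xs \<Longrightarrow> \<exists>as x y bs. xs = as @ x # y # bs \<and> y < (x::nat)"
proof (induction xs rule: induct_list012)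
  case (3 x y zs)
  show ?case
  proof (cases "y < x")
    case True
    then show ?thesis by (metis append_Nil)
  next
    case False
    then have "\<not> sorted (y # zs)" using 3(3) by (auto simp: not_less intro: order_trans)
    then obtain as a b bs where "y # zs = as @ a # b # bs" "b < a" using 3 by auto
    then show ?thesis by (metis append_Cons)
  qed
qed auto

text \<open>Only the pair \<open>x\<close>, \<open>y\<close> changes its order; every other element
  is compared with the same set as before.\<close>

lemma inversions_swap:
  assumes "distinct (as @ x # y # bs)" "y < x"
  shows "inversions (as @ x # y # bs) = Suc (inversions (as @ y # x # bs))"
proof -
  have a: "crossings {x} {y} = 1" 
  proof -
    have "{(a, b) \<in> {x} \<times> {y}. b < a} = {(x, y)}" using assms by auto
    then show ?thesis by (simp only: crossings_def) simp
  qed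
  have b: "crossings {y} {x} = 0"
    using assms by (simp add: crossings_def card_eq_0_iff)
  have "crossings {x} ({y} \<union> set bs) = 1 + crossings {x} (set bs)"
    "crossings {y} ({x} \<union> set bs) = crossings {y} (set bs)"
    using assms a b by (subst crossings_Un_right; auto)+
  moreover have "set (x # y # bs) = set (y # x # bs)" by auto
  moreover have "distinct (as @ y # x # bs)" using assms by auto
  ultimately show ?thesis
    using assms by (simp add: inversions_append insert_commute)
qed

text \<open>Bubble sort: undoing an adjacent descent removes one inversion and composes the
  permutation with one transposition.\<close>

lemma ex_permutes_sorted:
  "distinct xs \<Longrightarrow> \<exists>\<pi>. \<pi> permutes set xs \<and> map \<pi> (sorted_list_of_set (set xs)) = xs
     \<and> sign \<pi> = (-1) ^ inversions xs"
proof (induction "inversions xs" arbitrary: xs rule: less_induct)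
  case less
  show ?case
  proof (cases "sorted xs")
    case True
    then have "sorted_list_of_set (set xs) = xs"
      using less.prems sorted_list_of_set.idem_if_sorted_distinct by blast
    then show ?thesis
      using inversions_sorted[OF True less.prems] by (intro exI[of _ id]) (auto simp: permutes_id)
  next
    case False
    then obtain as x y bs where xs: "xs = as @ x # y # bs" and xy: "y < x"
      using unsorted_adjacent by blast
    let ?ys = "as @ y # x # bs"
    have inv: "inversions xs = Suc (inversions ?ys)"
      using inversions_swap less.prems xs xy by blast
    have d: "distinct ?ys" and st: "set ?ys = set xs" using less.prems xs by auto
    obtain \<pi> where \<pi>: "\<pi> permutes set xs" "map \<pi> (sorted_list_of_set (set xs)) = ?ys"
      "sign \<pi> = (-1) ^ inversions ?ys"
      using less.hyps[of ?ys] inv d unfolding st by (metis lessI)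
    let ?t = "transpose x y"
    have "?t permutes set xs" using xs by (intro permutes_swap_id) auto
    then have 1: "?t \<circ> \<pi> permutes set xs" using \<pi>(1) by (intro permutes_compose) auto
    have "map (?t \<circ> \<pi>) (sorted_list_of_set (set xs)) = map ?t ?ys"
      using \<pi>(2) by (metis map_map)
    also have "map ?t ?ys = xs"
    proof -
      have "map ?t as = as" "map ?t bs = bs"
        using less.prems xs by (auto intro!: map_idI transpose_apply_other)
      then show ?thesis by (simp add: xs)
    qed
    finally have 2: "map (?t \<circ> \<pi>) (sorted_list_of_set (set xs)) = xs" .
    have "permutation \<pi>" using \<pi>(1) by (auto simp: permutation_permutes)
    then have "sign (?t \<circ> \<pi>) = sign ?t * sign \<pi>"
      by (intro sign_compose permutation_swap_id)
    then have 3: "sign (?t \<circ> \<pi>) = (-1) ^ inversions xs"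
      using \<pi>(3) inv xy by (simp add: sign_swap_id)
    from 1 2 3 show ?thesis by blast
  qed
qed

text \<open>The permutation described in \<open>list_sign\<close> is unique, its values on the
  sorted list being prescribed and all other points being fixed, so the description can be
  evaluated.\<close>

lemma list_sign_inversions:
  assumes "distinct xs"
  shows "list_sign xs = (-1) ^ inversions xs"
proof -
  obtain \<pi> where \<pi>: "\<pi> permutes set xs" "map \<pi> (sorted_list_of_set (set xs)) = xs"
    "sign \<pi> = (-1) ^ inversions xs"
    using ex_permutes_sorted[OF assms] by blast
  have "(THE \<pi>. \<pi> permutes set xs \<and> map \<pi> (sorted_list_of_set (set xs)) = xs) = \<pi>"
  proof (rule the_equality)
    fix \<rho> assume \<rho>: "\<rho> permutes set xs \<and> map \<rho> (sorted_list_of_set (set xs)) = xs"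
    show "\<rho> = \<pi>"
    proof
      fix x show "\<rho> x = \<pi> x"
      proof (cases "x \<in> set xs")
        case True
        have "map \<rho> (sorted_list_of_set (set xs)) = map \<pi> (sorted_list_of_set (set xs))"
          using \<rho> \<pi>(2) by (elim conjE) (erule trans, erule sym)
        then have "\<forall>x\<in>set (sorted_list_of_set (set xs)). \<rho> x = \<pi> x"
          unfolding map_eq_conv .
        with True show ?thesis by simp
      next
        case False
        then show ?thesis using \<rho> \<pi>(1) by (metis permutes_not_in)
      qed
    qed
  qed (use \<pi> in blast)
  then show ?thesis using \<pi>(3) by (simp add: list_sign_def)
qed

lemma shuff_crossings:
  assumes "finite M" "finite N" "M \<inter> N = {}"
  shows "shuff M N = (-1) ^ crossings M N"
  using assms by (simp add: shuff_def list_sign_inversions inversions_append inversions_sorted)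

section \<open>Signs of ordered partitions\<close>

fun disjoint_blocks :: "face \<Rightarrow> bool" where
  "disjoint_blocks [] = True"
| "disjoint_blocks (U # u) \<longleftrightarrow> finite U \<and> U \<inter> \<Union>(set u) = {} \<and> disjoint_blocks u"

fun pcross :: "face \<Rightarrow> nat" where
  "pcross [] = 0"
| "pcross (U # u) = crossings U (\<Union>(set u)) + pcross u"

lemma disjoint_blocks_finite: "disjoint_blocks u \<Longrightarrow> finite (\<Union>(set u))"
  by (induction u) auto

lemma set_concat_sorted: "disjoint_blocks u \<Longrightarrow> set (concat (map sorted_list_of_set u)) = \<Union>(set u)"
  by (induction u) auto

text \<open>Each block is listed in increasing order, so an inversion always involves two different
  blocks.\<close>

lemma inversions_concat:
  "disjoint_blocks u \<Longrightarrow> distinct (concat (map sorted_list_of_set u)) \<and>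
     inversions (concat (map sorted_list_of_set u)) = pcross u"
proof (induction u)
  case (Cons U u)
  have s: "set (concat (map sorted_list_of_set u)) = \<Union>(set u)"
    using Cons.prems by (intro set_concat_sorted) simp
  have d: "distinct (concat (map sorted_list_of_set (U # u)))"
    using Cons s by (auto simp del: set_concat)
  then show ?case
    using Cons s by (simp add: inversions_append inversions_sorted del: set_concat)
qed simp

lemma psgn_pcross: "disjoint_blocks u \<Longrightarrow> psgn u = (-1) ^ pcross u"
  by (simp add: psgn_def list_sign_inversions inversions_concat)

lemma disjoint_blocks_append:
  "disjoint_blocks (u @ v) \<longleftrightarrow> disjoint_blocks u \<and> disjoint_blocks v \<and> \<Union>(set u) \<inter> \<Union>(set v) = {}"
  by (induction u) auto

lemma pcross_append:
  "disjoint_blocks (u @ v) \<Longrightarrow> pcross (u @ v) = pcross u + crossings (\<Union>(set u)) (\<Union>(set v)) + pcross v"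
proof (induction u)
  case (Cons U u)
  have "finite (\<Union>(set u))" "finite (\<Union>(set v))" 
    using Cons.prems by (auto intro: disjoint_blocks_finite simp: disjoint_blocks_append)
  then show ?case
    using Cons by (subst append_Cons, subst pcross.simps)
      (simp add: crossings_Un_right crossings_Un_left disjoint_blocks_append Int_Un_distrib)
qed simp

section \<open>Chains and tensor products\<close>

text \<open>Degrees enter only through signs and are recorded modulo 2. The degree
  \<open>card S - 1\<close> can then be written \<open>Suc (card S)\<close>, which avoids truncated
  subtraction.\<close>

definition hom_chain :: "nat \<Rightarrow> chain \<Rightarrow> bool" where
  "hom_chain d x \<longleftrightarrow> (\<forall>u\<in>Poly_Mapping.keys x. even (fdim u + d))"

definition hom_chain2 :: "nat \<Rightarrow> chain2 \<Rightarrow> bool" where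
  "hom_chain2 d x \<longleftrightarrow> (\<forall>z\<in>Poly_Mapping.keys x. even (fdim (fst z) + fdim (snd z) + d))"

definition cat :: "chain \<Rightarrow> chain \<Rightarrow> chain" where
  "cat x y = frag_extend (\<lambda>a. frag_extend (\<lambda>b. frag_of (a @ b)) y) x"

definition bd2 :: "chain2 \<Rightarrow> chain2" where
  "bd2 x = bd_tensor_id x + id_tensor_bd x"

lemma neg_one_power_cong: "even (m + n) \<Longrightarrow> (-1 :: int) ^ m = (-1) ^ n"
  by (auto simp: minus_one_power_iff)

lemma fdim_Nil [simp]: "fdim [] = 0"
  and fdim_Cons: "fdim (U # u) = card U - 1 + fdim u"
  and fdim_append [simp]: "fdim (u @ v) = fdim u + fdim v"
  by (simp_all add: fdim_def)

lemma frag_extend_add_fun: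
  "frag_extend (\<lambda>a. f a + g a) x = frag_extend f x + frag_extend g x"
  by (simp add: frag_extend_def frag_cmul_distrib2 sum.distrib)

lemma frag_cmul_minus: "frag_cmul c (p - q) = frag_cmul c p - frag_cmul c q"
  by (simp add: poly_mapping_eqI lookup_minus right_diff_distrib)

lemma frag_extend_diff_fun:
  "frag_extend (\<lambda>a. f a - g a) x = frag_extend f x - frag_extend g x"
  by (simp add: frag_extend_def frag_cmul_minus sum_subtractf)

lemma frag_extend_cmul_fun:
  "frag_extend (\<lambda>a. frag_cmul c (f a)) x = frag_cmul c (frag_extend f x)"
  by (simp add: frag_extend_def frag_cmul_sum mult.commute)

lemma frag_extend_0_fun [simp]: "frag_extend (\<lambda>a. 0) x = 0"
  by (simp add: frag_extend_def)

named_theorems linear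

lemma cat_linear [linear]:
  "cat 0 y = 0" "cat x 0 = 0"
  "cat (x + x') y = cat x y + cat x' y" "cat x (y + y') = cat x y + cat x y'"
  "cat (x - x') y = cat x y - cat x' y" "cat x (y - y') = cat x y - cat x y'"
  "cat (frag_cmul c x) y = frag_cmul c (cat x y)" "cat x (frag_cmul c y) = frag_cmul c (cat x y)"
  "cat (sum f I) y = (\<Sum>i\<in>I. cat (f i) y)" "cat x (sum g I) = (\<Sum>i\<in>I. cat x (g i))"
proof -
  show *: "cat 0 y = 0" "cat x 0 = 0"
    "cat (x + x') y = cat x y + cat x' y" "cat x (y + y') = cat x y + cat x y'" for x x' y y'
    by (simp_all add: cat_def frag_extend_add frag_extend_add_fun)
  show "cat (x - x') y = cat x y - cat x' y" "cat x (y - y') = cat x y - cat x y'"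
    "cat (frag_cmul c x) y = frag_cmul c (cat x y)" "cat x (frag_cmul c y) = frag_cmul c (cat x y)"
    by (simp_all add: cat_def frag_extend_diff frag_extend_diff_fun frag_extend_cmul frag_extend_cmul_fun)
  show "cat (sum f I) y = (\<Sum>i\<in>I. cat (f i) y)" "cat x (sum g I) = (\<Sum>i\<in>I. cat x (g i))"
    by (induction I rule: infinite_finite_induct) (simp_all add: *)
qed

lemma bar_linear [linear]:
  "bar 0 y = 0" "bar x 0 = 0"
  "bar (x + x') y = bar x y + bar x' y" "bar x (y + y') = bar x y + bar x y'"
  "bar (x - x') y = bar x y - bar x' y" "bar x (y - y') = bar x y - bar x y'"
  "bar (frag_cmul c x) y = frag_cmul c (bar x y)" "bar x (frag_cmul c y) = frag_cmul c (bar x y)"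
  "bar (sum f I) y = (\<Sum>i\<in>I. bar (f i) y)" "bar x (sum g I) = (\<Sum>i\<in>I. bar x (g i))"
proof -
  show *: "bar 0 y = 0" "bar x 0 = 0"
    "bar (x + x') y = bar x y + bar x' y" "bar x (y + y') = bar x y + bar x y'" for x x' y y'
    by (simp_all add: bar_def frag_extend_add frag_extend_add_fun case_prod_unfold)
  show "bar (x - x') y = bar x y - bar x' y" "bar x (y - y') = bar x y - bar x y'"
    "bar (frag_cmul c x) y = frag_cmul c (bar x y)" "bar x (frag_cmul c y) = frag_cmul c (bar x y)"
    by (simp_all add: bar_def frag_extend_diff frag_extend_diff_fun frag_extend_cmul
        frag_extend_cmul_fun case_prod_unfold)
  show "bar (sum f I) y = (\<Sum>i\<in>I. bar (f i) y)" "bar x (sum g I) = (\<Sum>i\<in>I. bar x (g i))"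
    by (induction I rule: infinite_finite_induct) (simp_all add: *)
qed

lemma tensor_linear [linear]:
  "tensor 0 y = 0" "tensor x 0 = 0"
  "tensor (x + x') y = tensor x y + tensor x' y" "tensor x (y + y') = tensor x y + tensor x y'"
  "tensor (x - x') y = tensor x y - tensor x' y" "tensor x (y - y') = tensor x y - tensor x y'"
  "tensor (frag_cmul c x) y = frag_cmul c (tensor x y)" "tensor x (frag_cmul c y) = frag_cmul c (tensor x y)"
  "tensor (sum f I) y = (\<Sum>i\<in>I. tensor (f i) y)" "tensor x (sum g I) = (\<Sum>i\<in>I. tensor x (g i))"
proof -
  show *: "tensor 0 y = 0" "tensor x 0 = 0"
    "tensor (x + x') y = tensor x y + tensor x' y" "tensor x (y + y') = tensor x y + tensor x y'" for x x' y y'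
    by (simp_all add: tensor_def frag_extend_add frag_extend_add_fun)
  show "tensor (x - x') y = tensor x y - tensor x' y" "tensor x (y - y') = tensor x y - tensor x y'"
    "tensor (frag_cmul c x) y = frag_cmul c (tensor x y)" "tensor x (frag_cmul c y) = frag_cmul c (tensor x y)"
    by (simp_all add: tensor_def frag_extend_diff frag_extend_diff_fun frag_extend_cmul frag_extend_cmul_fun)
  show "tensor (sum f I) y = (\<Sum>i\<in>I. tensor (f i) y)" "tensor x (sum g I) = (\<Sum>i\<in>I. tensor x (g i))"
    by (induction I rule: infinite_finite_induct) (simp_all add: *)
qed

lemma frag_extend_linear [linear]:
  "frag_extend f (x + y) = frag_extend f x + frag_extend f y"
  "frag_extend f (x - y) = frag_extend f x - frag_extend f y"
  "frag_extend f (frag_cmul c x) = frag_cmul c (frag_extend f x)"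
  "frag_extend f (sum g I) = (\<Sum>i\<in>I. frag_extend f (g i))"
  by (simp_all add: frag_extend_add frag_extend_diff frag_extend_cmul)
    (induction I rule: infinite_finite_induct; simp add: frag_extend_add)

lemma bd_linear [linear]:
  "bd 0 = 0" "bd (x + y) = bd x + bd y" "bd (x - y) = bd x - bd y"
  "bd (frag_cmul c x) = frag_cmul c (bd x)" "bd (sum g I) = (\<Sum>i\<in>I. bd (g i))"
  by (simp_all add: bd_def frag_extend_linear)

lemma bd_of [simp]: "bd (frag_of u) = bd_face u"
  by (simp add: bd_def)

lemma bd2_linear [linear]:
  "bd2 0 = 0" "bd2 (x + y) = bd2 x + bd2 y" "bd2 (x - y) = bd2 x - bd2 y"
  "bd2 (frag_cmul c x) = frag_cmul c (bd2 x)" "bd2 (sum g I) = (\<Sum>i\<in>I. bd2 (g i))"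
  by (simp_all add: bd2_def bd_tensor_id_def id_tensor_bd_def frag_extend_linear frag_cmul_distrib2
      sum.distrib)

lemma bd2_of: "bd2 (frag_of (a, b)) = tensor (bd_face a) (frag_of b)
    + frag_cmul ((-1) ^ fdim a) (tensor (frag_of a) (bd_face b))"
  by (simp add: bd2_def bd_tensor_id_def id_tensor_bd_def)

lemma cat_of [simp]: "cat (frag_of a) (frag_of b) = frag_of (a @ b)"
  by (simp add: cat_def)

lemma tensor_of [simp]: "tensor (frag_of a) (frag_of b) = frag_of (a, b)"
  by (simp add: tensor_def)

lemma bar_of: "bar (frag_of (a, b)) (frag_of (a', b'))
    = frag_cmul ((-1) ^ (fdim a' * fdim b)) (frag_of (a @ a', b @ b'))"
  by (simp add: bar_def)

text \<open>The basis case is restricted to the keys of \<open>c\<close>, so that a hypothesis on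
  the degree or the support of \<open>c\<close> is available there although the induction passes
  through arbitrary chains.\<close>

lemma chain_induct [case_names zero one diff]:
  assumes "P 0" "\<And>x. x \<in> Poly_Mapping.keys c \<Longrightarrow> P (frag_of x)" "\<And>a b. P a \<Longrightarrow> P b \<Longrightarrow> P (a - b)"
  shows "P c"
  using frag_induction[of c "Poly_Mapping.keys c" P] assms by blast

lemma bar_assoc: "bar (bar x y) z = bar x (bar y z)"
proof (induction x rule: chain_induct)
  case (one a)
  show ?case
  proof (induction y rule: chain_induct)
    case (one b)
    show ?case
    proof (induction z rule: chain_induct)
      case (one c)
      show ?case
        by (cases a; cases b; cases c)
          (simp add: bar_of linear power_add algebra_simps)
    qed (simp_all add: linear)
  qed (simp_all add: linear)
qed (simp_all add: linear)

lemma bar_unit [simp]: "bar (frag_of ([], [])) x = x" "bar x (frag_of ([], [])) = x"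
  by (induction x rule: chain_induct; force simp: bar_of linear)+

lemma cat_assoc: "cat (cat x y) z = cat x (cat y z)"
proof (induction x rule: chain_induct)
  case (one a)
  show ?case
  proof (induction y rule: chain_induct)
    case (one b)
    show ?case by (induction z rule: chain_induct) (simp_all add: linear)
  qed (simp_all add: linear)
qed (simp_all add: linear)

lemma hom_chain2_cong: "even (d + e) \<Longrightarrow> hom_chain2 d x = hom_chain2 e x"
  unfolding hom_chain2_def by auto

lemma hom_chain_of [simp]: "hom_chain (fdim u) (frag_of u)"
  by (simp add: hom_chain_def)

text \<open>The sign is that of moving \<open>x'\<close> past \<open>y\<close>, so it is determined
  by the degrees of these two factors.\<close>

lemma bar_tensor:
  assumes "hom_chain d x'" "hom_chain e y"
  shows "bar (tensor x y) (tensor x' y') = frag_cmul ((-1) ^ (d * e)) (tensor (cat x x') (cat y y'))"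
proof (induction x rule: chain_induct)
  case (one a)
  show ?case
  proof (induction y rule: chain_induct)
    case (one b)
    from assms(2) one have b: "even (fdim b + e)" by (simp add: hom_chain_def)
    show ?case
    proof (induction x' rule: chain_induct)
      case (one a')
      from assms(1) one have "even (fdim a' + d)" by (simp add: hom_chain_def)
      with b have s: "(-1::int) ^ (d * e) = (-1) ^ (fdim a' * fdim b)"
        by (intro neg_one_power_cong) auto
      show ?case
        by (induction y' rule: chain_induct) (simp_all add: linear bar_of s frag_cmul_minus)
    qed (simp_all add: linear frag_cmul_minus)
  qed (simp_all add: linear frag_cmul_minus)
qed (simp_all add: linear frag_cmul_minus)

section \<open>The boundary as a derivation of concatenation\<close>

definition split_block :: "nat set \<Rightarrow> chain" where
  "split_block U = (\<Sum>M\<in>{M. M \<noteq> {} \<and> M \<subset> U}.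
     frag_cmul ((-1) ^ card M * shuff M (U - M)) (frag_of [M, U - M]))"

lemma bd_face_Nil [simp]: "bd_face [] = 0"
  by (simp add: bd_face_def)

lemma bd_face_Cons:
  "bd_face (U # u) = cat (split_block U) (frag_of u)
     + frag_cmul ((-1) ^ (card U - 1)) (cat (frag_of [U]) (bd_face u))"
proof -
  have "bd_face (U # u) = cat (split_block U) (frag_of u) + (\<Sum>k<length u. \<Sum>M\<in>{M. M \<noteq> {} \<and> M \<subset> u ! k}.
     frag_cmul ((-1) ^ (fdim (take (Suc k) (U # u)) + card M) * shuff M (u ! k - M))
       (frag_of (U # take k u @ [M, u ! k - M] @ drop (Suc k) u)))"
    unfolding bd_face_def by (simp add: sum.lessThan_Suc_shift split_block_def linear del: sum.lessThan_Suc)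
  also have "(\<Sum>k<length u. \<Sum>M\<in>{M. M \<noteq> {} \<and> M \<subset> u ! k}.
     frag_cmul ((-1) ^ (fdim (take (Suc k) (U # u)) + card M) * shuff M (u ! k - M))
       (frag_of (U # take k u @ [M, u ! k - M] @ drop (Suc k) u)))
     = frag_cmul ((-1) ^ (card U - 1)) (cat (frag_of [U]) (bd_face u))"
    by (simp add: bd_face_def linear frag_cmul_sum fdim_Cons power_add mult_ac)
  finally show ?thesis .
qed

lemma bd_face_singleton: "bd_face [U] = split_block U"
proof -
  have "cat x (frag_of []) = x" for x
    by (induction x rule: chain_induct) (simp_all add: linear)
  then show ?thesis by (simp add: bd_face_Cons linear)
qed

text \<open>For a block of \<open>v\<close>, the blocks preceding it now include all of
  \<open>u\<close>, which shifts the exponent of its sign by \<open>fdim u\<close>.\<close>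

lemma bd_face_append:
  "bd_face (u @ v) = cat (bd_face u) (frag_of v)
     + frag_cmul ((-1) ^ fdim u) (cat (frag_of u) (bd_face v))"
proof (induction u)
  case Nil
  have "cat (frag_of []) x = x" for x
    by (induction x rule: chain_induct) (simp_all add: linear)
  then show ?case by (simp add: linear)
next
  case (Cons U u)
  have *: "cat (frag_of [U]) (cat (frag_of u) x) = cat (frag_of (U # u)) x" for x
    by (metis append_Cons append_Nil cat_assoc cat_of)
  show ?case
    by (simp add: bd_face_Cons Cons linear cat_assoc[symmetric] frag_cmul_distrib2 fdim_Cons power_add)
      (simp add: cat_assoc * linear)
qed

lemma hom_chain_add: "hom_chain d x \<Longrightarrow> hom_chain d y \<Longrightarrow> hom_chain d (x + y)"
  unfolding hom_chain_def using keys_add[of x y] by blast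

lemma hom_chain_cmul: "hom_chain d x \<Longrightarrow> hom_chain d (frag_cmul c x)"
  unfolding hom_chain_def by auto

lemma hom_chain_sum: "(\<And>i. i \<in> I \<Longrightarrow> hom_chain d (f i)) \<Longrightarrow> hom_chain d (sum f I)"
  unfolding hom_chain_def using keys_sum[of f I] by blast

lemma keys_cat: "Poly_Mapping.keys (cat x y) \<subseteq> (\<lambda>(a, b). a @ b) ` (Poly_Mapping.keys x \<times> Poly_Mapping.keys y)"
  unfolding cat_def by (force dest!: subsetD[OF keys_frag_extend])

lemma hom_chain_cat:
  assumes "hom_chain d x" "hom_chain e y" shows "hom_chain (d + e) (cat x y)"
  unfolding hom_chain_def
proof
  fix u assume "u \<in> Poly_Mapping.keys (cat x y)"
  then have "u \<in> (\<lambda>(a, b). a @ b) ` (Poly_Mapping.keys x \<times> Poly_Mapping.keys y)"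
    by (rule subsetD[OF keys_cat])
  then obtain a b where "a \<in> Poly_Mapping.keys x" "b \<in> Poly_Mapping.keys y" "u = a @ b"
    by auto
  with assms show "even (fdim u + (d + e))" by (auto simp: hom_chain_def)
qed

text \<open>With finite non-empty blocks \<open>card B - 1\<close> is the true dimension of a block,
  without truncation, and splitting a block lowers the dimension by exactly one.\<close>

definition good_face :: "face \<Rightarrow> bool" where
  "good_face u \<longleftrightarrow> (\<forall>B\<in>set u. finite B \<and> B \<noteq> {})"

lemma good_face_simps [simp]:
  "good_face []" "good_face (U # u) \<longleftrightarrow> finite U \<and> U \<noteq> {} \<and> good_face u"
  "good_face (u @ v) \<longleftrightarrow> good_face u \<and> good_face v"
  by (auto simp: good_face_def)

lemma hom_chain_split_block:
  assumes "finite U" "U \<noteq> {}" shows "hom_chain (card U) (split_block U)"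
  unfolding split_block_def
proof (intro hom_chain_sum hom_chain_cmul)
  fix M assume M: "M \<in> {M. M \<noteq> {} \<and> M \<subset> U}"
  then have fM: "finite M" "finite (U - M)" "U - M \<noteq> {}" using assms finite_subset by auto
  have "card U = card M + card (U - M)"
    using M assms fM by (metis card_Diff_subset card_mono le_add_diff_inverse mem_Collect_eq psubset_imp_subset)
  moreover have "card M > 0" "card (U - M) > 0" using fM M by (auto simp: card_gt_0_iff)
  ultimately show "hom_chain (card U) (frag_of [M, U - M])"
    by (simp add: hom_chain_def fdim_Cons)
qed

lemma hom_chain_bd_face:
  "good_face u \<Longrightarrow> hom_chain (Suc (fdim u)) (bd_face u)"
proof (induction u)
  case (Cons U u)
  have c: "card U > 0" using Cons.prems by (auto simp: card_gt_0_iff)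
  have "hom_chain (card U + fdim u) (cat (split_block U) (frag_of u))"
    using Cons.prems by (intro hom_chain_cat hom_chain_split_block) auto
  moreover have "hom_chain (fdim [U] + Suc (fdim u)) (cat (frag_of [U]) (bd_face u))"
    using Cons by (intro hom_chain_cat) auto
  ultimately show ?case
    using c unfolding bd_face_Cons
    by (intro hom_chain_add hom_chain_cmul) (simp_all add: fdim_Cons)
qed (simp add: hom_chain_def)

lemma frag_cmul_distribs: 
  "frag_cmul c (x + y) = frag_cmul c x + frag_cmul c y"
  "frag_cmul c (x - y) = frag_cmul c x - frag_cmul c y"
  by (simp_all add: frag_cmul_distrib2 frag_cmul_minus)

text \<open>The sign of \<open>bar\<close> involves only \<open>fdim a'\<close> and
  \<open>fdim b\<close>, so it changes exactly in the terms that differentiate \<open>a'\<close> or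
  \<open>b\<close>. These changes combine the derivation rules of the two tensor factors into a
  single rule for the total degree.\<close>

lemma bd2_bar_of:
  assumes "good_face b" "good_face a'"
  shows "bd2 (bar (frag_of (a, b)) (frag_of (a', b'))) = bar (bd2 (frag_of (a, b))) (frag_of (a', b'))
     + frag_cmul ((-1) ^ (fdim a + fdim b)) (bar (frag_of (a, b)) (bd2 (frag_of (a', b'))))"
proof -
  have e1: "bar (tensor (frag_of a) (bd_face b)) (frag_of (a', b'))
    = frag_cmul ((-1) ^ (fdim a' * Suc (fdim b))) (tensor (frag_of (a @ a')) (cat (bd_face b) (frag_of b')))"
    using bar_tensor[of "fdim a'" "frag_of a'" "Suc (fdim b)" "bd_face b" "frag_of a" "frag_of b'"]
      hom_chain_bd_face[OF assms(1)] by simp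
  have e2: "bar (tensor (bd_face a) (frag_of b)) (frag_of (a', b'))
    = frag_cmul ((-1) ^ (fdim a' * fdim b)) (tensor (cat (bd_face a) (frag_of a')) (frag_of (b @ b')))"
    using bar_tensor[of "fdim a'" "frag_of a'" "fdim b" "frag_of b" "bd_face a" "frag_of b'"] by simp
  have e3: "bar (frag_of (a, b)) (tensor (frag_of a') (bd_face b'))
    = frag_cmul ((-1) ^ (fdim a' * fdim b)) (tensor (frag_of (a @ a')) (cat (frag_of b) (bd_face b')))"
    using bar_tensor[of "fdim a'" "frag_of a'" "fdim b" "frag_of b" "frag_of a" "bd_face b'"] by simp
  have e4: "bar (frag_of (a, b)) (tensor (bd_face a') (frag_of b'))
    = frag_cmul ((-1) ^ (Suc (fdim a') * fdim b)) (tensor (cat (frag_of a) (bd_face a')) (frag_of (b @ b')))"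
    using bar_tensor[of "Suc (fdim a')" "bd_face a'" "fdim b" "frag_of b" "frag_of a" "frag_of b'"]
      hom_chain_bd_face[OF assms(2)] by simp
  show ?thesis
    by (simp add: bar_of bd2_of linear bd_face_append e1 e2 e3 e4 frag_cmul_distribs
        power_add algebra_simps)
qed

section \<open>Inserting the largest element\<close>

lemma bd_cat:
  assumes "hom_chain d x"
  shows "bd (cat x y) = cat (bd x) y + frag_cmul ((-1) ^ d) (cat x (bd y))"
proof (induction x rule: chain_induct)
  case (one a)
  then have s: "(-1::int) ^ d = (-1) ^ fdim a"
    using assms by (intro neg_one_power_cong) (auto simp: hom_chain_def)
  show ?case
    by (induction y rule: chain_induct) (simp_all add: linear bd_face_append s frag_cmul_distribs)
qed (simp_all add: linear frag_cmul_distribs)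

lemma bd2_tensor:
  assumes "hom_chain d x"
  shows "bd2 (tensor x y) = tensor (bd x) y + frag_cmul ((-1) ^ d) (tensor x (bd y))"
proof (induction x rule: chain_induct)
  case (one a)
  then have s: "(-1::int) ^ d = (-1) ^ fdim a"
    using assms by (intro neg_one_power_cong) (auto simp: hom_chain_def)
  show ?case
    by (induction y rule: chain_induct) (simp_all add: linear bd2_of s frag_cmul_distribs)
qed (simp_all add: linear frag_cmul_distribs)

lemma hom_chain_split:
  "x \<in> Poly_Mapping.keys c \<Longrightarrow> hom_chain d c \<Longrightarrow> (-1::int) ^ d = (-1) ^ fdim x"
  by (intro neg_one_power_cong) (auto simp: hom_chain_def)

lemma hom_chain2_split:
  "(a, b) \<in> Poly_Mapping.keys c \<Longrightarrow> hom_chain2 d c \<Longrightarrow> (-1::int) ^ d = (-1) ^ (fdim a + fdim b)"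
  by (intro neg_one_power_cong) (auto simp: hom_chain2_def)

lemma faces_good: "u \<in> faces S \<Longrightarrow> finite S \<Longrightarrow> good_face u"
  unfolding faces_def good_face_def partition_on_def by (auto intro: finite_subset)

lemma faces_bound: "u \<in> faces S \<Longrightarrow> \<forall>x\<in>S. x < m \<Longrightarrow> \<forall>B\<in>set u. \<forall>x\<in>B. x < m"
  unfolding faces_def partition_on_def by blast

lemma faces_Nil_iff: "u \<in> faces S \<Longrightarrow> u = [] \<longleftrightarrow> S = {}"
  unfolding faces_def partition_on_def by (cases u) auto

definition good_chain2 :: "chain2 \<Rightarrow> bool" where
  "good_chain2 x \<longleftrightarrow> (\<forall>z\<in>Poly_Mapping.keys x. good_face (fst z) \<and> good_face (snd z))"

lemma bd2_bar:
  assumes "hom_chain2 d x" "good_chain2 x" "good_chain2 y"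
  shows "bd2 (bar x y) = bar (bd2 x) y + frag_cmul ((-1) ^ d) (bar x (bd2 y))"
proof (induction x rule: chain_induct)
  case (one a)
  obtain a1 a2 where a: "a = (a1, a2)" by fastforce
  have s: "(-1::int) ^ d = (-1) ^ (fdim a1 + fdim a2)" and g: "good_face a2"
    using assms one a by (auto simp: hom_chain2_split good_chain2_def)
  show ?case
  proof (induction y rule: chain_induct)
    case (one b)
    obtain b1 b2 where b: "b = (b1, b2)" by fastforce
    then have "good_face b1"
      using assms one by (auto simp: good_chain2_def)
    then show ?case using a b s g bd2_bar_of by simp
  qed (simp_all add: linear frag_cmul_distribs)
qed (simp_all add: linear frag_cmul_distribs)

text \<open>The value at the empty face makes the recursion for the diagonal uniform in the splittings with
  an empty side.\<close>
definition ins :: "nat \<Rightarrow> nat \<Rightarrow> face \<Rightarrow> face" where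
  "ins m k u = (if u = [] then [{m}] else u[k := insert m (u ! k)])"

text \<open>The sign \<open>(-1)\<^bsup>dim\<^esup>\<close> of the blocks to the right makes this a derivation acting from the
  right.\<close>
definition insert_face :: "nat \<Rightarrow> face \<Rightarrow> chain" where
  "insert_face m u = (\<Sum>k<max 1 (length u).
     frag_cmul ((-1) ^ fdim (drop (Suc k) u)) (frag_of (ins m k u)))"

definition insert_chain :: "nat \<Rightarrow> chain \<Rightarrow> chain" where
  "insert_chain m = frag_extend (insert_face m)"

lemma insert_face_Nil: "insert_face m [] = frag_of [{m}]"
  by (simp add: insert_face_def ins_def)

lemma insert_face_singleton: "insert_face m [U] = frag_of [insert m U]"
  by (simp add: insert_face_def ins_def)

lemma insert_face_Cons:
  assumes "u \<noteq> []"
  shows "insert_face m (U # u) = frag_cmul ((-1) ^ fdim u) (frag_of (insert m U # u))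
     + cat (frag_of [U]) (insert_face m u)"
proof -
  have m: "max 1 (length (U # u)) = Suc (length u)" "max 1 (length u) = length u"
    using assms by (auto simp: Suc_le_eq max_def)
  show ?thesis
    using assms unfolding insert_face_def m
    by (simp add: sum.lessThan_Suc_shift linear ins_def del: sum.lessThan_Suc)
qed

text \<open>Both faces are non-empty because insertion into the empty face creates a new block,
  which would add a spurious term to the derivation rule.\<close>

lemma insert_face_append:
  assumes "u \<noteq> []" "v \<noteq> []"
  shows "insert_face m (u @ v) = frag_cmul ((-1) ^ fdim v) (cat (insert_face m u) (frag_of v))
     + cat (frag_of u) (insert_face m v)"
  using assms(1)
proof (induction u rule: list_nonempty_induct)
  case (single U)
  then show ?case using assms by (simp add: insert_face_Cons insert_face_singleton)
next
  case (cons U u)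
  have *: "cat (frag_of [U]) (cat (frag_of u) x) = cat (frag_of (U # u)) x" for x
    by (metis append_Cons append_Nil cat_assoc cat_of)
  show ?case using cons assms
    by (simp add: insert_face_Cons linear frag_cmul_distribs cat_assoc * power_add mult_ac)
qed

lemma insert_chain_of [simp]: "insert_chain m (frag_of u) = insert_face m u"
  by (simp add: insert_chain_def)

lemma insert_chain_linear [linear]:
  "insert_chain m 0 = 0" "insert_chain m (x + y) = insert_chain m x + insert_chain m y"
  "insert_chain m (x - y) = insert_chain m x - insert_chain m y"
  "insert_chain m (frag_cmul c x) = frag_cmul c (insert_chain m x)"
  "insert_chain m (sum g I) = (\<Sum>i\<in>I. insert_chain m (g i))"
  by (simp_all add: insert_chain_def frag_extend_linear)

lemma insert_chain_cat:
  assumes "[] \<notin> Poly_Mapping.keys x" "[] \<notin> Poly_Mapping.keys y" "hom_chain e y"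
  shows "insert_chain m (cat x y) = frag_cmul ((-1) ^ e) (cat (insert_chain m x) y)
     + cat x (insert_chain m y)"
proof (induction x rule: chain_induct)
  case (one a)
  then have a: "a \<noteq> []" using assms by auto
  show ?case
  proof (induction y rule: chain_induct)
    case (one b)
    then have "b \<noteq> []" "(-1::int) ^ e = (-1) ^ fdim b" using assms hom_chain_split by auto
    then show ?case using a by (simp add: insert_face_append)
  qed (simp_all add: linear frag_cmul_distribs)
qed (simp_all add: linear frag_cmul_distribs)

lemma keys_split_block: "Poly_Mapping.keys (split_block U) \<subseteq> {u. length u = 2}"
  unfolding split_block_def using keys_sum by fastforce

lemma keys_bd_face: "[] \<notin> Poly_Mapping.keys (bd_face u)"
  unfolding bd_face_def by (auto dest!: subsetD[OF keys_sum])

text \<open>A splitting of \<open>insert m U\<close> either adds \<open>m\<close> to one part of a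
  splitting of \<open>U\<close>, which yields the insertion, or splits off \<open>m\<close> alone,
  which yields the two correction terms. Since \<open>m\<close> is the largest element, in the first
  part it is inverted with every element of the second, and in the second part with nothing.\<close>

lemma split_block_insert:
  assumes U: "finite U" "U \<noteq> {}" and m: "\<forall>x\<in>U. x < m"
  shows "split_block (insert m U) = insert_chain m (split_block U)
     + frag_cmul ((-1) ^ (card U - 1)) (frag_of [{m}, U] - frag_of [U, {m}])"
proof -
  define P where "P = {M. M \<noteq> {} \<and> M \<subset> U}"
  define f where "f M = frag_cmul ((-1) ^ card M * shuff M (insert m U - M)) (frag_of [M, insert m U - M])" for M
  have mU: "m \<notin> U" using m by auto
  have fP: "finite P" unfolding P_def using U by (auto intro: finite_subset[of _ "Pow U"])
  have PU: "finite M \<and> finite (U - M) \<and> m \<notin> M \<and> M \<noteq> {} \<and> U - M \<noteq> {} \<and> M \<subset> U" if "M \<in> P" for M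
  proof -
    have "M \<subseteq> U" "M \<noteq> {}" "U - M \<noteq> {}" using that by (auto simp: P_def)
    moreover have "finite M" using \<open>M \<subseteq> U\<close> U by (auto intro: finite_subset)
    ultimately show ?thesis using mU U by auto
  qed
  have dec: "{M. M \<noteq> {} \<and> M \<subset> insert m U} = P \<union> insert m ` P \<union> {{m}, U}" (is "?L = ?R")
  proof (intro equalityI subsetI)
    fix M assume M: "M \<in> ?L"
    show "M \<in> ?R"
    proof (cases "m \<in> M")
      case True
      then have "M = insert m (M - {m})" by blast
      moreover have "M - {m} \<subset> U" using M True mU by blast
      ultimately show ?thesis unfolding P_def by (cases "M - {m} = {}") blast+
    next
      case False
      then show ?thesis using M unfolding P_def by blast
    qed
  next
    fix M assume "M \<in> ?R"
    then show "M \<in> ?L" using mU U unfolding P_def by auto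
  qed
  have "inj_on (insert m) P"
    by (rule inj_onI) (metis PU insert_ident)
  moreover have "P \<inter> insert m ` P = {}" "(P \<union> insert m ` P) \<inter> {{m}, U} = {}" "{m} \<noteq> U"
    using mU U by (auto simp: P_def)
  ultimately have "split_block (insert m U) = sum f P + (\<Sum>M\<in>P. f (insert m M)) + (f {m} + f U)"
    unfolding split_block_def dec f_def[symmetric] using fP
    by (simp add: sum.union_disjoint sum.reindex)
  also have "f {m} = frag_cmul ((-1) ^ (card U - 1)) (frag_of [{m}, U])"
  proof -
    have "crossings {m} U = card U" using crossings_insert_left_max[of "{}" U m] U m by simp
    moreover have "insert m U - {m} = U" using mU by auto
    moreover have "card U > 0" using U by (simp add: card_gt_0_iff)
    then have "(-1::int) ^ card U = - ((-1) ^ (card U - 1))"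
      by (metis Suc_diff_1 power_Suc mult_minus1)
    ultimately show ?thesis using U mU by (simp add: f_def shuff_crossings)
  qed
  also have "f U = - frag_cmul ((-1) ^ (card U - 1)) (frag_of [U, {m}])"
  proof -
    have "crossings U {m} = 0" using crossings_insert_right_max[of U m "{}"] m by simp
    moreover have "insert m U - U = {m}" using mU by auto
    moreover have "card U > 0" using U by (simp add: card_gt_0_iff)
    then have "(-1::int) ^ card U = - ((-1) ^ (card U - 1))"
      by (metis Suc_diff_1 power_Suc mult_minus1)
    ultimately show ?thesis using U mU by (simp add: f_def shuff_crossings)
  qed
  also have "sum f P + (\<Sum>M\<in>P. f (insert m M)) = insert_chain m (split_block U)"
  proof -
    have "f M + f (insert m M) = insert_chain m (frag_cmul ((-1) ^ card M * shuff M (U - M)) (frag_of [M, U - M]))"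
      if "M \<in> P" for M
    proof -
      note M = PU[OF that]
      have 1: "insert m U - M = insert m (U - M)" using M by auto
      have 2: "insert m U - insert m M = U - M" using mU by auto
      have c1: "crossings M (insert m (U - M)) = crossings M (U - M)"
        using M m by (intro crossings_insert_right_max) auto
      have c2: "crossings (insert m M) (U - M) = card (U - M) + crossings M (U - M)"
        using M m by (intro crossings_insert_left_max) auto
      \<comment> \<open>The exponent changes by \<open>card (U - M)\<close> for the inversions of
        \<open>m\<close> and by 1 for the larger first part. Together this is the dimension of the
        block to the right of \<open>m\<close>, the sign in \<open>insert_face\<close>.\<close>
      have "card (U - M) > 0" using M by (simp add: card_gt_0_iff)
      then have "(-1::int) ^ card (U - M) = - ((-1) ^ (card (U - M) - 1))"
        by (metis Suc_diff_1 power_Suc mult_minus1)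
      moreover have "shuff M (insert m (U - M)) = shuff M (U - M)"
        "shuff (insert m M) (U - M) = (-1) ^ card (U - M) * shuff M (U - M)"
        using M mU c1 c2 by (auto simp: shuff_crossings power_add)
      ultimately show ?thesis
        using M by (simp add: f_def 1 2 linear insert_face_Cons insert_face_singleton fdim_Cons
            frag_cmul_distribs mult_ac)
    qed
    then show ?thesis
      by (simp add: split_block_def linear P_def[symmetric] sum.distrib[symmetric])
  qed
  finally show ?thesis
    by (simp add: frag_cmul_distribs)
qed

text \<open>So inserting the largest element is a chain homotopy from right to left multiplication by it.\<close>
lemma bd_insert_face:
  assumes "good_face u" "\<forall>B\<in>set u. \<forall>x\<in>B. x < m" "u \<noteq> []"
  shows "bd (insert_face m u) = insert_chain m (bd_face u)
    + frag_cmul ((-1) ^ fdim u) (frag_of ({m} # u) - frag_of (u @ [{m}]))"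
  using assms(3,1,2)
proof (induction u rule: list_nonempty_induct)
  case (single U)
  then show ?case
    by (simp add: insert_face_singleton bd_face_singleton split_block_insert fdim_Cons)
next
  case (cons U u)
  then have IH: "bd (insert_face m u) = insert_chain m (bd_face u)
    + frag_cmul ((-1) ^ fdim u) (frag_of ({m} # u) - frag_of (u @ [{m}]))" by simp
  have U: "finite U" "U \<noteq> {}" "\<forall>x\<in>U. x < m" "m \<notin> U" using cons by auto
  have c: "card (insert m U) - Suc 0 = Suc (card U - Suc 0)"
    using U by (simp add: card_gt_0_iff)
  have k: "[] \<notin> Poly_Mapping.keys (split_block U)" using keys_split_block[of U] by auto
  have i1: "insert_chain m (cat (split_block U) (frag_of u)) = 
    frag_cmul ((-1) ^ fdim u) (cat (insert_chain m (split_block U)) (frag_of u))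
     + cat (split_block U) (insert_face m u)"
    using insert_chain_cat[of "split_block U" "frag_of u" "fdim u" m] k cons(1) by simp
  have i2: "insert_chain m (cat (frag_of [U]) (bd_face u)) = 
    frag_cmul ((-1) ^ Suc (fdim u)) (cat (frag_of [insert m U]) (bd_face u))
     + cat (frag_of [U]) (insert_chain m (bd_face u))"
    using insert_chain_cat[of "frag_of [U]" "bd_face u" "Suc (fdim u)" m] keys_bd_face
      hom_chain_bd_face[of u] cons by (simp add: insert_face_singleton)
  have b: "bd (cat (frag_of [U]) (insert_face m u)) = cat (split_block U) (insert_face m u)
     + frag_cmul ((-1) ^ (card U - 1)) (cat (frag_of [U]) (bd (insert_face m u)))"
    using bd_cat[OF hom_chain_of[of "[U]"]] by (simp add: bd_face_singleton fdim_Cons)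
  show ?case
    by (simp add: insert_face_Cons[OF cons(1)] linear bd_face_Cons i1 i2 b IH c fdim_Cons
        split_block_insert[OF U(1-3)] frag_cmul_distribs power_add algebra_simps)
qed

section \<open>Insertion in either tensor factor\<close>

definition ins_right :: "nat \<Rightarrow> chain2 \<Rightarrow> chain2" where
  "ins_right m = frag_extend (\<lambda>(a, b). tensor (frag_of a) (insert_face m b))"

text \<open>The operator acts from the right, so it passes \<open>b\<close> before it reaches
  \<open>a\<close>; this is the origin of the sign.\<close>

definition ins_left :: "nat \<Rightarrow> chain2 \<Rightarrow> chain2" where
  "ins_left m = frag_extend (\<lambda>(a, b). frag_cmul ((-1) ^ fdim b) (tensor (insert_face m a) (frag_of b)))"

lemma ins_right_linear [linear]:
  "ins_right m 0 = 0" "ins_right m (x + y) = ins_right m x + ins_right m y"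
  "ins_right m (x - y) = ins_right m x - ins_right m y"
  "ins_right m (frag_cmul c x) = frag_cmul c (ins_right m x)"
  "ins_right m (sum g I) = (\<Sum>i\<in>I. ins_right m (g i))"
  by (simp_all add: ins_right_def frag_extend_linear)

lemma ins_left_linear [linear]:
  "ins_left m 0 = 0" "ins_left m (x + y) = ins_left m x + ins_left m y"
  "ins_left m (x - y) = ins_left m x - ins_left m y"
  "ins_left m (frag_cmul c x) = frag_cmul c (ins_left m x)"
  "ins_left m (sum g I) = (\<Sum>i\<in>I. ins_left m (g i))"
  by (simp_all add: ins_left_def frag_extend_linear)

lemma ins_right_of: "ins_right m (frag_of (a, b)) = tensor (frag_of a) (insert_face m b)"
  by (simp add: ins_right_def)

lemma ins_left_of: "ins_left m (frag_of (a, b))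
    = frag_cmul ((-1) ^ fdim b) (tensor (insert_face m a) (frag_of b))"
  by (simp add: ins_left_def)

lemma ins_right_tensor: "ins_right m (tensor x y) = tensor x (insert_chain m y)"
proof (induction x rule: chain_induct)
  case (one a)
  show ?case by (induction y rule: chain_induct) (simp_all add: linear ins_right_of)
qed (simp_all add: linear)

lemma ins_left_tensor:
  assumes "hom_chain e y"
  shows "ins_left m (tensor x y) = frag_cmul ((-1) ^ e) (tensor (insert_chain m x) y)"
proof (induction x rule: chain_induct)
  case (one a)
  show ?case
  proof (induction y rule: chain_induct)
    case (one b)
    then show ?case using hom_chain_split[OF one assms] by (simp add: ins_left_of)
  qed (simp_all add: linear frag_cmul_distribs)
qed (simp_all add: linear frag_cmul_distribs)

text \<open>The empty face is exceptional: its insertion \<open>[{m}]\<close> has the same dimension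
  0.\<close>

lemma hom_chain_insert_face:
  assumes "u \<noteq> []" "good_face u" "\<forall>B\<in>set u. \<forall>x\<in>B. x < m"
  shows "hom_chain (Suc (fdim u)) (insert_face m u)"
  using assms
proof (induction u rule: list_nonempty_induct)
  case (single U)
  then have "m \<notin> U" "card U > 0" by (auto simp: card_gt_0_iff)
  then show ?case using single by (simp add: insert_face_singleton hom_chain_def fdim_Cons)
next
  case (cons U u)
  then have "m \<notin> U" "card U > 0" by (auto simp: card_gt_0_iff)
  then have "hom_chain (Suc (fdim (U # u))) (frag_of (insert m U # u))"
    using cons by (simp add: hom_chain_def fdim_Cons)
  moreover have "hom_chain (fdim [U] + Suc (fdim u)) (cat (frag_of [U]) (insert_face m u))"
    using cons by (intro hom_chain_cat) auto
  ultimately show ?case using cons unfolding insert_face_Cons[OF cons(1)]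
    by (intro hom_chain_add hom_chain_cmul) (simp_all add: fdim_Cons)
qed

text \<open>The sign of the commutator combines \<open>fdim b\<close> from
  \<open>bd_insert_face\<close> with \<open>fdim a\<close> from differentiating the second factor.
  As the block \<open>{m}\<close> has dimension 0, multiplying by it on either side costs no further
  sign.\<close>

lemma bd2_ins_right_of:
  assumes "good_face b" "\<forall>B\<in>set b. \<forall>x\<in>B. x < m" "b \<noteq> []"
  shows "bd2 (ins_right m (frag_of (a, b))) = ins_right m (bd2 (frag_of (a, b)))
    + frag_cmul ((-1) ^ (fdim a + fdim b)) (bar (frag_of ([], [{m}])) (frag_of (a, b))
        - bar (frag_of (a, b)) (frag_of ([], [{m}])))"
  using bd2_tensor[OF hom_chain_of[of a]] assms
  by (simp add: ins_right_of bd_insert_face bd2_of linear ins_right_tensor bar_of fdim_Cons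
      frag_cmul_distribs power_add algebra_simps)

lemma bd2_ins_left_of:
  assumes "good_face a" "\<forall>B\<in>set a. \<forall>x\<in>B. x < m" "a \<noteq> []" "good_face b"
  shows "bd2 (ins_left m (frag_of (a, b))) = ins_left m (bd2 (frag_of (a, b)))
    + frag_cmul ((-1) ^ (fdim a + fdim b)) (bar (frag_of ([{m}], [])) (frag_of (a, b))
        - bar (frag_of (a, b)) (frag_of ([{m}], [])))"
proof -
  have 1: "bd2 (tensor (insert_face m a) (frag_of b)) = tensor (bd (insert_face m a)) (frag_of b)
    + frag_cmul ((-1) ^ Suc (fdim a)) (tensor (insert_face m a) (bd_face b))"
    using bd2_tensor[OF hom_chain_insert_face[of a m]] assms by simp
  have 2: "ins_left m (tensor (frag_of a) (bd_face b))
    = frag_cmul ((-1) ^ Suc (fdim b)) (tensor (insert_face m a) (bd_face b))"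
    using ins_left_tensor[OF hom_chain_bd_face[OF assms(4)]] by simp
  have 3: "ins_left m (tensor (bd_face a) (frag_of b))
    = frag_cmul ((-1) ^ fdim b) (tensor (insert_chain m (bd_face a)) (frag_of b))"
    using ins_left_tensor[OF hom_chain_of] by simp
  show ?thesis
    using assms by (simp add: ins_left_of bd_insert_face bd2_of linear 1 2 3 bar_of fdim_Cons
      frag_cmul_distribs power_add algebra_simps)
qed

lemma ins_right_bar_of:
  assumes "good_face b" "\<forall>B\<in>set b. \<forall>x\<in>B. x < m" "b \<noteq> []" "b' \<noteq> []"
  shows "ins_right m (bar (frag_of (a, b)) (frag_of (a', b'))) =
    frag_cmul ((-1) ^ (fdim a' + fdim b')) (bar (ins_right m (frag_of (a, b))) (frag_of (a', b')))
    + bar (frag_of (a, b)) (ins_right m (frag_of (a', b')))"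
proof -
  have 1: "bar (tensor (frag_of a) (insert_face m b)) (frag_of (a', b')) =
     frag_cmul ((-1) ^ (fdim a' * Suc (fdim b))) (tensor (frag_of (a @ a')) (cat (insert_face m b) (frag_of b')))"
    using bar_tensor[of "fdim a'" "frag_of a'" _ _ "frag_of a" "frag_of b'", OF _ hom_chain_insert_face[of b m]]
      assms by simp
  have 2: "bar (frag_of (a, b)) (tensor (frag_of a') (insert_face m b')) =
     frag_cmul ((-1) ^ (fdim a' * fdim b)) (tensor (frag_of (a @ a')) (cat (frag_of b) (insert_face m b')))"
    using bar_tensor[of "fdim a'" "frag_of a'" "fdim b" "frag_of b" "frag_of a" "insert_face m b'"] by simp
  show ?thesis using assms
    by (simp add: ins_right_of bar_of linear 1 2 insert_face_append frag_cmul_distribs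
        power_add algebra_simps)
qed

lemma ins_left_bar_of:
  assumes "good_face a'" "\<forall>B\<in>set a'. \<forall>x\<in>B. x < m" "a \<noteq> []" "a' \<noteq> []"
  shows "ins_left m (bar (frag_of (a, b)) (frag_of (a', b'))) =
    frag_cmul ((-1) ^ (fdim a' + fdim b')) (bar (ins_left m (frag_of (a, b))) (frag_of (a', b')))
    + bar (frag_of (a, b)) (ins_left m (frag_of (a', b')))"
proof -
  have 1: "bar (tensor (insert_face m a) (frag_of b)) (frag_of (a', b')) =
     frag_cmul ((-1) ^ (fdim a' * fdim b)) (tensor (cat (insert_face m a) (frag_of a')) (frag_of (b @ b')))"
    using bar_tensor[of "fdim a'" "frag_of a'" "fdim b" "frag_of b" "insert_face m a" "frag_of b'"] by simp
  have 2: "bar (frag_of (a, b)) (tensor (insert_face m a') (frag_of b')) =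
     frag_cmul ((-1) ^ (Suc (fdim a') * fdim b)) (tensor (cat (frag_of a) (insert_face m a')) (frag_of (b @ b')))"
    using bar_tensor[of "Suc (fdim a')" "insert_face m a'" "fdim b" "frag_of b" "frag_of a" "frag_of b'"]
      hom_chain_insert_face[of a' m] assms by simp
  show ?thesis using assms
    by (simp add: ins_left_of bar_of linear 1 2 insert_face_append frag_cmul_distribs
        power_add algebra_simps)
qed

definition face_chains2 :: "nat set \<Rightarrow> chain2 set" where
  "face_chains2 S = {x. Poly_Mapping.keys x \<subseteq> faces S \<times> faces S}"

lemma face_chains2_face:
  assumes "x \<in> face_chains2 S" "(a, b) \<in> Poly_Mapping.keys x" "finite S" "S \<noteq> {}" "\<forall>x\<in>S. x < m"
  shows "good_face a" "\<forall>B\<in>set a. \<forall>x\<in>B. x < m" "a \<noteq> []" "good_face b" "\<forall>B\<in>set b. \<forall>x\<in>B. x < m" "b \<noteq> []"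
proof -
  have "a \<in> faces S" "b \<in> faces S" using assms(1,2) by (auto simp: face_chains2_def)
  then show "good_face a" "\<forall>B\<in>set a. \<forall>x\<in>B. x < m" "a \<noteq> []" "good_face b" "\<forall>B\<in>set b. \<forall>x\<in>B. x < m" "b \<noteq> []"
    using assms(3-5) faces_Nil_iff by (auto intro: faces_good faces_bound[rule_format])
qed

lemma bd2_ins_right:
  assumes "x \<in> face_chains2 S" "finite S" "S \<noteq> {}" "\<forall>x\<in>S. x < m" "hom_chain2 d x"
  shows "bd2 (ins_right m x) = ins_right m (bd2 x)
    + frag_cmul ((-1) ^ d) (bar (frag_of ([], [{m}])) x - bar x (frag_of ([], [{m}])))"
proof (induction x rule: chain_induct)
  case (one z)
  obtain a b where z: "z = (a, b)" by fastforce
  show ?case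
    using hom_chain2_split[of a b x d] bd2_ins_right_of[of b m a] face_chains2_face[OF assms(1) _ assms(2-4), of a b]
      one assms(5) by (simp add: z)
qed (simp_all add: linear frag_cmul_distribs)

lemma bd2_ins_left:
  assumes "x \<in> face_chains2 S" "finite S" "S \<noteq> {}" "\<forall>x\<in>S. x < m" "hom_chain2 d x"
  shows "bd2 (ins_left m x) = ins_left m (bd2 x)
    + frag_cmul ((-1) ^ d) (bar (frag_of ([{m}], [])) x - bar x (frag_of ([{m}], [])))"
proof (induction x rule: chain_induct)
  case (one z)
  obtain a b where z: "z = (a, b)" by fastforce
  show ?case
    using hom_chain2_split[of a b x d] bd2_ins_left_of[of a m b] face_chains2_face[OF assms(1) _ assms(2-4), of a b]
      one assms(5) by (simp add: z)
qed (simp_all add: linear frag_cmul_distribs)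

lemma ins_bar:
  assumes x: "x \<in> face_chains2 A" "finite A" "A \<noteq> {}" "\<forall>x\<in>A. x < m"
    and y: "y \<in> face_chains2 B" "finite B" "B \<noteq> {}" "\<forall>x\<in>B. x < m" and d: "hom_chain2 d y"
  shows "ins_right m (bar x y) = frag_cmul ((-1) ^ d) (bar (ins_right m x) y) + bar x (ins_right m y)" (is ?R)
    and "ins_left m (bar x y) = frag_cmul ((-1) ^ d) (bar (ins_left m x) y) + bar x (ins_left m y)" (is ?L)
proof -
  have "?R \<and> ?L"
  proof (induction x rule: chain_induct)
    case (one z)
    obtain a b where z: "z = (a, b)" by fastforce
    note ab = face_chains2_face[OF x(1) _ x(2-4), of a b, OF one[unfolded z]]
    show ?case
    proof (induction y rule: chain_induct)
      case (one z')
      obtain a' b' where z': "z' = (a', b')" by fastforce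
      note ab' = face_chains2_face[OF y(1) _ y(2-4), of a' b', OF one[unfolded z']]
      show ?case
        using hom_chain2_split[of a' b' y d] one d ab ab' ins_right_bar_of ins_left_bar_of
        by (simp add: z z')
    qed (simp_all add: linear frag_cmul_distribs)
  qed (simp_all add: linear frag_cmul_distribs)
  then show ?R ?L by auto
qed

text \<open>Ordered splittings of \<open>S\<close> into three parts, chosen by fixing first either
  the union of the first two parts or the first part.\<close>

lemma sum_Pow3:
  assumes "finite S"
  shows "(\<Sum>D\<in>Pow S. \<Sum>A\<in>Pow D. F A (D - A) (S - D)) =
     (\<Sum>A\<in>Pow S. \<Sum>B\<in>Pow (S - A). F A B (S - A - B))"
proof -
  have "(\<Sum>D\<in>Pow S. \<Sum>A\<in>Pow D. F A (D - A) (S - D)) =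
      (\<Sum>(D, A)\<in>Sigma (Pow S) Pow. F A (D - A) (S - D))"
    using assms by (subst sum.Sigma) (auto intro: finite_subset)
  also have "\<dots> = (\<Sum>(A, B)\<in>Sigma (Pow S) (\<lambda>A. Pow (S - A)). F A B (S - A - B))"
  proof (rule sum.reindex_bij_witness[of _ "\<lambda>(A, B). (A \<union> B, A)" "\<lambda>(D, A). (A, D - A)"])
    fix z assume "z \<in> Sigma (Pow S) Pow"
    then obtain D A where z: "z = (D, A)" "D \<subseteq> S" "A \<subseteq> D" by auto
    then have "S - A - (D - A) = S - D" by auto
    then show "(case case z of (D, A) \<Rightarrow> (A, D - A) of (A, B) \<Rightarrow> F A B (S - A - B)) =
       (case z of (D, A) \<Rightarrow> F A (D - A) (S - D))"
      by (simp add: z)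
  qed auto
  also have "\<dots> = (\<Sum>A\<in>Pow S. \<Sum>B\<in>Pow (S - A). F A B (S - A - B))"
    using assms by (subst sum.Sigma) (auto intro: finite_subset)
  finally show ?thesis .
qed

section \<open>The coderivation property from the recursion\<close>

text \<open>The commutator terms supply exactly the summands with \<open>A = {}\<close> of the first kind and with
  \<open>A = D\<close> of the second kind.\<close>
lemma bd2_insert_expand:
  assumes D: "finite D" and
    IH: "bd2 (\<Delta> D) = (\<Sum>A\<in>Pow D. frag_cmul (if A \<noteq> {} \<and> D - A \<noteq> {} then
        (-1) ^ (card A + crossings A (D - A)) else 0) (bar (\<Delta> A) (\<Delta> (D - A))))"
    and unit: "\<Delta> {} = frag_of ([], [])" "bd2 (J (\<Delta> {})) = 0"
    and J: "\<And>c x. J (frag_cmul c x) = frag_cmul c (J x)" "\<And>I (g :: nat set \<Rightarrow> chain2). J (sum g I) = (\<Sum>i\<in>I. J (g i))"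
    and comm: "D \<noteq> {} \<Longrightarrow> bd2 (J (\<Delta> D)) = J (bd2 (\<Delta> D))
       + frag_cmul ((-1) ^ Suc (card D)) (bar (J (\<Delta> {})) (\<Delta> D) - bar (\<Delta> D) (J (\<Delta> {})))"
    and der: "\<And>A. A \<subseteq> D \<Longrightarrow> A \<noteq> {} \<Longrightarrow> D - A \<noteq> {} \<Longrightarrow> J (bar (\<Delta> A) (\<Delta> (D - A))) =
       frag_cmul ((-1) ^ Suc (card (D - A))) (bar (J (\<Delta> A)) (\<Delta> (D - A))) + bar (\<Delta> A) (J (\<Delta> (D - A)))"
  shows "bd2 (J (\<Delta> D)) = (\<Sum>A\<in>Pow D.
      frag_cmul (if A \<noteq> {} \<and> D - A = {} then 0 else (-1) ^ (Suc (card D) + crossings A (D - A)))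
        (bar (J (\<Delta> A)) (\<Delta> (D - A)))
    + frag_cmul (if A = {} \<and> D - A \<noteq> {} then 0 else (-1) ^ (card A + crossings A (D - A)))
        (bar (\<Delta> A) (J (\<Delta> (D - A)))))" (is "_ = (\<Sum>A\<in>Pow D. ?t A)")
proof (cases "D = {}")
  case True
  then show ?thesis using unit by simp
next
  case False
  let ?J0 = "J (\<Delta> {})"
  have "J (frag_cmul (if A \<noteq> {} \<and> D - A \<noteq> {} then (-1) ^ (card A + crossings A (D - A)) else 0)
       (bar (\<Delta> A) (\<Delta> (D - A))))
     = ?t A - (if A = {} then frag_cmul ((-1) ^ Suc (card D)) (bar ?J0 (\<Delta> D)) else 0)
      - (if A = D then frag_cmul ((-1) ^ card D) (bar (\<Delta> D) ?J0) else 0)" if A: "A \<in> Pow D" for A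
  proof -
    \<comment> \<open>If one side is empty, the coefficient in \<open>IH\<close> vanishes but
      \<open>?t A\<close> does not; the subtracted term compensates for this. Otherwise
      \<open>der\<close> applies.\<close>
    consider "A = {}" | "A = D" | "A \<noteq> {}" "D - A \<noteq> {}" using A by auto
    then show ?thesis
    proof cases
      case 1 then show ?thesis using False J(1)[of 0] by (simp add: unit)
    next
      case 2 then show ?thesis using False J(1)[of 0] by (simp add: unit)
    next
      case 3
      have "card D = card A + card (D - A)"
        using A D by (metis PowD card_Diff_subset card_mono finite_subset le_add_diff_inverse)
      then show ?thesis using 3 A by (simp add: J der frag_cmul_distribs power_add mult_ac)
    qed
  qed
  then have "J (bd2 (\<Delta> D)) = (\<Sum>A\<in>Pow D. ?t A
      - (if A = {} then frag_cmul ((-1) ^ Suc (card D)) (bar ?J0 (\<Delta> D)) else 0)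
      - (if A = D then frag_cmul ((-1) ^ card D) (bar (\<Delta> D) ?J0) else 0))"
    unfolding IH J(2) by (intro sum.cong refl)
  also have "\<dots> = (\<Sum>A\<in>Pow D. ?t A) - frag_cmul ((-1) ^ Suc (card D)) (bar ?J0 (\<Delta> D))
      - frag_cmul ((-1) ^ card D) (bar (\<Delta> D) ?J0)"
    using D by (simp add: sum_subtractf sum.delta)
  finally show ?thesis
    using comm[OF False] by (simp add: frag_cmul_distribs)
qed

lemma frag_cmul_cancel:
  "frag_cmul c x + frag_cmul (- c) x = 0" "frag_cmul (- c) x + frag_cmul c x = 0"
  "frag_cmul c x + (frag_cmul (- c) x + y) = y" "frag_cmul (- c) x + (frag_cmul c x + y) = y"
  by (simp_all add: poly_mapping_eqI lookup_add)

text \<open>Both sides count the crossings between any two of the three parts. This cocycle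
  condition makes the shuffle signs compatible with either bracketing of a threefold
  product.\<close>

lemma crossings3:
  assumes "finite S" "A \<subseteq> S" "B \<subseteq> S - A"
  shows "crossings (A \<union> B) (S - A - B) + crossings A B = crossings A (S - A) + crossings B (S - A - B)"
proof -
  have f: "finite A" "finite B" "finite (S - A - B)"
    using assms by (auto intro: finite_subset)
  have "crossings A (B \<union> (S - A - B)) = crossings A B + crossings A (S - A - B)"
    using f assms by (intro crossings_Un_right) auto
  moreover have "B \<union> (S - A - B) = S - A" using assms by auto
  moreover have "crossings (A \<union> B) (S - A - B) = crossings A (S - A - B) + crossings B (S - A - B)"
    using f assms by (intro crossings_Un_left) auto
  ultimately show ?thesis by simp
qed

lemma bd2_single_entries: "bd2 (frag_of ([], [{m}])) = 0" "bd2 (frag_of ([{m}], [])) = 0"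
  "bd2 (frag_of ([], [])) = 0"
proof -
  have "{M. M \<noteq> {} \<and> M \<subset> {m}} = {}" by auto
  then have "split_block {m} = 0" unfolding split_block_def by (simp only: sum.empty)
  then show "bd2 (frag_of ([], [{m}])) = 0" "bd2 (frag_of ([{m}], [])) = 0"
    "bd2 (frag_of ([], [])) = 0"
    by (simp_all add: bd2_of bd_face_singleton linear)
qed

lemma keys_tensor: "Poly_Mapping.keys (tensor x y) \<subseteq> Poly_Mapping.keys x \<times> Poly_Mapping.keys y"
  unfolding tensor_def by (force dest!: subsetD[OF keys_frag_extend])

lemma keys_insert_face:
  "v \<in> Poly_Mapping.keys (insert_face m u) \<Longrightarrow> \<exists>k<max 1 (length u). v = ins m k u"
  unfolding insert_face_def by (auto dest!: subsetD[OF keys_sum])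

lemma good_face_ins:
  assumes "good_face u" "k < max 1 (length u)" shows "good_face (ins m k u)"
  using assms unfolding good_face_def ins_def
  by (auto dest!: subsetD[OF set_update_subset_insert] simp: max_def split: if_splits)

lemma keys_ins_right:
  "z \<in> Poly_Mapping.keys (ins_right m x) \<Longrightarrow>
     \<exists>a b. (a, b) \<in> Poly_Mapping.keys x \<and> fst z = a \<and> snd z \<in> Poly_Mapping.keys (insert_face m b)"
  unfolding ins_right_def by (force dest!: subsetD[OF keys_frag_extend] subsetD[OF keys_tensor])

lemma keys_ins_left:
  "z \<in> Poly_Mapping.keys (ins_left m x) \<Longrightarrow>
     \<exists>a b. (a, b) \<in> Poly_Mapping.keys x \<and> snd z = b \<and> fst z \<in> Poly_Mapping.keys (insert_face m a)"
  unfolding ins_left_def by (force dest!: subsetD[OF keys_frag_extend] subsetD[OF keys_tensor])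

lemma good_chain2_ins:
  assumes "good_chain2 x"
  shows "good_chain2 (ins_right m x)" "good_chain2 (ins_left m x)"
  using assms unfolding good_chain2_def
  by (force dest!: keys_ins_right keys_ins_left keys_insert_face intro!: good_face_ins)+

lemma hom_chain2_ins:
  assumes x: "x \<in> face_chains2 S" "finite S" "S \<noteq> {}" "\<forall>x\<in>S. x < m" and d: "hom_chain2 d x"
  shows "hom_chain2 (Suc d) (ins_right m x)" "hom_chain2 (Suc d) (ins_left m x)"
proof -
  note ab = face_chains2_face[OF x(1) _ x(2-4)]
  have h: "hom_chain (Suc (fdim a)) (insert_face m a)" "hom_chain (Suc (fdim b)) (insert_face m b)"
    if "(a, b) \<in> Poly_Mapping.keys x" for a b
    using ab[OF that] by (auto intro: hom_chain_insert_face)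
  show "hom_chain2 (Suc d) (ins_right m x)" "hom_chain2 (Suc d) (ins_left m x)"
    using d h unfolding hom_chain2_def hom_chain_def
    by (fastforce dest!: keys_ins_right keys_ins_left)+
qed

lemma face_chains2_good:
  "x \<in> face_chains2 S \<Longrightarrow> finite S \<Longrightarrow> good_chain2 x"
  unfolding face_chains2_def good_chain2_def by (auto dest!: subsetD intro: faces_good)

lemma card_Pow_split: "finite S \<Longrightarrow> A \<subseteq> S \<Longrightarrow> card S = card A + card (S - A)"
  by (metis card_Diff_subset card_mono finite_subset le_add_diff_inverse)

text \<open>Stated for an arbitrary solution of the recursion, so that matrices and words play no
  part. The right-hand side is the value of \<Delta> on the boundary of the cell \<open>S\<close>,
  each subset \<open>A\<close> standing for the facet \<open>A|S - A\<close>; the coefficients for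
  \<open>A = {}\<close> and \<open>A = S\<close>, which are not facets, are set to 0.\<close>

lemma recursive_diagonal_coderivation:
  fixes \<Delta> :: "nat set \<Rightarrow> chain2"
  assumes unit: "\<Delta> {} = frag_of ([], [])"
    and fc: "\<And>S. finite S \<Longrightarrow> \<Delta> S \<in> face_chains2 S"
    and hm: "\<And>S. finite S \<Longrightarrow> S \<noteq> {} \<Longrightarrow> hom_chain2 (Suc (card S)) (\<Delta> S)"
    and rec: "\<And>S m. finite S \<Longrightarrow> \<forall>x\<in>S. x < m \<Longrightarrow> \<Delta> (insert m S) =
      (\<Sum>A\<in>Pow S. frag_cmul ((-1) ^ crossings A (S - A))
         (bar (ins_right m (\<Delta> A)) (ins_left m (\<Delta> (S - A)))))"
    and "finite S"
  shows "bd2 (\<Delta> S) = (\<Sum>A\<in>Pow S. frag_cmul (if A \<noteq> {} \<and> S - A \<noteq> {} then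
        (-1) ^ (card A + crossings A (S - A)) else 0) (bar (\<Delta> A) (\<Delta> (S - A))))"
  using \<open>finite S\<close>
proof (induction "card S" arbitrary: S rule: less_induct)
  case less
  show ?case
  proof (cases "S = {}")
    case True
    then show ?thesis by (simp add: unit bd2_single_entries)
  next
    case False
    define m where "m = Max S"
    define T where "T = S - {m}"
    have "m \<in> S" using False less.prems by (simp add: m_def)
    then have S: "S = insert m T" by (auto simp: T_def)
    have "x < m" if "x \<in> T" for x
      using that less.prems Max_ge[of S x] by (auto simp: T_def m_def order.strict_iff_order)
    then have T: "finite T" "\<forall>x\<in>T. x < m" "m \<notin> T"
      using less.prems by (auto simp: T_def)
    have cT: "card T < card S" using S T by simp
    let ?f = "\<lambda>A. ins_right m (\<Delta> A)" and ?g = "\<lambda>A. ins_left m (\<Delta> A)"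
    have f0: "?f {} = frag_of ([], [{m}])" and g0: "?g {} = frag_of ([{m}], [])"
      by (simp_all add: unit ins_right_of ins_left_of insert_face_Nil)
    \<comment> \<open>For two empty parts \<open>c1\<close> and \<open>c2\<close> are -1 and 1 and
      their terms cancel, so the expansion also covers \<open>D = {}\<close>. Writing
      \<open>card A + card B\<close> for \<open>card D\<close> makes the coefficients functions of
      the parts, as \<open>sum_Pow3\<close> requires.\<close>
    define c1 :: "nat set \<Rightarrow> nat set \<Rightarrow> int" where
      "c1 A B = (if A \<noteq> {} \<and> B = {} then 0 else (-1) ^ (Suc (card A + card B) + crossings A B))" for A B
    define c2 :: "nat set \<Rightarrow> nat set \<Rightarrow> int" where
      "c2 A B = (if A = {} \<and> B \<noteq> {} then 0 else (-1) ^ (card A + crossings A B))" for A B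
    have fin: "finite A" if "A \<subseteq> T" for A using that T by (auto intro: finite_subset)
    have lt: "\<forall>x\<in>A. x < m" if "A \<subseteq> T" for A using that T by auto
    have IH: "bd2 (\<Delta> D) = (\<Sum>A\<in>Pow D. frag_cmul (if A \<noteq> {} \<and> D - A \<noteq> {} then
        (-1) ^ (card A + crossings A (D - A)) else 0) (bar (\<Delta> A) (\<Delta> (D - A))))" if "D \<subseteq> T" for D
      using that cT by (intro less.hyps fin) (meson T(1) card_mono le_less_trans)
    have bJ: "bd2 (J (\<Delta> D)) = (\<Sum>A\<in>Pow D. frag_cmul (c1 A (D - A)) (bar (J (\<Delta> A)) (\<Delta> (D - A)))
      + frag_cmul (c2 A (D - A)) (bar (\<Delta> A) (J (\<Delta> (D - A)))))"
      if DT: "D \<subseteq> T" and J: "J = ins_right m \<or> J = ins_left m" for D J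
    proof -
      note D = fin[OF DT]
      have "bd2 (J (\<Delta> D)) = (\<Sum>A\<in>Pow D.
        frag_cmul (if A \<noteq> {} \<and> D - A = {} then 0 else (-1) ^ (Suc (card D) + crossings A (D - A)))
          (bar (J (\<Delta> A)) (\<Delta> (D - A)))
        + frag_cmul (if A = {} \<and> D - A \<noteq> {} then 0 else (-1) ^ (card A + crossings A (D - A)))
          (bar (\<Delta> A) (J (\<Delta> (D - A)))))"
      proof (rule bd2_insert_expand[OF D IH[OF DT] unit])
        show "bd2 (J (\<Delta> {})) = 0" using J f0 g0 bd2_single_entries by metis
        show "bd2 (J (\<Delta> D)) = J (bd2 (\<Delta> D)) + frag_cmul ((- 1) ^ Suc (card D))
           (bar (J (\<Delta> {})) (\<Delta> D) - bar (\<Delta> D) (J (\<Delta> {})))" if "D \<noteq> {}"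
          using J bd2_ins_right[OF fc[OF D] D that lt[OF DT] hm[OF D that]]
            bd2_ins_left[OF fc[OF D] D that lt[OF DT] hm[OF D that]] f0 g0 by metis
        show "J (bar (\<Delta> A) (\<Delta> (D - A))) = frag_cmul ((- 1) ^ Suc (card (D - A)))
            (bar (J (\<Delta> A)) (\<Delta> (D - A))) + bar (\<Delta> A) (J (\<Delta> (D - A)))"
          if A: "A \<subseteq> D" "A \<noteq> {}" "D - A \<noteq> {}" for A
        proof -
          have "A \<subseteq> T" "D - A \<subseteq> T" using A DT by auto
          then have AT: "finite A" "\<forall>x\<in>A. x < m" "finite (D - A)" "\<forall>x\<in>D - A. x < m"
            using fin lt by blast+
          note ib = ins_bar[OF fc[OF AT(1)] AT(1) A(2) AT(2) fc[OF AT(3)] AT(3) A(3) AT(4) hm[OF AT(3) A(3)]]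
          show ?thesis using J ib by (elim disjE) simp_all
        qed
      qed (use J in \<open>auto simp: linear\<close>)
      also have "\<dots> = (\<Sum>A\<in>Pow D. frag_cmul (c1 A (D - A)) (bar (J (\<Delta> A)) (\<Delta> (D - A)))
      + frag_cmul (c2 A (D - A)) (bar (\<Delta> A) (J (\<Delta> (D - A)))))"
      proof (intro sum.cong refl)
        fix A assume "A \<in> Pow D"
        then have c: "card D = card A + card (D - A)" using card_Pow_split[OF D] by blast
        show "frag_cmul (if A \<noteq> {} \<and> D - A = {} then 0 else (-1) ^ (Suc (card D) + crossings A (D - A)))
          (bar (J (\<Delta> A)) (\<Delta> (D - A)))
        + frag_cmul (if A = {} \<and> D - A \<noteq> {} then 0 else (-1) ^ (card A + crossings A (D - A)))
          (bar (\<Delta> A) (J (\<Delta> (D - A)))) = frag_cmul (c1 A (D - A)) (bar (J (\<Delta> A)) (\<Delta> (D - A)))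
      + frag_cmul (c2 A (D - A)) (bar (\<Delta> A) (J (\<Delta> (D - A))))"
          unfolding c1_def c2_def c ..
      qed
      finally show ?thesis .
    qed
    note bf = bJ[OF _ disjI1[OF refl]] and bg = bJ[OF _ disjI2[OF refl]]
    \<comment> \<open>This holds uniformly in \<open>A\<close>: for non-empty \<open>A\<close> the
      insertion raises the degree \<open>card A - 1\<close> by one, and for \<open>A = {}\<close>
      the result \<open>([], [{m}])\<close> has degree 0.\<close>
    have hf: "hom_chain2 (card A) (?f A)" if "A \<subseteq> T" for A
    proof (cases "A = {}")
      case True
      then show ?thesis by (simp add: f0 hom_chain2_def fdim_Cons)
    next
      case False
      have "hom_chain2 (Suc (Suc (card A))) (?f A)"
        using fin[OF that] lt[OF that] False by (intro hom_chain2_ins(1)[where S = A] fc hm)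
      then show ?thesis by (subst hom_chain2_cong[of _ "Suc (Suc (card A))"]) auto
    qed
    have gd: "good_chain2 (?f A)" "good_chain2 (?g A)" if "A \<subseteq> T" for A
      using fc[OF fin[OF that]] fin[OF that] by (auto intro: good_chain2_ins face_chains2_good)
    let ?s = "\<lambda>A B. (-1 :: int) ^ crossings A B"
    have "bd2 (\<Delta> S) = (\<Sum>D\<in>Pow T. frag_cmul (?s D (T - D)) (bd2 (bar (?f D) (?g (T - D)))))"
      unfolding S using T by (simp add: rec linear)
    also have "\<dots> = (\<Sum>D\<in>Pow T. frag_cmul (?s D (T - D)) (bar (bd2 (?f D)) (?g (T - D))))
       + (\<Sum>D\<in>Pow T. frag_cmul (?s D (T - D) * (-1) ^ card D) (bar (?f D) (bd2 (?g (T - D)))))"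
      unfolding sum.distrib[symmetric]
    proof (intro sum.cong refl)
      fix D assume "D \<in> Pow T"
      then have "D \<subseteq> T" "T - D \<subseteq> T" by auto
      then show "frag_cmul (?s D (T - D)) (bd2 (bar (?f D) (?g (T - D)))) =
        frag_cmul (?s D (T - D)) (bar (bd2 (?f D)) (?g (T - D))) +
        frag_cmul (?s D (T - D) * (-1) ^ card D) (bar (?f D) (bd2 (?g (T - D))))"
        by (simp add: bd2_bar[OF hf gd] frag_cmul_distribs)
    qed
    also have "(\<Sum>D\<in>Pow T. frag_cmul (?s D (T - D)) (bar (bd2 (?f D)) (?g (T - D)))) =
       (\<Sum>A\<in>Pow T. \<Sum>B\<in>Pow (T - A). frag_cmul (?s (A \<union> B) (T - A - B) * c1 A B)
            (bar (bar (?f A) (\<Delta> B)) (?g (T - A - B)))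
          + frag_cmul (?s (A \<union> B) (T - A - B) * c2 A B)
            (bar (bar (\<Delta> A) (?f B)) (?g (T - A - B))))" (is "?l = ?r")
    proof -
      \<comment> \<open>\<open>D\<close> is written as \<open>A \<union> (D - A)\<close> so that the
        summand depends only on the three parts \<open>A\<close>, \<open>D - A\<close> and
        \<open>T - D\<close>.\<close>
      have "?l = (\<Sum>D\<in>Pow T. \<Sum>A\<in>Pow D. frag_cmul (?s (A \<union> (D - A)) (T - D) * c1 A (D - A))
            (bar (bar (?f A) (\<Delta> (D - A))) (?g (T - D)))
          + frag_cmul (?s (A \<union> (D - A)) (T - D) * c2 A (D - A))
            (bar (bar (\<Delta> A) (?f (D - A))) (?g (T - D))))"
      proof (intro sum.cong refl)
        fix D assume D: "D \<in> Pow T"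
        then show "frag_cmul (?s D (T - D)) (bar (bd2 (?f D)) (?g (T - D))) =
          (\<Sum>A\<in>Pow D. frag_cmul (?s (A \<union> (D - A)) (T - D) * c1 A (D - A))
            (bar (bar (?f A) (\<Delta> (D - A))) (?g (T - D)))
          + frag_cmul (?s (A \<union> (D - A)) (T - D) * c2 A (D - A))
            (bar (bar (\<Delta> A) (?f (D - A))) (?g (T - D))))"
          using D by (auto simp: bf linear frag_cmul_sum frag_cmul_distribs Un_absorb1 intro!: sum.cong)
      qed
      also have "\<dots> = ?r"
        by (rule sum_Pow3[OF T(1)])
      finally show ?thesis .
    qed
    also have "(\<Sum>D\<in>Pow T. frag_cmul (?s D (T - D) * (-1) ^ card D) (bar (?f D) (bd2 (?g (T - D))))) =
       (\<Sum>A\<in>Pow T. \<Sum>B\<in>Pow (T - A). frag_cmul (?s A (T - A) * (-1) ^ card A * c1 B (T - A - B))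
            (bar (?f A) (bar (?g B) (\<Delta> (T - A - B))))
          + frag_cmul (?s A (T - A) * (-1) ^ card A * c2 B (T - A - B))
            (bar (?f A) (bar (\<Delta> B) (?g (T - A - B)))))"
      by (intro sum.cong refl) (simp add: bg linear frag_cmul_sum frag_cmul_distribs)
    \<comment> \<open>The products \<open>?f A | \<Delta> B | ?g C\<close> occur in both sums with
      opposite signs. In the remaining ones the insertions are adjacent: \<open>?f B | ?g C\<close>
      summed over \<open>B\<close> is the recursion for \<open>insert m (T - A)\<close>, and
      \<open>?f A | ?g B\<close> is the one for \<open>insert m (A \<union> B)\<close>.\<close>
    also have "?r + \<dots> =
       (\<Sum>A\<in>Pow T. \<Sum>B\<in>Pow (T - A).
          frag_cmul (if A = {} then 0 else (-1) ^ (card A + crossings A (T - A)))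
            (frag_cmul (?s B (T - A - B)) (bar (\<Delta> A) (bar (?f B) (?g (T - A - B)))))
        + frag_cmul (if T - A - B = {} then 0 else (-1) ^ (Suc (card T) + crossings (A \<union> B) (T - A - B)))
            (frag_cmul (?s A B) (bar (bar (?f A) (?g B)) (\<Delta> (T - A - B)))))"
      unfolding sum.distrib[symmetric]
    proof (intro sum.cong refl)
      fix A B assume AB: "A \<in> Pow T" "B \<in> Pow (T - A)"
      define C where "C = T - A - B"
      have c: "card T = card A + card B + card C"
        using AB card_Pow_split[OF T(1), of A] card_Pow_split[of "T - A" B] T(1) by (auto simp: C_def)
      have x: "crossings (A \<union> B) C + crossings A B = crossings A (T - A) + crossings B C"
        using AB T(1) unfolding C_def by (intro crossings3) auto
      then have s: "?s (A \<union> B) C * ?s A B = ?s A (T - A) * ?s B C"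
        by (simp only: power_add[symmetric])
      \<comment> \<open>Signs are their own inverses, so every coefficient can be expressed by the
        same three shuffle signs.\<close>
      then have s': "?s (A \<union> B) C = ?s A (T - A) * ?s B C * ?s A B"
        by (simp add: minus_one_power_iff split: if_splits)
      show "frag_cmul (?s (A \<union> B) (T - A - B) * c1 A B) (bar (bar (?f A) (\<Delta> B)) (?g (T - A - B)))
          + frag_cmul (?s (A \<union> B) (T - A - B) * c2 A B) (bar (bar (\<Delta> A) (?f B)) (?g (T - A - B)))
          + (frag_cmul (?s A (T - A) * (-1) ^ card A * c1 B (T - A - B))
            (bar (?f A) (bar (?g B) (\<Delta> (T - A - B))))
          + frag_cmul (?s A (T - A) * (-1) ^ card A * c2 B (T - A - B))
            (bar (?f A) (bar (\<Delta> B) (?g (T - A - B))))) =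
          frag_cmul (if A = {} then 0 else (-1) ^ (card A + crossings A (T - A)))
            (frag_cmul (?s B (T - A - B)) (bar (\<Delta> A) (bar (?f B) (?g (T - A - B)))))
        + frag_cmul (if T - A - B = {} then 0 else (-1) ^ (Suc (card T) + crossings (A \<union> B) (T - A - B)))
            (frag_cmul (?s A B) (bar (bar (?f A) (?g B)) (\<Delta> (T - A - B))))"
        \<comment> \<open>The coefficients depend on which parts are empty. For
          \<open>A = B = {}\<close>, for instance, the two terms of the first sum cancel each other,
          and the \<open>c2\<close> term of the second sum vanishes unless \<open>C\<close> is empty
          too.\<close>
        unfolding C_def[symmetric] c1_def c2_def power_add s' c bar_assoc
        by (cases "A = {}"; cases "B = {}"; cases "C = {}")
          (simp_all add: unit frag_cmul_cancel power_add algebra_simps power2_eq_square[symmetric] power_mult_distrib[symmetric])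
    qed
    also have "\<dots> = (\<Sum>A\<in>Pow T. frag_cmul (if A = {} then 0 else (-1) ^ (card A + crossings A (T - A)))
            (bar (\<Delta> A) (\<Delta> (insert m (T - A)))))
        + (\<Sum>A\<in>Pow T. frag_cmul (if T - A = {} then 0 else (-1) ^ (Suc (card T) + crossings A (T - A)))
            (bar (\<Delta> (insert m A)) (\<Delta> (T - A))))" (is "_ = ?p + ?q")
    proof -
      have p: "?p = (\<Sum>A\<in>Pow T. \<Sum>B\<in>Pow (T - A).
          frag_cmul (if A = {} then 0 else (-1) ^ (card A + crossings A (T - A)))
            (frag_cmul (?s B (T - A - B)) (bar (\<Delta> A) (bar (?f B) (?g (T - A - B))))))"
        using T(2) fin by (intro sum.cong refl) (simp add: rec linear frag_cmul_sum)
      have "?q = (\<Sum>D\<in>Pow T. \<Sum>A\<in>Pow D.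
          frag_cmul (if T - D = {} then 0 else (-1) ^ (Suc (card T) + crossings (A \<union> (D - A)) (T - D)))
            (frag_cmul (?s A (D - A)) (bar (bar (?f A) (?g (D - A))) (\<Delta> (T - D)))))"
      proof (intro sum.cong refl)
        fix D assume D: "D \<in> Pow T"
        then show "frag_cmul (if T - D = {} then 0 else (-1) ^ (Suc (card T) + crossings D (T - D)))
            (bar (\<Delta> (insert m D)) (\<Delta> (T - D))) = (\<Sum>A\<in>Pow D.
          frag_cmul (if T - D = {} then 0 else (-1) ^ (Suc (card T) + crossings (A \<union> (D - A)) (T - D)))
            (frag_cmul (?s A (D - A)) (bar (bar (?f A) (?g (D - A))) (\<Delta> (T - D)))))"
          using D lt fin by (auto simp: rec linear frag_cmul_sum Un_absorb1 intro!: sum.cong)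
      qed
      also have "\<dots> = (\<Sum>A\<in>Pow T. \<Sum>B\<in>Pow (T - A).
          frag_cmul (if T - A - B = {} then 0 else (-1) ^ (Suc (card T) + crossings (A \<union> B) (T - A - B)))
            (frag_cmul (?s A B) (bar (bar (?f A) (?g B)) (\<Delta> (T - A - B)))))"
        by (rule sum_Pow3[OF T(1)])
      finally show ?thesis by (simp only: p sum.distrib)
    qed
    also have "\<dots> = (\<Sum>A\<in>Pow S. frag_cmul (if A \<noteq> {} \<and> S - A \<noteq> {} then
        (-1) ^ (card A + crossings A (S - A)) else 0) (bar (\<Delta> A) (\<Delta> (S - A))))"
    proof -
      let ?t = "\<lambda>A. frag_cmul (if A \<noteq> {} \<and> S - A \<noteq> {} then
        (-1) ^ (card A + crossings A (S - A)) else 0) (bar (\<Delta> A) (\<Delta> (S - A)))"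
      \<comment> \<open>Subsets without \<open>m\<close> give \<open>?p\<close> and those with
        \<open>m\<close> give \<open>?q\<close>; the subsets \<open>{}\<close> and \<open>S\<close>
        have coefficient 0 on both sides.\<close>
      have "sum ?t (Pow S) = sum ?t (Pow T) + sum ?t (insert m ` Pow T)"
        unfolding S Pow_insert using T by (intro sum.union_disjoint) auto
      also have "sum ?t (insert m ` Pow T) = (\<Sum>A\<in>Pow T. ?t (insert m A))"
        using T(3) by (subst sum.reindex) (auto simp: inj_on_def)
      also have "\<dots> = ?q"
      proof (intro sum.cong refl)
        fix A assume A: "A \<in> Pow T"
        have 1: "S - insert m A = T - A" using T S by auto
        have 2: "crossings (insert m A) (T - A) = card (T - A) + crossings A (T - A)"
          using A T fin by (intro crossings_insert_left_max) auto
        have 3: "card (insert m A) = Suc (card A)" "card T = card A + card (T - A)"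
          using A T(3) fin[of A] card_Pow_split[OF T(1), of A] by (auto simp: card_insert_if)
        show "?t (insert m A) = frag_cmul (if T - A = {} then 0 else (-1) ^ (Suc (card T) + crossings A (T - A)))
            (bar (\<Delta> (insert m A)) (\<Delta> (T - A)))"
          unfolding 1 2 3 by (simp add: add.assoc)
      qed
      also have "sum ?t (Pow T) = ?p"
      proof (intro sum.cong refl)
        fix A assume A: "A \<in> Pow T"
        have 1: "S - A = insert m (T - A)" using A T S by auto
        have 2: "crossings A (insert m (T - A)) = crossings A (T - A)"
          using A T by (intro crossings_insert_right_max) auto
        show "?t A = frag_cmul (if A = {} then 0 else (-1) ^ (card A + crossings A (T - A)))
            (bar (\<Delta> A) (\<Delta> (insert m (T - A))))"
          unfolding 1 2 by simp
      qed
      finally show ?thesis by simp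
    qed
    finally show ?thesis .
  qed
qed

section \<open>Step matrices as words\<close>

text \<open>A step matrix is encoded by the word \<open>w\<close> of its entries along the lattice path from the bottom
  left to the top right corner. Ascents are steps to the right and descents are steps upwards, so
  \<open>cix w x\<close> and \<open>rix w x\<close> are the column of \<open>x\<close> counted from the left and its row counted from below,
  both starting from 0.\<close>
fun asc :: "nat list \<Rightarrow> nat" where
  "asc (x # y # w) = (if x < y then 1 else 0) + asc (y # w)"
| "asc w = 0"

fun des :: "nat list \<Rightarrow> nat" where
  "des (x # y # w) = (if y < x then 1 else 0) + des (y # w)"
| "des w = 0"

definition cix :: "nat list \<Rightarrow> nat \<Rightarrow> nat" where
  "cix w x = asc (takeWhile (\<lambda>y. y \<noteq> x) w @ [x])"

definition rix :: "nat list \<Rightarrow> nat \<Rightarrow> nat" where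
  "rix w x = des (takeWhile (\<lambda>y. y \<noteq> x) w @ [x])"

text \<open>The empty word has no row and no column, whereas a single entry has one of each. This is
  the source of the expressions \<open>max 1\<close> below, which reserve a column or a row for
  \<open>m\<close> when a side of the cut is empty.\<close>

definition ncol :: "nat list \<Rightarrow> nat" where
  "ncol w = (if w = [] then 0 else Suc (asc w))"

definition nrow :: "nat list \<Rightarrow> nat" where
  "nrow w = (if w = [] then 0 else Suc (des w))"

lemma ncol_Nil [simp]: "ncol [] = 0" and nrow_Nil [simp]: "nrow [] = 0"
  by (simp_all add: ncol_def nrow_def)

lemma ncol_0_iff [simp]: "ncol w = 0 \<longleftrightarrow> w = []" and nrow_0_iff [simp]: "nrow w = 0 \<longleftrightarrow> w = []"
  by (simp_all add: ncol_def nrow_def)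

lemma asc_append: "asc (u @ y # v) = asc (u @ [y]) + asc (y # v)"
  by (induction u rule: asc.induct) simp_all

lemma des_append: "des (u @ y # v) = des (u @ [y]) + des (y # v)"
  by (induction u rule: des.induct) simp_all

lemma asc_max: "\<forall>x\<in>set v. x < m \<Longrightarrow> asc (m # v) = asc v"
  by (cases v) auto

lemma des_max: "\<forall>x\<in>set v. x < m \<Longrightarrow> v \<noteq> [] \<Longrightarrow> des (m # v) = Suc (des v)"
  by (cases v) auto

lemma asc_snoc_max: "\<forall>x\<in>set u. x < m \<Longrightarrow> asc (u @ [m]) = ncol u"
proof (cases u rule: rev_cases)
  case (snoc u' z)
  assume "\<forall>x\<in>set u. x < m"
  then show ?thesis using asc_append[of u' z "[m]"] snoc by (simp add: ncol_def)
qed simp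

lemma des_snoc_max: "\<forall>x\<in>set u. x < m \<Longrightarrow> des (u @ [m]) = des u"
proof (cases u rule: rev_cases)
  case (snoc u' z)
  assume "\<forall>x\<in>set u. x < m"
  then show ?thesis using des_append[of u' z "[m]"] snoc by simp
qed simp

text \<open>The step into \<open>m\<close> is an ascent and the step out of it a descent. So
  \<open>m\<close> opens a new column, which is also the first column of \<open>v\<close>, and it
  stays in the last row of \<open>u\<close>.\<close>

lemma ncol_peak:
  assumes "\<forall>x\<in>set u \<union> set v. x < m"
  shows "ncol (u @ m # v) = ncol u + max 1 (ncol v)"
  using assms asc_append[of u m v] asc_snoc_max[of u m] asc_max[of v m] by (auto simp: ncol_def)

lemma nrow_peak:
  assumes "\<forall>x\<in>set u \<union> set v. x < m"
  shows "nrow (u @ m # v) = max 1 (nrow u) + nrow v"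
  using assms des_append[of u m v] des_snoc_max[of u m] des_max[of v m] by (auto simp: nrow_def)

lemma ncol_nrow: "distinct w \<Longrightarrow> w \<noteq> [] \<Longrightarrow> ncol w + nrow w = Suc (length w)"
proof -
  have "distinct w \<Longrightarrow> w \<noteq> [] \<Longrightarrow> asc w + des w + 1 = length w"
    by (induction w rule: asc.induct) auto
  then show "distinct w \<Longrightarrow> w \<noteq> [] \<Longrightarrow> ncol w + nrow w = Suc (length w)"
    by (simp add: ncol_def nrow_def)
qed

lemma cix_append: "x \<in> set u \<Longrightarrow> cix (u @ v) x = cix u x"
  by (simp add: cix_def)

lemma rix_append: "x \<in> set u \<Longrightarrow> rix (u @ v) x = rix u x"
  by (simp add: rix_def)

lemma takeWhile_peak:
  "m \<notin> set u \<Longrightarrow> takeWhile (\<lambda>y. y \<noteq> m) (u @ m # v) = u"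
  "x \<notin> set u \<Longrightarrow> x \<noteq> m \<Longrightarrow> takeWhile (\<lambda>y. y \<noteq> x) (u @ m # v) = u @ m # takeWhile (\<lambda>y. y \<noteq> x) v"
  by (auto simp: takeWhile_append2 takeWhile_tail intro: trans[OF takeWhile_append2])

lemma cix_peak:
  assumes "distinct (u @ m # v)" "\<forall>x\<in>set u \<union> set v. x < m"
  shows "x \<in> set u \<Longrightarrow> cix (u @ m # v) x = cix u x"
    and "cix (u @ m # v) m = ncol u"
    and "x \<in> set v \<Longrightarrow> cix (u @ m # v) x = ncol u + cix v x"
proof -
  show "x \<in> set u \<Longrightarrow> cix (u @ m # v) x = cix u x" by (rule cix_append)
  show "cix (u @ m # v) m = ncol u"
    using assms by (simp add: cix_def takeWhile_peak asc_snoc_max)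
  assume x: "x \<in> set v"
  have "\<forall>y\<in>set (takeWhile (\<lambda>y. y \<noteq> x) v @ [x]). y < m"
    using assms x by (auto dest: set_takeWhileD)
  then show "cix (u @ m # v) x = ncol u + cix v x"
    using assms x asc_append[of u m "takeWhile (\<lambda>y. y \<noteq> x) v @ [x]"] asc_snoc_max[of u m]
    by (subst cix_def, subst takeWhile_peak) (auto simp: asc_max cix_def)
qed

lemma rix_peak:
  assumes "distinct (u @ m # v)" "\<forall>x\<in>set u \<union> set v. x < m"
  shows "x \<in> set u \<Longrightarrow> rix (u @ m # v) x = rix u x"
    and "rix (u @ m # v) m = max 1 (nrow u) - 1"
    and "x \<in> set v \<Longrightarrow> rix (u @ m # v) x = max 1 (nrow u) + rix v x"
proof -
  show "x \<in> set u \<Longrightarrow> rix (u @ m # v) x = rix u x" by (rule rix_append)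
  have d: "des u = max 1 (nrow u) - 1" by (simp add: nrow_def)
  then show "rix (u @ m # v) m = max 1 (nrow u) - 1"
    using assms by (simp add: rix_def takeWhile_peak des_snoc_max)
  assume x: "x \<in> set v"
  have "\<forall>y\<in>set (takeWhile (\<lambda>y. y \<noteq> x) v @ [x]). y < m"
    using assms x by (auto dest: set_takeWhileD)
  then have "des (m # takeWhile (\<lambda>y. y \<noteq> x) v @ [x]) = Suc (rix v x)"
    by (simp add: des_max rix_def)
  moreover have "Suc (des u) = max 1 (nrow u)" by (simp add: nrow_def)
  moreover have "rix (u @ m # v) x = des (u @ [m]) + des (m # takeWhile (\<lambda>y. y \<noteq> x) v @ [x])"
    using assms x des_append[of u m "takeWhile (\<lambda>y. y \<noteq> x) v @ [x]"]
    by (subst rix_def, subst takeWhile_peak) auto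
  ultimately show "rix (u @ m # v) x = max 1 (nrow u) + rix v x"
    using assms des_snoc_max[of u m] by simp
qed

lemma peak_split:
  fixes w :: "nat list"
  assumes "distinct w" "set w = insert m S" "\<forall>x\<in>S. x < m"
  obtains u v where "w = u @ m # v" "\<forall>x\<in>set u \<union> set v. x < m" "set u \<union> set v = S" "set u \<inter> set v = {}"
proof -
  obtain u v where w: "w = u @ m # v" using assms(2) by (metis insertI1 split_list)
  have "m \<notin> S" using assms(3) by (metis less_irrefl)
  moreover have "m \<notin> set u \<union> set v" "set u \<inter> set v = {}" "insert m (set u \<union> set v) = insert m S"
    using assms(1,2) w by auto
  ultimately have "set u \<union> set v = S" "set u \<inter> set v = {}" by (metis insert_ident)+
  then show ?thesis using that[OF w] assms(3) by simp
qed

text \<open>The recursion behind decreasing binary trees: a word without repetitions is its maximum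
  together with the words on either side. It is the induction used for the combinatorics of words
  below.\<close>

lemma peak_induct [consumes 1, case_names Nil peak]:
  fixes w :: "nat list"
  assumes "distinct w" and "P []"
    and step: "\<And>u m v. distinct (u @ m # v) \<Longrightarrow> \<forall>x\<in>set u \<union> set v. x < m \<Longrightarrow> P u \<Longrightarrow> P v \<Longrightarrow> P (u @ m # v)"
  shows "P w"
  using assms(1)
proof (induction "length w" arbitrary: w rule: less_induct)
  case less
  show ?case
  proof (cases "w = []")
    case False
    have "set w = insert (Max (set w)) (set w - {Max (set w)})"
      using False by (simp add: insert_absorb)
    moreover have "\<forall>x\<in>set w - {Max (set w)}. x < Max (set w)"
      by (auto simp: order.strict_iff_order)
    ultimately obtain u v where w: "w = u @ Max (set w) # v" "\<forall>x\<in>set u \<union> set v. x < Max (set w)"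
      using peak_split[OF less.prems] by metis
    define m where "m = Max (set w)"
    have w': "w = u @ m # v" "\<forall>x\<in>set u \<union> set v. x < m" using w by (simp_all add: m_def)
    show ?thesis
      unfolding w'(1) using less w' by (intro step) auto
  qed (simp add: \<open>P []\<close>)
qed

text \<open>\<open>\<phi> x\<close> and \<open>\<psi> x\<close> are the column and the row of \<open>x\<close> after all moves: on its way \<open>x\<close> has to
  exceed all entries of each set that it joins, and these conditions are independent for different \<open>x\<close>.\<close>
definition colok :: "nat list \<Rightarrow> (nat \<Rightarrow> nat) \<Rightarrow> bool" where
  "colok w \<phi> \<longleftrightarrow> (\<forall>x\<in>set w. cix w x \<le> \<phi> x \<and> \<phi> x < ncol w \<and>
     (\<forall>y\<in>set w. cix w x < cix w y \<and> cix w y \<le> \<phi> x \<longrightarrow> y < x))"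

definition rowok :: "nat list \<Rightarrow> (nat \<Rightarrow> nat) \<Rightarrow> bool" where
  "rowok w \<psi> \<longleftrightarrow> (\<forall>x\<in>set w. \<psi> x \<le> rix w x \<and>
     (\<forall>y\<in>set w. \<psi> x \<le> rix w y \<and> rix w y < rix w x \<longrightarrow> y < x))"

lemma cix_less_ncol: "distinct w \<Longrightarrow> x \<in> set w \<Longrightarrow> cix w x < ncol w"
  by (induction w rule: peak_induct) (auto simp: ncol_peak cix_peak)

lemma rix_less_nrow: "distinct w \<Longrightarrow> x \<in> set w \<Longrightarrow> rix w x < nrow w"
  by (induction w rule: peak_induct) (auto simp: nrow_peak rix_peak)

text \<open>The column numbered \<open>ncol u\<close> contains \<open>m\<close>, which stops every
  entry of \<open>u\<close>. Entries of \<open>v\<close> start at or beyond this column, and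
  \<open>m\<close> exceeds all entries of the columns that it can reach.\<close>

lemma colok_peak:
  assumes w: "distinct (u @ m # v)" "\<forall>x\<in>set u \<union> set v. x < m"
  shows "colok (u @ m # v) \<phi> \<longleftrightarrow> colok u \<phi> \<and> colok v (\<lambda>x. \<phi> x - ncol u) \<and>
    (\<forall>x\<in>set v. ncol u \<le> \<phi> x) \<and> ncol u \<le> \<phi> m \<and> \<phi> m < ncol u + max 1 (ncol v)" (is "?L \<longleftrightarrow> ?R")
proof
  note [simp] = cix_peak[OF w] ncol_peak[OF w(2)]
  have u: "cix u x < ncol u" if "x \<in> set u" for x using cix_less_ncol that w by auto
  have v: "cix v x < ncol v" if "x \<in> set v" for x using cix_less_ncol that w by auto
  have um: "x < m" "\<not> m < x" if "x \<in> set u" for x using that w by (auto simp: less_not_sym)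
  assume L: ?L
  have uL: "cix u x \<le> \<phi> x \<and> \<phi> x < ncol u \<and> (\<forall>y\<in>set u. cix u x < cix u y \<and> cix u y \<le> \<phi> x \<longrightarrow> y < x)"
    if x: "x \<in> set u" for x
  proof -
    have *: "cix (u @ m # v) x \<le> \<phi> x"
      "\<forall>y\<in>set (u @ m # v). cix (u @ m # v) x < cix (u @ m # v) y \<and> cix (u @ m # v) y \<le> \<phi> x \<longrightarrow> y < x"
      using bspec[OF L[unfolded colok_def], of x] x by auto
    \<comment> \<open>The instance \<open>y = m\<close>: reaching column \<open>ncol u\<close> would
      require \<open>m < x\<close>.\<close>
    from *(2) have "\<not> ncol u \<le> \<phi> x" using um[OF x] u[OF x] x by auto
    with * x show ?thesis by auto
  qed
  have vL: "ncol u \<le> \<phi> x \<and> cix v x \<le> \<phi> x - ncol u \<and> \<phi> x - ncol u < ncol v \<and>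
     (\<forall>y\<in>set v. cix v x < cix v y \<and> cix v y \<le> \<phi> x - ncol u \<longrightarrow> y < x)"
    if x: "x \<in> set v" for x
  proof -
    have "v \<noteq> []" using x by auto
    then have "max 1 (ncol v) = ncol v" by (simp add: ncol_def)
    then have *: "ncol u + cix v x \<le> \<phi> x" "\<phi> x < ncol u + ncol v"
      "\<forall>y\<in>set v. cix v x < cix v y \<and> ncol u + cix v y \<le> \<phi> x \<longrightarrow> y < x"
      using bspec[OF L[unfolded colok_def], of x] x by auto
    then show ?thesis by auto
  qed
  have "ncol u \<le> \<phi> m" "\<phi> m < ncol u + max 1 (ncol v)"
    using bspec[OF L[unfolded colok_def], of m] by auto
  then show ?R using uL vL unfolding colok_def by auto
next
  note [simp] = cix_peak[OF w] ncol_peak[OF w(2)]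
  have u: "cix u x < ncol u" if "x \<in> set u" for x using cix_less_ncol that w by auto
  assume R: ?R
  show ?L
    unfolding colok_def
  proof
    fix x assume "x \<in> set (u @ m # v)"
    then consider "x \<in> set u" | "x = m" | "x \<in> set v" by auto
    then show "cix (u @ m # v) x \<le> \<phi> x \<and> \<phi> x < ncol (u @ m # v) \<and>
     (\<forall>y\<in>set (u @ m # v). cix (u @ m # v) x < cix (u @ m # v) y \<and> cix (u @ m # v) y \<le> \<phi> x \<longrightarrow> y < x)"
    proof cases
      case 1
      then have "cix u x \<le> \<phi> x" "\<phi> x < ncol u"
        "\<forall>y\<in>set u. cix u x < cix u y \<and> cix u y \<le> \<phi> x \<longrightarrow> y < x"
        using R unfolding colok_def by auto
      then show ?thesis using 1 by auto
    next
      case 2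
      then show ?thesis using R w by auto
    next
      case 3
      then have "ncol u \<le> \<phi> x" "cix v x \<le> \<phi> x - ncol u" "\<phi> x - ncol u < ncol v"
        "\<forall>y\<in>set v. cix v x < cix v y \<and> cix v y \<le> \<phi> x - ncol u \<longrightarrow> y < x"
        using R unfolding colok_def by auto
      moreover from this have "\<forall>y\<in>set v. cix v x < cix v y \<and> ncol u + cix v y \<le> \<phi> x \<longrightarrow> y < x"
        by auto
      moreover have "\<not> ncol u + cix v x < cix u y" if "y \<in> set u" for y
        using u[OF that] by simp
      ultimately show ?thesis using 3 by auto
    qed
  qed
qed

text \<open>The mirror image of \<open>colok_peak\<close>: rows are counted from below and entries
  move down, so here \<open>m\<close> stops the entries of \<open>v\<close> and ranges over the rows
  of \<open>u\<close>.\<close>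

lemma rowok_peak:
  assumes w: "distinct (u @ m # v)" "\<forall>x\<in>set u \<union> set v. x < m"
  shows "rowok (u @ m # v) \<psi> \<longleftrightarrow> rowok u \<psi> \<and> rowok v (\<lambda>x. \<psi> x - max 1 (nrow u)) \<and>
    (\<forall>x\<in>set v. max 1 (nrow u) \<le> \<psi> x) \<and> \<psi> m < max 1 (nrow u)" (is "?L \<longleftrightarrow> ?R")
proof
  define q where "q = max 1 (nrow u)"
  have q: "q > 0" "nrow u \<le> q" by (auto simp: q_def)
  note [simp] = rix_peak[OF w, folded q_def] nrow_peak[OF w(2), folded q_def]
  have u: "rix u x < q" if "x \<in> set u" for x using rix_less_nrow[of u x] that w q by auto
  have vm: "x < m" "\<not> m < x" if "x \<in> set v" for x using that w by (auto simp: less_not_sym)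
  assume L: ?L
  have uL: "\<psi> x \<le> rix u x \<and> (\<forall>y\<in>set u. \<psi> x \<le> rix u y \<and> rix u y < rix u x \<longrightarrow> y < x)"
    if x: "x \<in> set u" for x
  proof -
    have "\<psi> x \<le> rix (u @ m # v) x"
      "\<forall>y\<in>set (u @ m # v). \<psi> x \<le> rix (u @ m # v) y \<and> rix (u @ m # v) y < rix (u @ m # v) x \<longrightarrow> y < x"
      using bspec[OF L[unfolded rowok_def], of x] x by auto
    with x show ?thesis by auto
  qed
  have vL: "q \<le> \<psi> x \<and> \<psi> x - q \<le> rix v x \<and>
     (\<forall>y\<in>set v. \<psi> x - q \<le> rix v y \<and> rix v y < rix v x \<longrightarrow> y < x)"
    if x: "x \<in> set v" for x
  proof -
    have *: "\<psi> x \<le> rix (u @ m # v) x"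
      "\<forall>y\<in>set (u @ m # v). \<psi> x \<le> rix (u @ m # v) y \<and> rix (u @ m # v) y < rix (u @ m # v) x \<longrightarrow> y < x"
      using bspec[OF L[unfolded rowok_def], of x] x by auto
    \<comment> \<open>The instance \<open>y = m\<close>, since \<open>m\<close> lies in row
      \<open>q - 1\<close>.\<close>
    from *(2) have "\<not> \<psi> x \<le> q - 1" using vm[OF x] x q by auto
    moreover from *(2) have "\<forall>y\<in>set v. \<psi> x \<le> q + rix v y \<and> rix v y < rix v x \<longrightarrow> y < x"
      using x by auto
    ultimately show ?thesis using x *(1) by auto
  qed
  have "\<psi> m < q" using bspec[OF L[unfolded rowok_def], of m] q by auto
  then show ?R using uL vL unfolding rowok_def q_def[symmetric] by auto
next
  define q where "q = max 1 (nrow u)"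
  have q: "q > 0" "nrow u \<le> q" by (auto simp: q_def)
  note [simp] = rix_peak[OF w, folded q_def] nrow_peak[OF w(2), folded q_def]
  have u: "rix u x < q" if "x \<in> set u" for x using rix_less_nrow[of u x] that w q by auto
  assume R: ?R
  show ?L
    unfolding rowok_def
  proof
    fix x assume "x \<in> set (u @ m # v)"
    then consider "x \<in> set u" | "x = m" | "x \<in> set v" by auto
    then show "\<psi> x \<le> rix (u @ m # v) x \<and>
     (\<forall>y\<in>set (u @ m # v). \<psi> x \<le> rix (u @ m # v) y \<and> rix (u @ m # v) y < rix (u @ m # v) x \<longrightarrow> y < x)"
    proof cases
      case 1
      then have "\<psi> x \<le> rix u x" "\<forall>y\<in>set u. \<psi> x \<le> rix u y \<and> rix u y < rix u x \<longrightarrow> y < x"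
        using R unfolding rowok_def by auto
      then show ?thesis using 1 u[OF 1] by auto
    next
      case 2
      have "\<psi> m < q" using R unfolding q_def by simp
      moreover have "\<forall>y\<in>set u \<union> set v. y < m" using w by simp
      ultimately show ?thesis using 2 by auto
    next
      case 3
      then have "q \<le> \<psi> x" "\<psi> x - q \<le> rix v x"
        "\<forall>y\<in>set v. \<psi> x - q \<le> rix v y \<and> rix v y < rix v x \<longrightarrow> y < x"
        using R unfolding rowok_def q_def[symmetric] by auto
      moreover from this have "\<forall>y\<in>set v. \<psi> x \<le> q + rix v y \<and> rix v y < rix v x \<longrightarrow> y < x"
        by auto
      moreover have "\<not> \<psi> x \<le> rix u y" if "y \<in> set u" for y
        using u[OF that] \<open>q \<le> \<psi> x\<close> by simp
      moreover have "\<not> \<psi> x \<le> q - 1" using \<open>q \<le> \<psi> x\<close> q by simp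
      ultimately show ?thesis using 3 by auto
    qed
  qed
qed

text \<open>The moves never empty a column. This supplies the non-empty blocks of the resulting face
  and the properness of the moved sets. The columns from \<open>ncol u\<close> on are filled by
  \<open>v\<close> if it is non-empty; otherwise there is only one, and it contains
  \<open>m\<close>.\<close>

lemma colok_surj:
  "distinct w \<Longrightarrow> colok w \<phi> \<Longrightarrow> j < ncol w \<Longrightarrow> \<exists>x\<in>set w. \<phi> x = j"
proof (induction w arbitrary: \<phi> j rule: peak_induct)
  case (peak u m v)
  note ok = peak(5)[unfolded colok_peak[OF peak(1,2)]]
  show ?case
  proof (cases "j < ncol u")
    case True
    then show ?thesis using peak(3)[of \<phi> j] ok by auto
  next
    case False
    show ?thesis
    proof (cases "v = []")
      case True
      then have "j = \<phi> m" using ok False peak(6) ncol_peak[OF peak(2)] by auto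
      then show ?thesis by auto
    next
      case v: False
      then have "max 1 (ncol v) = ncol v" by (simp add: ncol_def)
      then have "j - ncol u < ncol v" using peak(6) False ncol_peak[OF peak(2)] by auto
      then obtain x where "x \<in> set v" "\<phi> x - ncol u = j - ncol u" using peak(4) ok by blast
      moreover have "ncol u \<le> \<phi> x" using ok \<open>x \<in> set v\<close> by auto
      ultimately show ?thesis using False by (intro bexI[of _ x]) auto
    qed
  qed
qed simp

lemma rowok_surj:
  "distinct w \<Longrightarrow> rowok w \<psi> \<Longrightarrow> i < nrow w \<Longrightarrow> \<exists>x\<in>set w. \<psi> x = i"
proof (induction w arbitrary: \<psi> i rule: peak_induct)
  case (peak u m v)
  define q where "q = max 1 (nrow u)"
  note ok = peak(5)[unfolded rowok_peak[OF peak(1,2)], folded q_def]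
  show ?case
  proof (cases "i < q")
    case True
    show ?thesis
    proof (cases "u = []")
      case u: True
      then have "i = 0" "\<psi> m = 0" using ok True by (auto simp: q_def)
      then show ?thesis by auto
    next
      case False
      then have "i < nrow u" using True by (simp add: q_def nrow_def)
      then show ?thesis using peak(3)[of \<psi> i] ok by auto
    qed
  next
    case False
    then have "i - q < nrow v" using peak(6) nrow_peak[OF peak(2), folded q_def] by auto
    then obtain x where "x \<in> set v" "\<psi> x - q = i - q" using peak(4) ok by blast
    moreover have "q \<le> \<psi> x" using ok \<open>x \<in> set v\<close> by auto
    ultimately show ?thesis using False by (intro bexI[of _ x]) auto
  qed
qed simp

section \<open>Configurations of a word\<close>

definition face_of :: "nat \<Rightarrow> nat set \<Rightarrow> (nat \<Rightarrow> nat) \<Rightarrow> face" where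
  "face_of p S \<phi> = map (\<lambda>j. {x \<in> S. \<phi> x = j}) [0..<p]"

text \<open>The conditions on final columns and on final rows are independent, so the configurations
  derived from the step matrix of \<open>w\<close> correspond to pairs in
  \<open>cols w \<times> rows w\<close>.\<close>

definition cols :: "nat list \<Rightarrow> face set" where
  "cols w = {face_of (ncol w) (set w) \<phi> | \<phi>. colok w \<phi>}"

definition rows :: "nat list \<Rightarrow> face set" where
  "rows w = {face_of (nrow w) (set w) \<psi> | \<psi>. rowok w \<psi>}"

lemma length_face_of [simp]: "length (face_of p S \<phi>) = p"
  by (simp add: face_of_def)

lemma nth_face_of [simp]: "j < p \<Longrightarrow> face_of p S \<phi> ! j = {x \<in> S. \<phi> x = j}"
  by (simp add: face_of_def)

lemma face_of_cong: "(\<And>x. x \<in> S \<Longrightarrow> \<phi> x = \<psi> x) \<Longrightarrow> face_of p S \<phi> = face_of p S \<psi>"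
  unfolding face_of_def by (intro map_cong refl Collect_cong) auto

lemma face_of_inj:
  assumes "face_of p S \<phi> = face_of p S \<psi>" "\<forall>x\<in>S. \<phi> x < p" "x \<in> S"
  shows "\<phi> x = \<psi> x"
proof -
  have "{y \<in> S. \<phi> y = \<phi> x} = face_of p S \<psi> ! \<phi> x" using assms by (simp flip: assms(1))
  then have eq: "{y \<in> S. \<phi> y = \<phi> x} = {y \<in> S. \<psi> y = \<phi> x}" using assms(2,3) by simp
  have "x \<in> {y \<in> S. \<phi> y = \<phi> x}" using assms(3) by simp
  then have "x \<in> {y \<in> S. \<psi> y = \<phi> x}" unfolding eq .
  then show ?thesis by simp
qed

lemma face_of_faces:
  assumes "\<forall>x\<in>S. \<phi> x < p" "\<forall>j<p. \<exists>x\<in>S. \<phi> x = j"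
  shows "face_of p S \<phi> \<in> faces S"
proof -
  have "inj_on (\<lambda>j. {x \<in> S. \<phi> x = j}) {0..<p}"
  proof (rule inj_onI)
    fix i j assume "i \<in> {0..<p}" "j \<in> {0..<p}" "{x \<in> S. \<phi> x = i} = {x \<in> S. \<phi> x = j}"
    moreover from this obtain x where "x \<in> S" "\<phi> x = i" using assms(2) by auto
    ultimately show "i = j" by blast
  qed
  then have "distinct (face_of p S \<phi>)" by (simp add: face_of_def distinct_map)
  moreover have "partition_on S (set (face_of p S \<phi>))"
    unfolding partition_on_def disjoint_def face_of_def using assms by auto
  ultimately show ?thesis by (simp add: faces_def)
qed

lemma face_of_append:
  "face_of (p + p') S \<phi> = face_of p {x \<in> S. \<phi> x < p} \<phi> @ face_of p' {x \<in> S. p \<le> \<phi> x} (\<lambda>x. \<phi> x - p)"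
  by (rule nth_equalityI) (auto simp: nth_append)

lemma length_ins [simp]: "length (ins m k u) = max 1 (length u)"
  by (auto simp: ins_def max_def Suc_le_eq)

lemma face_of_insert:
  assumes "m \<notin> B" "\<phi> m < max 1 p" "p = 0 \<longrightarrow> B = {}"
  shows "face_of (max 1 p) (insert m B) \<phi> = ins m (\<phi> m) (face_of p B \<phi>)"
proof (cases "p = 0")
  case True
  then show ?thesis using assms by (auto simp: face_of_def ins_def)
next
  case False
  then have p: "max 1 p = p" by simp
  have ne: "face_of p B \<phi> \<noteq> []" using False by (simp add: face_of_def)
  show ?thesis unfolding p
  proof (rule nth_equalityI)
    fix i assume "i < length (face_of p (insert m B) \<phi>)"
    then have i: "i < p" by simp
    show "face_of p (insert m B) \<phi> ! i = ins m (\<phi> m) (face_of p B \<phi>) ! i"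
      using i assms(1,2) ne unfolding ins_def by (cases "i = \<phi> m") auto
  qed (use False in \<open>simp add: max_def\<close>)
qed

lemma cols_Nil [simp]: "cols [] = {[]}" and rows_Nil [simp]: "rows [] = {[]}"
  by (auto simp: cols_def rows_def face_of_def colok_def rowok_def)

lemma colok_bound: "colok w \<phi> \<Longrightarrow> x \<in> set w \<Longrightarrow> \<phi> x < ncol w"
  by (simp add: colok_def)

lemma rowok_bound: "distinct w \<Longrightarrow> rowok w \<psi> \<Longrightarrow> x \<in> set w \<Longrightarrow> \<psi> x < nrow w"
  unfolding rowok_def by (metis le_less_trans rix_less_nrow)

lemma face_of_peak_col:
  assumes w: "distinct (u @ m # v)" "\<forall>x\<in>set u \<union> set v. x < m" and ok: "colok (u @ m # v) \<phi>"
  shows "face_of (ncol (u @ m # v)) (set (u @ m # v)) \<phi> = face_of (ncol u) (set u) \<phi> @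
    ins m (\<phi> m - ncol u) (face_of (ncol v) (set v) (\<lambda>x. \<phi> x - ncol u))"
proof -
  note ok' = ok[unfolded colok_peak[OF w]]
  have u: "\<phi> x < ncol u" if "x \<in> set u" for x using ok' that colok_bound by blast
  have 1: "{x \<in> set (u @ m # v). \<phi> x < ncol u} = set u"
    using ok' u by (auto simp: not_less)
  have 2: "{x \<in> set (u @ m # v). ncol u \<le> \<phi> x} = insert m (set v)"
    using ok' u by (auto simp: not_less[symmetric])
  show ?thesis
    unfolding ncol_peak[OF w(2)] face_of_append 1 2
    using ok' w by (subst face_of_insert) auto
qed

lemma face_of_peak_row:
  assumes w: "distinct (u @ m # v)" "\<forall>x\<in>set u \<union> set v. x < m" and ok: "rowok (u @ m # v) \<psi>"
  shows "face_of (nrow (u @ m # v)) (set (u @ m # v)) \<psi> = ins m (\<psi> m) (face_of (nrow u) (set u) \<psi>) @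
     face_of (nrow v) (set v) (\<lambda>x. \<psi> x - max 1 (nrow u))"
proof -
  note ok' = ok[unfolded rowok_peak[OF w]]
  have u: "\<psi> x < max 1 (nrow u)" if "x \<in> set u" for x
    using rowok_bound[of u \<psi> x] ok' that w by auto
  have 1: "{x \<in> set (u @ m # v). \<psi> x < max 1 (nrow u)} = insert m (set u)"
    using ok' u by (auto simp del: max_less_iff_conj less_max_iff_disj simp: not_less)
  have 2: "{x \<in> set (u @ m # v). max 1 (nrow u) \<le> \<psi> x} = set v"
    using ok' u by (auto simp del: max.bounded_iff simp: not_less[symmetric])
  show ?thesis
    unfolding nrow_peak[OF w(2)] face_of_append 1 2
    using ok' w by (subst face_of_insert) auto
qed

lemma colok_cong: "(\<And>x. x \<in> set w \<Longrightarrow> \<phi> x = \<psi> x) \<Longrightarrow> colok w \<phi> \<longleftrightarrow> colok w \<psi>"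
  unfolding colok_def by (intro ball_cong refl) simp

lemma rowok_cong: "(\<And>x. x \<in> set w \<Longrightarrow> \<phi> x = \<psi> x) \<Longrightarrow> rowok w \<phi> \<longleftrightarrow> rowok w \<psi>"
  unfolding rowok_def by (intro ball_cong refl) simp

lemma cols_peak:
  assumes w: "distinct (u @ m # v)" "\<forall>x\<in>set u \<union> set v. x < m"
  shows "cols (u @ m # v) = (\<lambda>(a, a', k). a @ ins m k a') ` (cols u \<times> cols v \<times> {..<max 1 (ncol v)})"
proof (intro equalityI subsetI)
  fix c assume "c \<in> cols (u @ m # v)"
  then obtain \<phi> where \<phi>: "colok (u @ m # v) \<phi>" "c = face_of (ncol (u @ m # v)) (set (u @ m # v)) \<phi>"
    by (auto simp: cols_def)
  note ok = \<phi>(1)[unfolded colok_peak[OF w]]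
  have "\<phi> m - ncol u < max 1 (ncol v)" using ok by arith
  then show "c \<in> (\<lambda>(a, a', k). a @ ins m k a') ` (cols u \<times> cols v \<times> {..<max 1 (ncol v)})"
    unfolding \<phi>(2) face_of_peak_col[OF w \<phi>(1)] using ok
    by (intro image_eqI[where x = "(face_of (ncol u) (set u) \<phi>,
         face_of (ncol v) (set v) (\<lambda>x. \<phi> x - ncol u), \<phi> m - ncol u)"]) (auto simp: cols_def)
next
  fix c assume "c \<in> (\<lambda>(a, a', k). a @ ins m k a') ` (cols u \<times> cols v \<times> {..<max 1 (ncol v)})"
  then obtain \<phi>1 \<phi>2 k where c: "colok u \<phi>1" "colok v \<phi>2" "k < max 1 (ncol v)"
    "c = face_of (ncol u) (set u) \<phi>1 @ ins m k (face_of (ncol v) (set v) \<phi>2)"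
    by (auto simp: cols_def)
  define \<phi> where "\<phi> x = (if x \<in> set u then \<phi>1 x else if x = m then ncol u + k else ncol u + \<phi>2 x)" for x
  have 1: "colok u \<phi>" using c(1) by (subst colok_cong[of _ _ \<phi>1]) (auto simp: \<phi>_def)
  have 2: "colok v (\<lambda>x. \<phi> x - ncol u)" using c(2) w
    by (subst colok_cong[of _ _ \<phi>2]) (auto simp: \<phi>_def)
  have m: "\<phi> m = ncol u + k" using w by (simp add: \<phi>_def)
  have "ncol u \<le> \<phi> x" if "x \<in> set v" for x using that w by (auto simp: \<phi>_def)
  then have ok: "colok (u @ m # v) \<phi>"
    unfolding colok_peak[OF w] using 1 2 m c(3) by auto
  have "face_of (ncol u) (set u) \<phi>1 = face_of (ncol u) (set u) \<phi>"
    by (rule face_of_cong) (auto simp: \<phi>_def)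
  moreover have "face_of (ncol v) (set v) \<phi>2 = face_of (ncol v) (set v) (\<lambda>x. \<phi> x - ncol u)"
    using w by (intro face_of_cong) (auto simp: \<phi>_def)
  ultimately have "c = face_of (ncol (u @ m # v)) (set (u @ m # v)) \<phi>"
    unfolding face_of_peak_col[OF w ok] c(4) by (simp add: m)
  then show "c \<in> cols (u @ m # v)" using ok by (auto simp: cols_def)
qed

lemma rows_peak:
  assumes w: "distinct (u @ m # v)" "\<forall>x\<in>set u \<union> set v. x < m"
  shows "rows (u @ m # v) = (\<lambda>(b, b', l). ins m l b @ b') ` (rows u \<times> rows v \<times> {..<max 1 (nrow u)})"
proof (intro equalityI subsetI)
  fix c assume "c \<in> rows (u @ m # v)"
  then obtain \<psi> where \<psi>: "rowok (u @ m # v) \<psi>" "c = face_of (nrow (u @ m # v)) (set (u @ m # v)) \<psi>"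
    by (auto simp: rows_def)
  note ok = \<psi>(1)[unfolded rowok_peak[OF w]]
  show "c \<in> (\<lambda>(b, b', l). ins m l b @ b') ` (rows u \<times> rows v \<times> {..<max 1 (nrow u)})"
    unfolding \<psi>(2) face_of_peak_row[OF w \<psi>(1)] using ok
    by (intro image_eqI[where x = "(face_of (nrow u) (set u) \<psi>,
         face_of (nrow v) (set v) (\<lambda>x. \<psi> x - max 1 (nrow u)), \<psi> m)"]) (auto simp: rows_def)
next
  fix c assume "c \<in> (\<lambda>(b, b', l). ins m l b @ b') ` (rows u \<times> rows v \<times> {..<max 1 (nrow u)})"
  then obtain \<psi>1 \<psi>2 l where c: "rowok u \<psi>1" "rowok v \<psi>2" "l < max 1 (nrow u)"
    "c = ins m l (face_of (nrow u) (set u) \<psi>1) @ face_of (nrow v) (set v) \<psi>2"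
    by (auto simp: rows_def)
  define \<psi> where "\<psi> x = (if x \<in> set u then \<psi>1 x else if x = m then l else max 1 (nrow u) + \<psi>2 x)" for x
  have 1: "rowok u \<psi>" using c(1) by (subst rowok_cong[of _ _ \<psi>1]) (auto simp: \<psi>_def)
  have 2: "rowok v (\<lambda>x. \<psi> x - max 1 (nrow u))" using c(2) w
    by (subst rowok_cong[of _ _ \<psi>2]) (auto simp: \<psi>_def)
  have m: "\<psi> m = l" using w by (simp add: \<psi>_def)
  have "max 1 (nrow u) \<le> \<psi> x" if "x \<in> set v" for x using that w by (auto simp: \<psi>_def)
  then have ok: "rowok (u @ m # v) \<psi>"
    unfolding rowok_peak[OF w] using 1 2 m c(3) by auto
  have "face_of (nrow u) (set u) \<psi>1 = face_of (nrow u) (set u) \<psi>"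
    by (rule face_of_cong) (auto simp: \<psi>_def)
  moreover have "face_of (nrow v) (set v) \<psi>2 = face_of (nrow v) (set v) (\<lambda>x. \<psi> x - max 1 (nrow u))"
    using w by (intro face_of_cong) (auto simp: \<psi>_def)
  ultimately have "c = face_of (nrow (u @ m # v)) (set (u @ m # v)) \<psi>"
    unfolding face_of_peak_row[OF w ok] c(4) by (simp add: m)
  then show "c \<in> rows (u @ m # v)" using ok by (auto simp: rows_def)
qed

text \<open>The element \<open>m\<close> marks its block, which gives the index, and deleting it
  recovers the face.\<close>

lemma ins_inj:
  assumes "m \<notin> \<Union>(set a)" "m \<notin> \<Union>(set b)" "length a = length b"
    "k < max 1 (length a)" "l < max 1 (length a)" "ins m k a = ins m l b"
  shows "a = b \<and> k = l"
proof (cases "a = []")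
  case True
  then show ?thesis using assms by auto
next
  case False
  then have "length a > 0" by simp
  then have b: "b \<noteq> []" "k < length a" "l < length b" using assms(3-5) by (auto simp: max_def split: if_splits)
  have eq: "a[k := insert m (a ! k)] = b[l := insert m (b ! l)]"
    using assms(6) False b by (simp add: ins_def)
  have n: "m \<notin> a ! j" "m \<notin> b ! j" if "j < length a" for j
    using that assms(1-3) nth_mem[of j a] nth_mem[of j b] by auto
  have "m \<in> b[l := insert m (b ! l)] ! k" using b by (simp flip: eq)
  then have kl: "k = l" using b n(2)[of k] by (auto simp: nth_list_update split: if_splits)
  have "a ! j = b ! j" if "j < length a" for j
  proof -
    have "a[k := insert m (a ! k)] ! j = b[l := insert m (b ! l)] ! j" by (simp only: eq)
    then show ?thesis using that b kl n assms(3)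
      by (auto simp: nth_list_update insert_ident split: if_splits)
  qed
  then show ?thesis using kl assms(3) by (auto intro: nth_equalityI)
qed

lemma cols_faces: "distinct w \<Longrightarrow> a \<in> cols w \<Longrightarrow> a \<in> faces (set w) \<and> length a = ncol w"
  unfolding cols_def using colok_surj colok_bound by (auto intro!: face_of_faces)

lemma rows_faces: "distinct w \<Longrightarrow> b \<in> rows w \<Longrightarrow> b \<in> faces (set w) \<and> length b = nrow w"
  unfolding rows_def using rowok_surj rowok_bound by (auto intro!: face_of_faces)

lemma finite_cols: "distinct w \<Longrightarrow> finite (cols w)"
  by (induction w rule: peak_induct) (simp_all add: cols_peak)

lemma finite_rows: "distinct w \<Longrightarrow> finite (rows w)"
  by (induction w rule: peak_induct) (simp_all add: rows_peak)

lemma faces_Union: "u \<in> faces S \<Longrightarrow> \<Union>(set u) = S"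
  by (simp add: faces_def partition_on_def)

text \<open>The range of \<open>k\<close> is expressed by \<open>length a'\<close>, as in
  \<open>insert_face\<close>, so that the innermost sum can be recognised as an insertion into
  \<open>a'\<close>.\<close>

lemma sum_cols_peak:
  assumes w: "distinct (u @ m # v)" "\<forall>x\<in>set u \<union> set v. x < m"
  shows "sum f (cols (u @ m # v)) = (\<Sum>a\<in>cols u. \<Sum>a'\<in>cols v. \<Sum>k<max 1 (length a'). f (a @ ins m k a'))"
proof -
  have d: "distinct u" "distinct v" "m \<notin> set v" using w by auto
  have "inj_on (\<lambda>(a, a', k). a @ ins m k a') (cols u \<times> cols v \<times> {..<max 1 (ncol v)})"
  proof (rule inj_onI)
    fix x y
    assume x: "x \<in> cols u \<times> cols v \<times> {..<max 1 (ncol v)}" and y: "y \<in> cols u \<times> cols v \<times> {..<max 1 (ncol v)}"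
      and eq: "(case x of (a, a', k) \<Rightarrow> a @ ins m k a') = (case y of (a, a', k) \<Rightarrow> a @ ins m k a')"
    obtain a a' k b b' l where xy: "x = (a, a', k)" "y = (b, b', l)" by (metis prod_cases3)
    note * = x[unfolded xy] y[unfolded xy] eq[unfolded xy prod.case]
    have len: "length a = length b" "length a' = length b'" "length a' = ncol v"
      using * cols_faces[OF d(1)] cols_faces[OF d(2)] by auto
    then have "a = b" "ins m k a' = ins m l b'" using * by auto
    moreover have "\<Union>(set a') = set v" "\<Union>(set b') = set v"
      using * cols_faces[OF d(2)] by (auto simp del: Union_iff intro!: faces_Union)
    ultimately show "x = y" unfolding xy using ins_inj[of m a' b' k l] len * d by auto
  qed
  then have "sum f (cols (u @ m # v)) =
     (\<Sum>(a, a', k)\<in>cols u \<times> cols v \<times> {..<max 1 (ncol v)}. f (a @ ins m k a'))"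
    unfolding cols_peak[OF w] by (simp add: sum.reindex case_prod_unfold)
  also have "\<dots> = (\<Sum>a\<in>cols u. \<Sum>a'\<in>cols v. \<Sum>k<max 1 (ncol v). f (a @ ins m k a'))"
    by (simp add: sum.cartesian_product)
  also have "\<dots> = (\<Sum>a\<in>cols u. \<Sum>a'\<in>cols v. \<Sum>k<max 1 (length a'). f (a @ ins m k a'))"
    using cols_faces[OF d(2)] by (intro sum.cong refl) auto
  finally show ?thesis .
qed

lemma sum_rows_peak:
  assumes w: "distinct (u @ m # v)" "\<forall>x\<in>set u \<union> set v. x < m"
  shows "sum f (rows (u @ m # v)) = (\<Sum>b\<in>rows u. \<Sum>b'\<in>rows v. \<Sum>l<max 1 (length b). f (ins m l b @ b'))"
proof -
  have d: "distinct u" "distinct v" "m \<notin> set u" using w by auto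
  have "inj_on (\<lambda>(b, b', l). ins m l b @ b') (rows u \<times> rows v \<times> {..<max 1 (nrow u)})"
  proof (rule inj_onI)
    fix x y
    assume x: "x \<in> rows u \<times> rows v \<times> {..<max 1 (nrow u)}" and y: "y \<in> rows u \<times> rows v \<times> {..<max 1 (nrow u)}"
      and eq: "(case x of (b, b', l) \<Rightarrow> ins m l b @ b') = (case y of (b, b', l) \<Rightarrow> ins m l b @ b')"
    obtain a a' k b b' l where xy: "x = (a, a', k)" "y = (b, b', l)" by (metis prod_cases3)
    note * = x[unfolded xy] y[unfolded xy] eq[unfolded xy prod.case]
    have len: "length a' = length b'" "length a = length b" "length a = nrow u"
      using * rows_faces[OF d(1)] rows_faces[OF d(2)] by auto
    then have "a' = b'" "ins m k a = ins m l b" using * by auto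
    moreover have "\<Union>(set a) = set u" "\<Union>(set b) = set u"
      using * rows_faces[OF d(1)] by (auto simp del: Union_iff intro!: faces_Union)
    ultimately show "x = y" unfolding xy using ins_inj[of m a b k l] len * d by auto
  qed
  then have "sum f (rows (u @ m # v)) =
     (\<Sum>(b, b', l)\<in>rows u \<times> rows v \<times> {..<max 1 (nrow u)}. f (ins m l b @ b'))"
    unfolding rows_peak[OF w] by (simp add: sum.reindex case_prod_unfold)
  also have "\<dots> = (\<Sum>b\<in>rows u. \<Sum>b'\<in>rows v. \<Sum>l<max 1 (nrow u). f (ins m l b @ b'))"
    by (simp add: sum.cartesian_product)
  also have "\<dots> = (\<Sum>b\<in>rows u. \<Sum>b'\<in>rows v. \<Sum>l<max 1 (length b). f (ins m l b @ b'))"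
    using rows_faces[OF d(1)] by (intro sum.cong refl) auto
  finally show ?thesis .
qed

text \<open>A union \<open>T\<close> of initial columns that is also a union of bottom rows would split the matrix into two
  diagonal blocks.\<close>
lemma indecomposable:
  assumes "distinct w" "colok w \<phi>" "rowok w \<psi>"
    "T = {x \<in> set w. \<phi> x < k}" "T = {x \<in> set w. \<psi> x < l}"
  shows "T = {} \<or> T = set w"
  using assms
proof (induction w arbitrary: \<phi> \<psi> T k l rule: peak_induct)
  case (peak u m v)
  define p where "p = ncol u"
  define q where "q = max 1 (nrow u)"
  note c = peak(5)[unfolded colok_peak[OF peak(1,2)], folded p_def]
  note r = peak(6)[unfolded rowok_peak[OF peak(1,2)], folded q_def]
  have d: "distinct u" "distinct v" "m \<notin> set u" "m \<notin> set v" "set u \<inter> set v = {}" using peak(1) by auto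
  have cu: "\<phi> x < p" if "x \<in> set u" for x using c that colok_bound[of u \<phi> x] by (auto simp: p_def)
  have ru: "\<psi> x < q" if "x \<in> set u" for x using r that rowok_bound[of u \<psi> x] d by (auto simp: q_def)
  show ?case
  proof (cases "m \<in> T")
    case True
    then have k: "p < k" using peak(7) c by auto
    have U: "set u \<subseteq> T" using cu k peak(7) by fastforce
    have "T \<inter> set v = {x \<in> set v. \<phi> x - p < k - p}" using peak(7) c k by auto
    moreover have "T \<inter> set v = {x \<in> set v. \<psi> x - q < l - q}"
    proof -
      have "\<psi> x < l \<longleftrightarrow> \<psi> x - q < l - q" if "x \<in> set v" for x using r that by auto
      then show ?thesis using peak(8) by auto
    qed
    ultimately have "T \<inter> set v = {} \<or> T \<inter> set v = set v"
      using peak(4) c r d unfolding p_def q_def by blast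
    then show ?thesis
    proof
      assume e: "T \<inter> set v = {}"
      have "v = []"
      proof (rule ccontr)
        assume v: "v \<noteq> []"
        then have "max 1 (ncol v) = ncol v" by (simp add: ncol_def)
        then have "\<phi> m - p < ncol v" using c by auto
        \<comment> \<open>An entry of \<open>v\<close> with the same final column as
          \<open>m\<close> lies in \<open>T\<close> together with \<open>m\<close>, so
          \<open>T\<close> cannot miss \<open>v\<close>.\<close>
        then obtain x where x: "x \<in> set v" "\<phi> x - p = \<phi> m - p"
          using colok_surj[OF d(2), of "\<lambda>x. \<phi> x - p"] c unfolding p_def by blast
        then have "\<phi> x = \<phi> m" using c by (metis le_add_diff_inverse)
        then have "x \<in> T" using True peak(7) x by auto
        with x e show False by auto
      qed
      then show ?thesis using U True peak(7) by auto
    next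
      assume "T \<inter> set v = set v"
      then show ?thesis using U True peak(7) by auto
    qed
  next
    case False
    then have l: "l \<le> \<psi> m" using peak(8) by auto
    have V: "T \<inter> set v = {}" using peak(8) r l by fastforce
    then have T: "T \<subseteq> set u" using peak(7) False by auto
    have "T = {x \<in> set u. \<phi> x < k}" "T = {x \<in> set u. \<psi> x < l}"
      using T peak(7,8) by auto
    then have *: "T = {} \<or> T = set u" using peak(3) c r by blast
    show ?thesis
    proof (cases "u = []")
      case True
      then show ?thesis using T by auto
    next
      case u: False
      then have "\<psi> m < nrow u" using r by (simp add: q_def nrow_def)
      \<comment> \<open>An entry of \<open>u\<close> with the same final row as \<open>m\<close>
        lies outside \<open>T\<close> together with \<open>m\<close>, so \<open>T\<close> is not all
        of \<open>u\<close>.\<close>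
      then obtain x where x: "x \<in> set u" "\<psi> x = \<psi> m"
        using rowok_surj[OF d(1)] r by blast
      then have "x \<notin> T" using l peak(8) by auto
      then show ?thesis using * x by auto
    qed
  qed
qed simp

text \<open>The entries of \<open>u\<close> are those entries of \<open>u'\<close> whose final
  column lies below \<open>ncol u\<close>, and also those whose final row lies below
  \<open>max 1 (nrow u)\<close>. By \<open>indecomposable\<close> for \<open>u'\<close> they are
  none or all of \<open>u'\<close>. If they were none and \<open>u'\<close> were non-empty, an entry
  of \<open>u'\<close> with final row 0 would belong to \<open>v\<close>, whose entries keep to rows
  above that of \<open>m\<close>.\<close>

lemma word_prefix_subset:
  assumes u: "distinct (u @ m # v)" "\<forall>x\<in>set u \<union> set v. x < m"
    and u': "distinct (u' @ m # v')" "\<forall>x\<in>set u' \<union> set v'. x < m"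
    and S: "set u \<union> set v = set u' \<union> set v'"
    and ok: "colok (u @ m # v) \<phi>" "colok (u' @ m # v') \<phi>" "rowok (u @ m # v) \<psi>" "rowok (u' @ m # v') \<psi>"
    and le: "ncol u \<le> ncol u'"
  shows "set u = set u'"
proof -
  note c = ok(1)[unfolded colok_peak[OF u]] and c' = ok(2)[unfolded colok_peak[OF u']]
  note r = ok(3)[unfolded rowok_peak[OF u]] and r' = ok(4)[unfolded rowok_peak[OF u']]
  have d: "distinct u" "distinct u'" "m \<notin> set u" "m \<notin> set u'" "m \<notin> set v" "m \<notin> set v'" using u(1) u'(1) by auto
  have cu: "\<phi> x < ncol u \<longleftrightarrow> x \<in> set u" if "x \<in> set u \<union> set v" for x
    using c colok_bound[of u \<phi> x] that by (auto simp: not_less)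
  have cu': "\<phi> x < ncol u' \<longleftrightarrow> x \<in> set u'" if "x \<in> set u \<union> set v" for x
    using c' colok_bound[of u' \<phi> x] that[unfolded S] by (auto simp: not_less)
  have sub: "set u \<subseteq> set u'"
  proof
    fix x assume "x \<in> set u"
    then show "x \<in> set u'" using cu[of x] cu'[of x] le by simp
  qed
  have ru: "\<psi> x < max 1 (nrow u)" if "x \<in> set u" for x
    using rowok_bound[of u \<psi> x] r d that by auto
  have "set u = {x \<in> set u'. \<phi> x < ncol u}"
    using cu sub S by blast
  moreover have "set u = {x \<in> set u'. \<psi> x < max 1 (nrow u)}"
  proof -
    have "x \<in> set u" if "x \<in> set u'" "\<psi> x < max 1 (nrow u)" for x
      using that r S by (metis UnCI UnE not_less)
    then show ?thesis using sub ru by blast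
  qed
  ultimately have "set u = {} \<or> set u = set u'"
    using indecomposable[OF d(2)] c' r' by blast
  then show ?thesis
  proof
    assume e: "set u = {}"
    show ?thesis
    proof (rule ccontr)
      assume "set u \<noteq> set u'"
      then have "u' \<noteq> []" using e by auto
      then have "0 < nrow u'" by (simp add: nrow_def)
      then obtain x where x: "x \<in> set u'" "\<psi> x = 0" using rowok_surj[OF d(2)] r' by blast
      then have "x \<in> set v" using S e by (metis UnCI UnE empty_iff)
      then show False using r x e by auto
    qed
  qed
qed

text \<open>A configuration determines the step matrix from which it is derived.\<close>
lemma word_unique:
  assumes "distinct w" "distinct w'" "set w = set w'"
    "colok w \<phi>" "colok w' \<phi>" "rowok w \<psi>" "rowok w' \<psi>"
  shows "w = w'"
  using assms
proof (induction w arbitrary: w' \<phi> \<psi> rule: peak_induct)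
  case (peak u m v)
  have "m \<notin> set u \<union> set v" using peak(1) by auto
  have "set w' = insert m (set u \<union> set v)" using peak(6) by auto
  then obtain u' v' where w': "w' = u' @ m # v'" "\<forall>x\<in>set u' \<union> set v'. x < m"
    "set u' \<union> set v' = set u \<union> set v" "set u' \<inter> set v' = {}"
    using peak_split[OF peak(5)] peak(2) by metis
  note d' = peak(5)[unfolded w'(1)]
  note ok = peak(7) peak(8)[unfolded w'(1)] peak(9) peak(10)[unfolded w'(1)]
  have uu: "set u = set u'"
  proof (cases "ncol u \<le> ncol u'")
    case True
    then show ?thesis
      using word_prefix_subset[OF peak(1,2) d' w'(2) w'(3)[symmetric] ok] by blast
  next
    case False
    then show ?thesis
      using word_prefix_subset[OF d' w'(2) peak(1,2) w'(3) ok(2,1,4,3)] by auto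
  qed
  moreover have "set u \<inter> set v = {}" using peak(1) by auto
  ultimately have vv: "set v = set v'" using w'(3,4) by blast
  note c = ok(1)[unfolded colok_peak[OF peak(1,2)]] and c' = ok(2)[unfolded colok_peak[OF d' w'(2)]]
  note r = ok(3)[unfolded rowok_peak[OF peak(1,2)]] and r' = ok(4)[unfolded rowok_peak[OF d' w'(2)]]
  have u: "u = u'" using peak(3)[of u' \<phi> \<psi>] c c' r r' d' uu by auto
  moreover have "v = v'"
    using peak(4)[of v' "\<lambda>x. \<phi> x - ncol u" "\<lambda>x. \<psi> x - max 1 (nrow u)"] c c' r r' d' vv u by auto
  ultimately show ?case by (simp add: w'(1))
qed simp

section \<open>Signs of configurations\<close>

text \<open>The exponent in \<open>sgn1\<close>: every block is weighted by the number of blocks to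
  its right, which permits recursion along the list.\<close>

fun wpos :: "face \<Rightarrow> nat" where
  "wpos [] = 0"
| "wpos (U # u) = length u * card U + wpos u"

lemma wpos_sum: "(\<Sum>i\<in>{1..<length u}. i * card (u ! (length u - i - 1))) = wpos u"
proof (induction u)
  case (Cons U u)
  have "(\<Sum>i\<in>{1..<length (U # u)}. i * card ((U # u) ! (length (U # u) - i - 1)))
     = (\<Sum>i\<in>{1..<Suc (length u)}. i * card ((U # u) ! (length u - i)))"
    by simp
  also have "\<dots> = (\<Sum>i\<in>{1..length u}. i * card ((U # u) ! (length u - i)))"
    by (simp only: atLeastLessThanSuc_atLeastAtMost)
  also have "\<dots> = (\<Sum>i\<in>{1..<length u}. i * card ((U # u) ! (length u - i))) + length u * card U"
  proof (cases "u = []")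
    case False
    then have "{1..length u} = insert (length u) {1..<length u}" by (auto simp: Suc_le_eq)
    then show ?thesis by simp
  qed simp
  also have "(\<Sum>i\<in>{1..<length u}. i * card ((U # u) ! (length u - i)))
     = (\<Sum>i\<in>{1..<length u}. i * card (u ! (length u - i - 1)))"
    by (intro sum.cong refl) (auto simp: nth_Cons')
  finally show ?case using Cons by simp
qed simp

lemma sgn1_wpos: "disjoint_blocks u \<Longrightarrow> sgn1 u = (-1) ^ (wpos u + pcross u)"
  unfolding sgn1_def wpos_sum by (simp add: psgn_pcross power_add)

lemma wpos_append: "disjoint_blocks (u @ v) \<Longrightarrow> wpos (u @ v) = wpos u + length v * card (\<Union>(set u)) + wpos v"
proof (induction u)
  case (Cons U u)
  have "card (U \<union> \<Union>(set u)) = card U + card (\<Union>(set u))"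
    using Cons.prems by (intro card_Un_disjoint) (auto simp: disjoint_blocks_append disjoint_blocks_finite)
  with Cons show ?case by (simp add: algebra_simps)
qed simp

lemma faces_disjoint_blocks: "u \<in> faces S \<Longrightarrow> finite S \<Longrightarrow> disjoint_blocks u"
proof (induction u arbitrary: S)
  case (Cons U u)
  have U: "U \<inter> \<Union>(set u) = {}" "U \<subseteq> S"
    using Cons.prems by (auto simp: faces_def partition_on_def disjoint_def)
  have "u \<in> faces (\<Union>(set u))" "finite (\<Union>(set u))"
    using Cons.prems by (auto simp: faces_def partition_on_def disjoint_def)
  then show ?case using Cons.IH U Cons.prems by (auto intro: finite_subset)
qed simp

lemma fdim_length:
  "disjoint_blocks u \<Longrightarrow> good_face u \<Longrightarrow> fdim u + length u = card (\<Union>(set u))"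
proof (induction u)
  case (Cons U u)
  have "card (U \<union> \<Union>(set u)) = card U + card (\<Union>(set u))"
    using Cons.prems by (intro card_Un_disjoint) (auto simp: disjoint_blocks_finite)
  moreover have "card U > 0" using Cons.prems by (simp add: card_gt_0_iff)
  ultimately show ?case using Cons by (simp add: fdim_Cons)
qed simp

lemma Union_ins: "k < max 1 (length u) \<Longrightarrow> \<Union>(set (ins m k u)) = insert m (\<Union>(set u))"
proof (induction u arbitrary: k)
  case (Cons U u)
  show ?case
  proof (cases k)
    case (Suc j)
    then have "u \<noteq> []" "j < max 1 (length u)" using Cons.prems by (auto simp: max_def split: if_splits)
    then show ?thesis using Cons.IH[of j] Suc by (simp add: ins_def)
  qed (simp add: ins_def)
qed (simp add: ins_def)

lemma ins_Cons: "u \<noteq> [] \<Longrightarrow> ins m (Suc k) (U # u) = U # ins m k u"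
  by (simp add: ins_def)

lemma disjoint_blocks_ins:
  "disjoint_blocks u \<Longrightarrow> m \<notin> \<Union>(set u) \<Longrightarrow> k < max 1 (length u) \<Longrightarrow> disjoint_blocks (ins m k u)"
proof (induction u arbitrary: k)
  case (Cons U u)
  show ?case
  proof (cases k)
    case 0
    then show ?thesis using Cons.prems by (simp add: ins_def)
  next
    case (Suc j)
    then have j: "u \<noteq> []" "j < max 1 (length u)" using Cons.prems by (auto simp: max_def split: if_splits)
    then show ?thesis using Cons Suc by (simp add: ins_Cons Union_ins)
  qed
qed (simp add: ins_def)

text \<open>Adding \<open>m\<close> to a block raises the weighted count by the number of blocks to
  its right and the crossings by the number of elements to its right. Modulo 2 the sum is the
  dimension of what lies to the right, which explains the sign chosen in
  \<open>insert_face\<close>.\<close>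

lemma sign_exponent_ins:
  assumes "disjoint_blocks u" "good_face u" "\<forall>x\<in>\<Union>(set u). x < m" "k < max 1 (length u)"
  shows "even (wpos (ins m k u) + pcross (ins m k u) + wpos u + pcross u + fdim (drop (Suc k) u))"
  using assms
proof (induction u arbitrary: k)
  case Nil
  then show ?case by (simp add: ins_def)
next
  case (Cons U u)
  have m: "m \<notin> \<Union>(set (U # u))" using Cons.prems(3) by auto
  show ?case
  proof (cases k)
    case 0
    have 1: "crossings (insert m U) (\<Union>(set u)) = card (\<Union>(set u)) + crossings U (\<Union>(set u))"
      using Cons.prems by (intro crossings_insert_left_max) (auto simp: disjoint_blocks_finite)
    have 2: "fdim u + length u = card (\<Union>(set u))" using Cons.prems by (intro fdim_length) auto
    have 3: "card (insert m U) = Suc (card U)" using m Cons.prems by simp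
    show ?thesis by (simp add: 0 ins_def 1 2[symmetric] 3) argo
  next
    case (Suc j)
    then have j: "u \<noteq> []" "j < max 1 (length u)" using Cons.prems by (auto simp: max_def split: if_splits)
    have l: "max 1 (length u) = length u" using j(1) by (auto simp: max_def Suc_le_eq)
    have "crossings U (\<Union>(set (ins m j u))) = crossings U (\<Union>(set u))"
      unfolding Union_ins[OF j(2)] using Cons.prems by (intro crossings_insert_right_max) auto
    then show ?thesis using Cons.IH[of j] Cons.prems j l Suc by (simp add: ins_Cons) argo
  qed
qed

section \<open>Coefficients of configurations cut at the largest entry\<close>

definition rexp :: "face \<Rightarrow> nat" where
  "rexp u = (\<Sum>B\<leftarrow>u. card B * (card B - 1) div 2)"

lemma rsgn_rexp: "rsgn u = (-1) ^ rexp u"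
  unfolding rsgn_def rexp_def by (induction u) (simp_all add: power_add)

lemma rexp_append [simp]: "rexp (u @ v) = rexp u + rexp v"
  by (simp add: rexp_def)

lemma rexp_ins_0:
  assumes "finite U" "m \<notin> U"
  shows "rexp (ins m 0 (U # u)) = rexp (U # u) + card U"
proof -
  have "Suc n * n div 2 = n * (n - 1) div 2 + n" for n :: nat
    by (cases n) (simp_all add: algebra_simps)
  then show ?thesis using assms by (simp add: rexp_def ins_def)
qed

definition step_cols :: "nat list \<Rightarrow> face" where
  "step_cols w = face_of (ncol w) (set w) (cix w)"

lemma colok_cix: "distinct w \<Longrightarrow> colok w (cix w)"
  by (simp add: colok_def cix_less_ncol)

lemma step_cols_in_cols: "distinct w \<Longrightarrow> step_cols w \<in> cols w"
  using colok_cix by (auto simp: step_cols_def cols_def)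

text \<open>Before any move \<open>m\<close> lies in the first column of the block of
  \<open>v\<close>, hence index 0.\<close>

lemma step_cols_peak:
  assumes w: "distinct (u @ m # v)" "\<forall>x\<in>set u \<union> set v. x < m"
  shows "step_cols (u @ m # v) = step_cols u @ ins m 0 (step_cols v)"
proof -
  have "face_of (ncol u) (set u) (cix (u @ m # v)) = face_of (ncol u) (set u) (cix u)"
    using cix_peak[OF w] by (intro face_of_cong) auto
  moreover have "face_of (ncol v) (set v) (\<lambda>x. cix (u @ m # v) x - ncol u) = face_of (ncol v) (set v) (cix v)"
    using cix_peak[OF w] by (intro face_of_cong) auto
  ultimately show ?thesis
    unfolding step_cols_def face_of_peak_col[OF w colok_cix[OF w(1)]] by (simp add: cix_peak[OF w])
qed

text \<open>This is \<open>csgn\<close> transported to words: \<open>step_cols w\<close> plays the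
  role of c(E), while \<open>a\<close> and \<open>b\<close> play those of c(F) and r(F).\<close>

definition coef :: "nat list \<Rightarrow> face \<Rightarrow> face \<Rightarrow> int" where
  "coef w a b = (-1) ^ (nrow w choose 2) * rsgn (step_cols w) * sgn1 b *
     sgn2 (step_cols w) * sgn2 a"

text \<open>The binomial signs of the two occurrences of \<open>sgn2\<close> cancel, because
  \<open>a\<close> and \<open>step_cols w\<close> both have \<open>ncol w\<close> blocks.\<close>

lemma coef_exponent:
  assumes "distinct w" "a \<in> cols w" "b \<in> rows w"
  shows "coef w a b = (-1) ^ ((nrow w choose 2) + rexp (step_cols w) + (wpos (step_cols w)
     + pcross (step_cols w)) + (wpos b + pcross b) + (wpos a + pcross a))"
proof -
  have f: "a \<in> faces (set w)" "length a = ncol w" "b \<in> faces (set w)"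
    "step_cols w \<in> faces (set w)" "length (step_cols w) = ncol w"
    using cols_faces rows_faces step_cols_in_cols assms by blast+
  then have "disjoint_blocks a" "disjoint_blocks b" "disjoint_blocks (step_cols w)"
    by (auto intro: faces_disjoint_blocks)
  then show ?thesis
    by (simp add: coef_def sgn2_def rsgn_rexp sgn1_wpos f power_add)
qed

lemma choose_2_add: "(m + n) choose 2 = (m choose 2) + (n choose 2) + m * n"
  by (induction n) (simp_all add: numeral_2_eq_2)

text \<open>The signs on the right are those of the shuffle, of the insertion into \<open>b\<close>,
  of the insertion into \<open>a'\<close> after passing \<open>b'\<close>, and of
  \<open>bar\<close>. All exponents reduce modulo 2 to expressions in \<alpha>, \<beta>,
  \<open>q\<close>, \<open>q'\<close>, \<open>p\<close> and the dimensions of tails of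
  \<open>a'\<close> and \<open>b\<close>, after which only a propositional check of parities
  remains.\<close>

lemma coef_peak:
  assumes w: "distinct (u @ m # v)" "\<forall>x\<in>set u \<union> set v. x < m"
    and a: "a \<in> cols u" "a' \<in> cols v" "k < max 1 (length a')"
    and b: "b \<in> rows u" "b' \<in> rows v" "l < max 1 (length b)"
  shows "coef (u @ m # v) (a @ ins m k a') (ins m l b @ b') =
    (-1) ^ crossings (set u) (set v) * coef u a b * coef v a' b'
    * (-1) ^ fdim (drop (Suc l) b) * (-1) ^ (fdim b' + fdim (drop (Suc k) a'))
    * (-1) ^ (fdim (ins m k a') * fdim (ins m l b))"
proof -
  define \<alpha> \<beta> q q' p where "\<alpha> = card (set u)" and "\<beta> = card (set v)" and
    "q = max 1 (nrow u)" and "q' = nrow v" and "p = max 1 (ncol v)"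
  note defs = \<alpha>_def \<beta>_def q_def q'_def p_def
  have d: "distinct u" "distinct v" "m \<notin> set u" "m \<notin> set v" "set u \<inter> set v = {}" using w(1) by auto
  have fa: "a \<in> faces (set u)" "length a = ncol u" using cols_faces d a by blast+
  have fa': "a' \<in> faces (set v)" "length a' = ncol v" using cols_faces d a by blast+
  have fb: "b \<in> faces (set u)" "length b = nrow u" using rows_faces d b by blast+
  have fb': "b' \<in> faces (set v)" "length b' = nrow v" using rows_faces d b by blast+
  have fu: "step_cols u \<in> faces (set u)" "length (step_cols u) = ncol u"
    using cols_faces step_cols_in_cols d by blast+
  have fv: "step_cols v \<in> faces (set v)" "length (step_cols v) = ncol v"
    using cols_faces step_cols_in_cols d by blast+
  note db = faces_disjoint_blocks[OF _ finite_set] and gd = faces_good[OF _ finite_set]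
  \<comment> \<open>Used for the face \<open>a\<close> and, with \<open>j = 0\<close>, for the step
    columns. The contributions of the crossings and of \<open>p * \<alpha>\<close> then occur twice
    and drop out.\<close>
  have insL: "even (wpos (c @ ins m j c') + pcross (c @ ins m j c') + (wpos c + pcross c)
      + (wpos c' + pcross c') + fdim (drop (Suc j) c') + crossings (set u) (set v) + p * \<alpha>)"
    if c: "c \<in> faces (set u)" "c' \<in> faces (set v)" "length c' = ncol v" "j < max 1 (length c')" for c c' j
  proof -
    have U: "\<Union>(set c) = set u" "\<Union>(set c') = set v" "\<Union>(set (ins m j c')) = insert m (set v)"
      using c faces_Union Union_ins by auto
    have di: "disjoint_blocks (ins m j c')"
      using db[OF c(2)] c(4) U d by (intro disjoint_blocks_ins) auto
    have dd: "disjoint_blocks (c @ ins m j c')"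
      using db[OF c(1)] di U d by (simp add: disjoint_blocks_append)
    have "even (wpos (ins m j c') + pcross (ins m j c') + wpos c' + pcross c' + fdim (drop (Suc j) c'))"
      using db[OF c(2)] gd[OF c(2)] c(4) w U by (intro sign_exponent_ins) auto
    moreover have "crossings (set u) (insert m (set v)) = crossings (set u) (set v)"
      using w by (intro crossings_insert_right_max) auto
    ultimately show ?thesis
      unfolding wpos_append[OF dd] pcross_append[OF dd] U
      by (simp add: c \<alpha>_def p_def) argo
  qed
  have insR: "even (wpos (ins m l b @ b') + pcross (ins m l b @ b') + (wpos b + pcross b)
      + (wpos b' + pcross b') + fdim (drop (Suc l) b) + crossings (set u) (set v) + \<beta> + q' * Suc \<alpha>)"
  proof -
    have U: "\<Union>(set b) = set u" "\<Union>(set b') = set v" "\<Union>(set (ins m l b)) = insert m (set u)"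
      using fb fb' b faces_Union Union_ins by auto
    have di: "disjoint_blocks (ins m l b)"
      using db[OF fb(1)] b U d by (intro disjoint_blocks_ins) auto
    have dd: "disjoint_blocks (ins m l b @ b')"
      using db[OF fb'(1)] di U d by (simp add: disjoint_blocks_append)
    have "even (wpos (ins m l b) + pcross (ins m l b) + wpos b + pcross b + fdim (drop (Suc l) b))"
      using db[OF fb(1)] gd[OF fb(1)] b w U by (intro sign_exponent_ins) auto
    moreover have "crossings (insert m (set u)) (set v) = \<beta> + crossings (set u) (set v)"
      unfolding \<beta>_def using w by (intro crossings_insert_left_max) auto
    moreover have "card (insert m (set u)) = Suc \<alpha>" using d by (simp add: \<alpha>_def)
    ultimately show ?thesis
      unfolding wpos_append[OF dd] pcross_append[OF dd] U
      by (simp add: fb' q'_def) argo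
  qed
  \<comment> \<open>The case of empty \<open>v\<close> fits as well: \<open>p = 1\<close> is the
    column of \<open>m\<close>, and \<open>q' = 0\<close>.\<close>
  have pq: "p + q' = Suc \<beta>"
  proof (cases "v = []")
    case False
    then have "p = ncol v" by (simp add: p_def ncol_def)
    then show ?thesis using ncol_nrow[OF d(2) False] d by (simp add: q'_def \<beta>_def distinct_card)
  qed (simp add: p_def q'_def \<beta>_def)
  have da': "fdim (ins m k a') = q'"
  proof -
    have U: "\<Union>(set a') = set v" "\<Union>(set (ins m k a')) = insert m (set v)"
      using fa' a faces_Union Union_ins by auto
    have "fdim (ins m k a') + length (ins m k a') = card (insert m (set v))"
      unfolding U(2)[symmetric] using db[OF fa'(1)] gd[OF fa'(1)] a U d
      by (intro fdim_length disjoint_blocks_ins good_face_ins) auto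
    then show ?thesis using pq d fa' by (simp add: p_def \<beta>_def)
  qed
  have db2: "fdim (ins m l b) + q = Suc \<alpha>"
  proof -
    have U: "\<Union>(set b) = set u" "\<Union>(set (ins m l b)) = insert m (set u)"
      using fb b faces_Union Union_ins by auto
    have "fdim (ins m l b) + length (ins m l b) = card (insert m (set u))"
      unfolding U(2)[symmetric] using db[OF fb(1)] gd[OF fb(1)] b U d
      by (intro fdim_length disjoint_blocks_ins good_face_ins) auto
    then show ?thesis using d fb by (simp add: q_def \<alpha>_def)
  qed
  have db': "fdim b' + q' = \<beta>"
    using fdim_length[OF db[OF fb'(1)] gd[OF fb'(1)]] fb' faces_Union[OF fb'(1)]
    by (simp add: q'_def \<beta>_def)
  have E: "even (rexp (step_cols (u @ m # v)) + (wpos (step_cols (u @ m # v)) + pcross (step_cols (u @ m # v)))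
      + (rexp (step_cols u) + (wpos (step_cols u) + pcross (step_cols u)))
      + (rexp (step_cols v) + (wpos (step_cols v) + pcross (step_cols v)))
      + crossings (set u) (set v) + p * \<alpha> + \<beta> + 1 + p)"
  proof -
    \<comment> \<open>The increase of \<open>rexp\<close> is the size of the first block. Together
      with the dimension of the other blocks it is one more than the total dimension
      \<open>\<beta> - p\<close>; for empty \<open>v\<close> both are 0.\<close>
    have "even (rexp (ins m 0 (step_cols v)) + rexp (step_cols v) + fdim (drop (Suc 0) (step_cols v)) + \<beta> + 1 + p)"
    proof (cases "step_cols v")
      case Nil
      then have v: "v = []" using fv by simp
      show ?thesis unfolding Nil by (simp add: v ins_def rexp_def \<beta>_def p_def)
    next
      case (Cons U c)
      have U: "finite U" "U \<noteq> {}" using gd[OF fv(1)] Cons by auto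
      have "U \<subseteq> set v" using faces_Union[OF fv(1)] Cons by auto
      then have "m \<notin> U" using d by auto
      then have 1: "rexp (ins m 0 (step_cols v)) = rexp (step_cols v) + card U"
        unfolding Cons using U by (intro rexp_ins_0)
      have 2: "fdim (step_cols v) + ncol v = \<beta>"
        using fdim_length[OF db[OF fv(1)] gd[OF fv(1)]] fv faces_Union[OF fv(1)] by (simp add: \<beta>_def)
      have 3: "p = ncol v" using fv Cons by (simp add: p_def max_def)
      have "card U > 0" using U by (simp add: card_gt_0_iff)
      then show ?thesis unfolding 1 2[symmetric] 3 by (simp add: Cons fdim_Cons) argo
    qed
    moreover have "0 < max 1 (length (step_cols v))" by simp
    ultimately show ?thesis
      using insL[OF fu(1) fv, of 0] unfolding step_cols_peak[OF w] by simp argo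
  qed
  \<comment> \<open>Replacing \<open>nrow u\<close> by \<open>max 1 (nrow u)\<close> does not affect
    the binomial coefficient, since 0 and 1 both give 0.\<close>
  have C: "(nrow (u @ m # v) choose 2) = (nrow u choose 2) + (q' choose 2) + q * q'"
    unfolding nrow_peak[OF w(2)] q_def[symmetric] q'_def[symmetric] choose_2_add
    by (auto simp: q_def max_def binomial_eq_0)
  have ca: "a @ ins m k a' \<in> cols (u @ m # v)"
    unfolding cols_peak[OF w] using a fa' by (intro image_eqI[where x = "(a, a', k)"]) auto
  have cb: "ins m l b @ b' \<in> rows (u @ m # v)"
    unfolding rows_peak[OF w] using b fb by (intro image_eqI[where x = "(b, b', l)"]) auto
  note insa = insL[OF fa(1) fa' a(3)]
  have par: "even (q * q') \<longleftrightarrow> even q \<or> even q'" "even (p * \<alpha>) \<longleftrightarrow> even p \<or> even \<alpha>"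
    "even (q' * Suc \<alpha>) \<longleftrightarrow> even q' \<or> odd \<alpha>" 
    "even (fdim (ins m k a') * fdim (ins m l b)) \<longleftrightarrow> even q' \<or> even (fdim (ins m l b))"
    "even (fdim (ins m l b)) \<longleftrightarrow> (even q \<longleftrightarrow> odd \<alpha>)"
    "even (fdim b') \<longleftrightarrow> (even \<beta> \<longleftrightarrow> even q')" "even p \<longleftrightarrow> (even q' \<longleftrightarrow> odd \<beta>)"
    using da' db2 db' pq by (auto simp flip: db' ) presburger+
  show ?thesis
    unfolding coef_exponent[OF w(1) ca cb] coef_exponent[OF d(1) a(1) b(1)] coef_exponent[OF d(2) a(2) b(2)]
      power_add[symmetric] C q'_def[symmetric]
    using insa insR E par
    by (intro neg_one_power_cong) (simp only: even_add odd_one simp_thms; argo)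
qed

section \<open>The recursion for the diagonal\<close>

definition words :: "nat set \<Rightarrow> nat list set" where
  "words S = {w. distinct w \<and> set w = S}"

definition word_chain :: "nat list \<Rightarrow> chain2" where
  "word_chain w = (\<Sum>a\<in>cols w. \<Sum>b\<in>rows w. frag_cmul (coef w a b) (frag_of (a, b)))"

text \<open>Step matrices of all shapes are summed at once; \<open>diag_top\<close> has the same
  terms grouped by the number of rows.\<close>

definition word_diag :: "nat set \<Rightarrow> chain2" where
  "word_diag S = (\<Sum>w\<in>words S. word_chain w)"

lemma words_empty [simp]: "words {} = {[]}"
  by (auto simp: words_def)

lemma finite_words: "finite S \<Longrightarrow> finite (words S)"
  unfolding words_def
  by (rule finite_subset[OF _ finite_lists_length_eq[of S "card S"]]) (auto simp: distinct_card)

lemma sum_words_insert: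
  assumes "finite S" "\<forall>x\<in>S. x < m"
  shows "(\<Sum>w\<in>words (insert m S). F w) =
    (\<Sum>A\<in>Pow S. \<Sum>u\<in>words A. \<Sum>v\<in>words (S - A). F (u @ m # v))"
proof -
  have m: "m \<notin> S" using assms(2) by auto
  have fin: "finite A" "finite (S - A)" if "A \<subseteq> S" for A
    using that assms(1) by (auto intro: finite_subset)
  have "(\<Sum>A\<in>Pow S. \<Sum>u\<in>words A. \<Sum>v\<in>words (S - A). F (u @ m # v)) =
    (\<Sum>A\<in>Pow S. \<Sum>(u, v)\<in>words A \<times> words (S - A). F (u @ m # v))"
    by (simp add: sum.cartesian_product)
  also have "\<dots> = (\<Sum>(A, u, v)\<in>Sigma (Pow S) (\<lambda>A. words A \<times> words (S - A)). F (u @ m # v))"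
    using assms(1) fin by (subst sum.Sigma) (auto simp: finite_words)
  also have "\<dots> = (\<Sum>w\<in>words (insert m S). F w)"
  proof (rule sum.reindex_bij_witness[of _
      "\<lambda>w. (set (takeWhile (\<lambda>y. y \<noteq> m) w), takeWhile (\<lambda>y. y \<noteq> m) w, tl (dropWhile (\<lambda>y. y \<noteq> m) w))"
      "\<lambda>(A, u, v). u @ m # v"])
    fix z assume "z \<in> Sigma (Pow S) (\<lambda>A. words A \<times> words (S - A))"
    then obtain A u v where z: "z = (A, u, v)" "A \<subseteq> S" "distinct u" "set u = A" "distinct v" "set v = S - A"
      by (auto simp: words_def)
    then have "m \<notin> set u" using m by auto
    then have t: "takeWhile (\<lambda>y. y \<noteq> m) (u @ m # v) = u" "dropWhile (\<lambda>y. y \<noteq> m) (u @ m # v) = m # v"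
      by (auto simp: takeWhile_append2 dropWhile_append2 intro: trans[OF takeWhile_append2] trans[OF dropWhile_append2])
    show "(set (takeWhile (\<lambda>y. y \<noteq> m) (case z of (A, u, v) \<Rightarrow> u @ m # v)),
       takeWhile (\<lambda>y. y \<noteq> m) (case z of (A, u, v) \<Rightarrow> u @ m # v),
       tl (dropWhile (\<lambda>y. y \<noteq> m) (case z of (A, u, v) \<Rightarrow> u @ m # v))) = z"
      using z by (simp add: t)
    show "(case z of (A, u, v) \<Rightarrow> u @ m # v) \<in> words (insert m S)"
      using z m by (auto simp: words_def)
    show "F (case z of (A, u, v) \<Rightarrow> u @ m # v) = (case z of (A, u, v) \<Rightarrow> F (u @ m # v))"
      by (simp add: z)
  next
    fix w assume "w \<in> words (insert m S)"
    then have w: "distinct w" "set w = insert m S" by (auto simp: words_def)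
    obtain u v where uv: "w = u @ m # v" "\<forall>x\<in>set u \<union> set v. x < m" "set u \<union> set v = S" "set u \<inter> set v = {}"
      using peak_split[OF w assms(2)] by metis
    then have "m \<notin> set u" by auto
    then have t: "takeWhile (\<lambda>y. y \<noteq> m) (u @ m # v) = u" "dropWhile (\<lambda>y. y \<noteq> m) (u @ m # v) = m # v"
      by (auto simp: takeWhile_append2 dropWhile_append2 intro: trans[OF takeWhile_append2] trans[OF dropWhile_append2])
    show "(case (set (takeWhile (\<lambda>y. y \<noteq> m) w), takeWhile (\<lambda>y. y \<noteq> m) w,
        tl (dropWhile (\<lambda>y. y \<noteq> m) w)) of (A, u, v) \<Rightarrow> u @ m # v) = w"
      by (simp add: uv(1) t)
    show "(set (takeWhile (\<lambda>y. y \<noteq> m) w), takeWhile (\<lambda>y. y \<noteq> m) w, tl (dropWhile (\<lambda>y. y \<noteq> m) w))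
         \<in> Sigma (Pow S) (\<lambda>A. words A \<times> words (S - A))"
      using w(1) uv by (auto simp: t words_def)
  qed
  finally show ?thesis ..
qed

text \<open>Brings the sums over columns in front of those over rows, the order in which
  \<open>sum_cols_peak\<close> and \<open>sum_rows_peak\<close> produce them.\<close>

lemma sum_reorder:
  "(\<Sum>a\<in>A. \<Sum>b\<in>B. \<Sum>a'\<in>A'. \<Sum>b'\<in>B'. \<Sum>l\<in>L b. \<Sum>k\<in>K a'. f a b a' b' l k) =
   (\<Sum>a\<in>A. \<Sum>a'\<in>A'. \<Sum>k\<in>K a'. \<Sum>b\<in>B. \<Sum>b'\<in>B'. \<Sum>l\<in>L b. f a b a' b' l k)"
proof (rule sum.cong[OF refl])
  fix a
  have "(\<Sum>b\<in>B. \<Sum>a'\<in>A'. \<Sum>b'\<in>B'. \<Sum>l\<in>L b. \<Sum>k\<in>K a'. f a b a' b' l k) =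
     (\<Sum>a'\<in>A'. \<Sum>b\<in>B. \<Sum>b'\<in>B'. \<Sum>l\<in>L b. \<Sum>k\<in>K a'. f a b a' b' l k)" by (rule sum.swap)
  also have "\<dots> = (\<Sum>a'\<in>A'. \<Sum>k\<in>K a'. \<Sum>b\<in>B. \<Sum>b'\<in>B'. \<Sum>l\<in>L b. f a b a' b' l k)"
  proof (rule sum.cong[OF refl])
    fix a'
    have "(\<Sum>b\<in>B. \<Sum>b'\<in>B'. \<Sum>l\<in>L b. \<Sum>k\<in>K a'. f a b a' b' l k) =
      (\<Sum>b\<in>B. \<Sum>b'\<in>B'. \<Sum>k\<in>K a'. \<Sum>l\<in>L b. f a b a' b' l k)"
      by (rule sum.cong[OF refl], rule sum.cong[OF refl], rule sum.swap)
    also have "\<dots> = (\<Sum>b\<in>B. \<Sum>k\<in>K a'. \<Sum>b'\<in>B'. \<Sum>l\<in>L b. f a b a' b' l k)"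
      by (rule sum.cong[OF refl], rule sum.swap)
    also have "\<dots> = (\<Sum>k\<in>K a'. \<Sum>b\<in>B. \<Sum>b'\<in>B'. \<Sum>l\<in>L b. f a b a' b' l k)"
      by (rule sum.swap)
    finally show "(\<Sum>b\<in>B. \<Sum>b'\<in>B'. \<Sum>l\<in>L b. \<Sum>k\<in>K a'. f a b a' b' l k) = \<dots>" .
  qed
  finally show "(\<Sum>b\<in>B. \<Sum>a'\<in>A'. \<Sum>b'\<in>B'. \<Sum>l\<in>L b. \<Sum>k\<in>K a'. f a b a' b' l k) = \<dots>" .
qed

lemma bar_sum_sum: "bar (sum f I) (sum g J) = (\<Sum>i\<in>I. \<Sum>j\<in>J. bar (f i) (g j))"
  by (subst bar_linear(9)) (simp only: bar_linear(10))

lemma bar_ins_of: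
  "bar (ins_right m (frag_of (a, b))) (ins_left m (frag_of (a', b'))) =
   (\<Sum>l<max 1 (length b). \<Sum>k<max 1 (length a').
      frag_cmul ((-1) ^ fdim (drop (Suc l) b) * (-1) ^ (fdim b' + fdim (drop (Suc k) a'))
        * (-1) ^ (fdim (ins m k a') * fdim (ins m l b)))
       (frag_of (a @ ins m k a', ins m l b @ b')))"
proof -
  have 1: "ins_right m (frag_of (a, b)) = (\<Sum>l<max 1 (length b).
      frag_cmul ((-1) ^ fdim (drop (Suc l) b)) (frag_of (a, ins m l b)))"
    by (simp add: ins_right_of insert_face_def linear del: max_0L max_0R)
  have 2: "ins_left m (frag_of (a', b')) = (\<Sum>k<max 1 (length a').
      frag_cmul ((-1) ^ (fdim b' + fdim (drop (Suc k) a'))) (frag_of (ins m k a', b')))"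
    by (simp add: ins_left_of insert_face_def linear frag_cmul_sum power_add)
  show ?thesis unfolding 1 2 bar_sum_sum
    by (simp add: linear bar_of frag_cmul_sum mult_ac)
qed

lemma word_chain_peak:
  assumes w: "distinct (u @ m # v)" "\<forall>x\<in>set u \<union> set v. x < m"
  shows "word_chain (u @ m # v) = frag_cmul ((-1) ^ crossings (set u) (set v))
    (bar (ins_right m (word_chain u)) (ins_left m (word_chain v)))"
proof -
  define g where "g a b a' b' l k = frag_cmul (coef u a b * coef v a' b' *
       ((-1) ^ fdim (drop (Suc l) b) * (-1) ^ (fdim b' + fdim (drop (Suc k) a'))
        * (-1) ^ (fdim (ins m k a') * fdim (ins m l b))))
       (frag_of (a @ ins m k a', ins m l b @ b'))" for a b a' b' l k
  have "bar (ins_right m (word_chain u)) (ins_left m (word_chain v)) =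
    (\<Sum>a\<in>cols u. \<Sum>b\<in>rows u. \<Sum>a'\<in>cols v. \<Sum>b'\<in>rows v.
      frag_cmul (coef u a b * coef v a' b')
        (bar (ins_right m (frag_of (a, b))) (ins_left m (frag_of (a', b')))))"
    unfolding word_chain_def ins_right_linear ins_left_linear bar_linear(7,9)
    by (simp only: bar_linear(8,10) frag_cmul_cmul frag_cmul_sum)
  also have "\<dots> = (\<Sum>a\<in>cols u. \<Sum>b\<in>rows u. \<Sum>a'\<in>cols v. \<Sum>b'\<in>rows v.
      \<Sum>l<max 1 (length b). \<Sum>k<max 1 (length a'). g a b a' b' l k)"
    by (simp only: bar_ins_of g_def frag_cmul_cmul frag_cmul_sum)
  also have "\<dots> = (\<Sum>a\<in>cols u. \<Sum>a'\<in>cols v. \<Sum>k<max 1 (length a').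
      \<Sum>b\<in>rows u. \<Sum>b'\<in>rows v. \<Sum>l<max 1 (length b). g a b a' b' l k)"
    by (rule sum_reorder)
  finally have R: "bar (ins_right m (word_chain u)) (ins_left m (word_chain v)) = \<dots>" .
  have "word_chain (u @ m # v) = (\<Sum>a\<in>cols u. \<Sum>a'\<in>cols v. \<Sum>k<max 1 (length a').
      \<Sum>b\<in>rows u. \<Sum>b'\<in>rows v. \<Sum>l<max 1 (length b).
        frag_cmul ((-1) ^ crossings (set u) (set v)) (g a b a' b' l k))"
    unfolding word_chain_def sum_cols_peak[OF w] sum_rows_peak[OF w]
    by (intro sum.cong refl) (simp add: g_def coef_peak[OF w] mult.assoc)
  then show ?thesis
    unfolding R frag_cmul_sum .
qed

lemma word_diag_insert:
  assumes "finite S" "\<forall>x\<in>S. x < m"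
  shows "word_diag (insert m S) = (\<Sum>A\<in>Pow S. frag_cmul ((-1) ^ crossings A (S - A))
         (bar (ins_right m (word_diag A)) (ins_left m (word_diag (S - A)))))"
proof -
  have "word_chain (u @ m # v) = frag_cmul ((-1) ^ crossings A (S - A))
    (bar (ins_right m (word_chain u)) (ins_left m (word_chain v)))"
    if "A \<in> Pow S" "u \<in> words A" "v \<in> words (S - A)" for A u v
  proof -
    have "distinct (u @ m # v)" "\<forall>x\<in>set u \<union> set v. x < m" "set u = A" "set v = S - A"
      using that assms(2) by (auto simp: words_def)
    then show ?thesis using word_chain_peak by metis
  qed
  then have "word_diag (insert m S) = (\<Sum>A\<in>Pow S. \<Sum>u\<in>words A. \<Sum>v\<in>words (S - A).
      frag_cmul ((-1) ^ crossings A (S - A)) (bar (ins_right m (word_chain u)) (ins_left m (word_chain v))))"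
    unfolding word_diag_def sum_words_insert[OF assms] by (intro sum.cong refl) blast
  then show ?thesis
    unfolding word_diag_def ins_right_linear ins_left_linear bar_sum_sum frag_cmul_sum .
qed

lemma word_diag_empty: "word_diag {} = frag_of ([], [])"
proof -
  have "coef [] [] [] = 1"
    by (subst coef_exponent) (auto simp: step_cols_def face_of_def rexp_def binomial_eq_0)
  then show ?thesis by (simp add: word_diag_def word_chain_def)
qed

lemma keys_word_diag:
  assumes "finite S" "z \<in> Poly_Mapping.keys (word_diag S)"
  obtains w where "w \<in> words S" "fst z \<in> cols w" "snd z \<in> rows w"
  using assms(2) unfolding word_diag_def word_chain_def
  by (fastforce dest!: subsetD[OF keys_sum])

lemma word_diag_face_chains2:
  assumes "finite S" shows "word_diag S \<in> face_chains2 S"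
  unfolding face_chains2_def
proof (clarify)
  fix a b assume "(a, b) \<in> Poly_Mapping.keys (word_diag S)"
  then obtain w where "w \<in> words S" "a \<in> cols w" "b \<in> rows w"
    using keys_word_diag[OF assms] by (metis fst_conv snd_conv)
  then show "a \<in> faces S \<and> b \<in> faces S"
    using cols_faces rows_faces by (auto simp: words_def)
qed

text \<open>The two faces have \<open>ncol w + nrow w = card S + 1\<close> blocks in total, so their
  dimensions add up to \<open>card S - 1\<close>.\<close>

lemma hom_chain2_word_diag:
  assumes "finite S" "S \<noteq> {}" shows "hom_chain2 (Suc (card S)) (word_diag S)"
  unfolding hom_chain2_def
proof
  fix z assume "z \<in> Poly_Mapping.keys (word_diag S)"
  then obtain w where w: "w \<in> words S" "fst z \<in> cols w" "snd z \<in> rows w"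
    using keys_word_diag[OF assms(1)] by blast
  then have d: "distinct w" "set w = S" "w \<noteq> []" using assms by (auto simp: words_def)
  have 1: "fst z \<in> faces S" "length (fst z) = ncol w" "snd z \<in> faces S" "length (snd z) = nrow w"
    using cols_faces rows_faces w d by blast+
  have "fdim (fst z) + length (fst z) = card S" "fdim (snd z) + length (snd z) = card S"
    using fdim_length[OF faces_disjoint_blocks faces_good] 1 assms(1) faces_Union by metis+
  moreover have "ncol w + nrow w = Suc (card S)" using ncol_nrow[OF d(1,3)] d distinct_card by metis
  ultimately have eq: "fdim (fst z) + fdim (snd z) + Suc (card S) = 2 * card S"
    using 1 by linarith
  then show "even (fdim (fst z) + fdim (snd z) + Suc (card S))" unfolding eq by simp
qed

lemma bd2_word_diag:
  assumes "finite S"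
  shows "bd2 (word_diag S) = (\<Sum>A\<in>Pow S. frag_cmul (if A \<noteq> {} \<and> S - A \<noteq> {} then
        (-1) ^ (card A + crossings A (S - A)) else 0) (bar (word_diag A) (word_diag (S - A))))"
  by (rule recursive_diagonal_coderivation[OF word_diag_empty word_diag_face_chains2
        hom_chain2_word_diag word_diag_insert assms])

section \<open>Relabelling\<close>

lemma length_relabel [simp]: "length (relabel f u) = length u"
  by (simp add: relabel_def)

lemma relabel_face_of: "face_of p (f ` S) \<phi> = relabel f (face_of p S (\<phi> \<circ> f))"
  by (auto simp: face_of_def relabel_def)

lemma strict_mono_on_less_iff:
  "strict_mono_on S f \<Longrightarrow> a \<in> S \<Longrightarrow> b \<in> S \<Longrightarrow> f a < f b \<longleftrightarrow> a < b" for f :: "nat \<Rightarrow> nat"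
  by (metis linorder_neqE_nat less_asym strict_mono_onD)

lemma asc_map: "strict_mono_on (set w) f \<Longrightarrow> asc (map f w) = asc w" for f :: "nat \<Rightarrow> nat"
proof (induction w rule: asc.induct)
  case (1 x y w)
  have "strict_mono_on (set (y # w)) f" by (rule monotone_on_subset[OF 1(2)]) auto
  moreover have "f x < f y \<longleftrightarrow> x < y" using 1(2) by (intro strict_mono_on_less_iff) auto
  ultimately show ?case using 1(1) by simp
qed auto

lemma des_map: "strict_mono_on (set w) f \<Longrightarrow> des (map f w) = des w" for f :: "nat \<Rightarrow> nat"
proof (induction w rule: des.induct)
  case (1 x y w)
  have "strict_mono_on (set (y # w)) f" by (rule monotone_on_subset[OF 1(2)]) auto
  moreover have "f y < f x \<longleftrightarrow> y < x" using 1(2) by (intro strict_mono_on_less_iff) auto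
  ultimately show ?case using 1(1) by simp
qed auto

lemma takeWhile_map_neq:
  assumes "inj_on f (set w)" "x \<in> set w"
  shows "takeWhile (\<lambda>y. y \<noteq> f x) (map f w) = map f (takeWhile (\<lambda>y. y \<noteq> x) w)"
  unfolding takeWhile_map
  by (rule arg_cong[of _ _ "map f"], rule takeWhile_cong) (use assms in \<open>auto dest: inj_onD\<close>)

lemma cix_map: "strict_mono_on (set w) f \<Longrightarrow> x \<in> set w \<Longrightarrow> cix (map f w) (f x) = cix w x"
  and rix_map: "strict_mono_on (set w) f \<Longrightarrow> x \<in> set w \<Longrightarrow> rix (map f w) (f x) = rix w x"
proof -
  assume f: "strict_mono_on (set w) f" and x: "x \<in> set w"
  have "inj_on f (set w)" by (rule strict_mono_on_imp_inj_on[OF f])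
  then have t: "takeWhile (\<lambda>y. y \<noteq> f x) (map f w) @ [f x] = map f (takeWhile (\<lambda>y. y \<noteq> x) w @ [x])"
    using x by (simp add: takeWhile_map_neq)
  have "strict_mono_on (set (takeWhile (\<lambda>y. y \<noteq> x) w @ [x])) f"
    by (rule monotone_on_subset[OF f]) (use x in \<open>auto dest: set_takeWhileD\<close>)
  then show "cix (map f w) (f x) = cix w x" "rix (map f w) (f x) = rix w x"
    unfolding cix_def rix_def t by (rule asc_map, rule des_map)
qed

lemma ncol_map: "strict_mono_on (set w) f \<Longrightarrow> ncol (map f w) = ncol w"
  and nrow_map: "strict_mono_on (set w) f \<Longrightarrow> nrow (map f w) = nrow w"
  by (simp_all add: ncol_def nrow_def asc_map des_map)

lemma colok_map: "strict_mono_on (set w) f \<Longrightarrow> colok (map f w) \<phi> \<longleftrightarrow> colok w (\<phi> \<circ> f)"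
  unfolding colok_def by (simp add: cix_map ncol_map strict_mono_on_less_iff cong: ball_cong)

lemma rowok_map: "strict_mono_on (set w) f \<Longrightarrow> rowok (map f w) \<psi> \<longleftrightarrow> rowok w (\<psi> \<circ> f)"
  unfolding rowok_def by (simp add: rix_map strict_mono_on_less_iff cong: ball_cong)

lemma cols_map:
  assumes f: "strict_mono_on (set w) f"
  shows "cols (map f w) = relabel f ` cols w"
proof (intro equalityI subsetI)
  fix a assume "a \<in> cols (map f w)"
  then show "a \<in> relabel f ` cols w"
    using f by (auto simp: cols_def ncol_map relabel_face_of colok_map)
next
  fix a assume "a \<in> relabel f ` cols w"
  then obtain \<phi> where \<phi>: "colok w \<phi>" "a = relabel f (face_of (ncol w) (set w) \<phi>)"
    by (auto simp: cols_def)
  \<comment> \<open>Since \<open>colok_map\<close> pulls position functions back along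
    \<open>f\<close>, a function on \<open>set w\<close> is carried forward by the inverse.\<close>
  define \<phi>' where "\<phi>' = \<phi> \<circ> inv_into (set w) f"
  have e: "(\<phi>' \<circ> f) x = \<phi> x" if "x \<in> set w" for x
    using that strict_mono_on_imp_inj_on[OF f] by (simp add: \<phi>'_def)
  have "colok (map f w) \<phi>'" using \<phi>(1) e by (simp add: colok_map[OF f] cong: colok_cong)
  moreover have "a = face_of (ncol (map f w)) (set (map f w)) \<phi>'"
    unfolding \<phi>(2) set_map relabel_face_of ncol_map[OF f]
    by (rule arg_cong[of _ _ "relabel f"], rule face_of_cong) (rule e[symmetric])
  ultimately show "a \<in> cols (map f w)" unfolding cols_def by blast
qed

lemma rows_map:
  assumes f: "strict_mono_on (set w) f"
  shows "rows (map f w) = relabel f ` rows w"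
proof (intro equalityI subsetI)
  fix a assume "a \<in> rows (map f w)"
  then show "a \<in> relabel f ` rows w"
    using f by (auto simp: rows_def nrow_map relabel_face_of rowok_map)
next
  fix a assume "a \<in> relabel f ` rows w"
  then obtain \<phi> where \<phi>: "rowok w \<phi>" "a = relabel f (face_of (nrow w) (set w) \<phi>)"
    by (auto simp: rows_def)
  define \<phi>' where "\<phi>' = \<phi> \<circ> inv_into (set w) f"
  have e: "(\<phi>' \<circ> f) x = \<phi> x" if "x \<in> set w" for x
    using that strict_mono_on_imp_inj_on[OF f] by (simp add: \<phi>'_def)
  have "rowok (map f w) \<phi>'" using \<phi>(1) e by (simp add: rowok_map[OF f] cong: rowok_cong)
  moreover have "a = face_of (nrow (map f w)) (set (map f w)) \<phi>'"
    unfolding \<phi>(2) set_map relabel_face_of nrow_map[OF f]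
    by (rule arg_cong[of _ _ "relabel f"], rule face_of_cong) (rule e[symmetric])
  ultimately show "a \<in> rows (map f w)" unfolding rows_def by blast
qed

lemma relabel_inj_on:
  assumes "inj_on f S" shows "inj_on (relabel f) {u. \<Union>(set u) \<subseteq> S}"
proof (rule inj_onI)
  fix u v assume "u \<in> {u. \<Union>(set u) \<subseteq> S}" "v \<in> {u. \<Union>(set u) \<subseteq> S}" "relabel f u = relabel f v"
  moreover have "inj_on (image f) (Pow S)" by (rule inj_on_image_Pow[OF assms])
  ultimately show "u = v"
    unfolding relabel_def by (intro map_inj_on[of "image f" u v]) (auto elim!: inj_on_subset)
qed

lemma exponents_relabel:
  assumes "strict_mono_on S f" "\<Union>(set u) \<subseteq> S"
  shows "wpos (relabel f u) = wpos u" "pcross (relabel f u) = pcross u" "rexp (relabel f u) = rexp u"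
proof -
  have c: "card (f ` B) = card B" if "B \<subseteq> S" for B
    by (rule card_image[OF inj_on_subset[OF strict_mono_on_imp_inj_on[OF assms(1)] that]])
  show "wpos (relabel f u) = wpos u" "pcross (relabel f u) = pcross u" "rexp (relabel f u) = rexp u"
    using assms(2)
  proof (induction u)
    case (Cons U u)
    {
      case 1
      then show ?case using Cons c by (simp add: relabel_def)
    next
      case 2
      have "\<Union>(set (relabel f u)) = f ` \<Union>(set u)" by (auto simp: relabel_def)
      then show ?case using Cons 2 crossings_image[OF assms(1), of U "\<Union>(set u)"]
        by (simp add: relabel_def)
    next
      case 3
      then show ?case using Cons c by (simp add: relabel_def rexp_def)
    }
  qed (simp_all add: relabel_def)
qed

lemma step_cols_map:
  assumes f: "strict_mono_on (set w) f"
  shows "step_cols (map f w) = relabel f (step_cols w)"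
  unfolding step_cols_def set_map relabel_face_of ncol_map[OF f]
  by (rule arg_cong[of _ _ "relabel f"], rule face_of_cong) (simp add: cix_map[OF f])

lemma coef_map:
  assumes f: "strict_mono_on (set w) f" and d: "distinct w" and ab: "a \<in> cols w" "b \<in> rows w"
  shows "coef (map f w) (relabel f a) (relabel f b) = coef w a b"
proof -
  have d': "distinct (map f w)" using d strict_mono_on_imp_inj_on[OF f] by (simp add: distinct_map)
  have U: "\<Union>(set a) \<subseteq> set w" "\<Union>(set b) \<subseteq> set w" "\<Union>(set (step_cols w)) \<subseteq> set w"
    using cols_faces rows_faces d ab step_cols_in_cols faces_Union by blast+
  have "relabel f a \<in> cols (map f w)" "relabel f b \<in> rows (map f w)"
    using ab by (auto simp: cols_map[OF f] rows_map[OF f])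
  then show ?thesis
    unfolding coef_exponent[OF d ab] coef_exponent[OF d' \<open>relabel f a \<in> _\<close> \<open>relabel f b \<in> _\<close>]
    by (simp only: nrow_map[OF f] step_cols_map[OF f] exponents_relabel[OF f U(1)]
        exponents_relabel[OF f U(2)] exponents_relabel[OF f U(3)])
qed

text \<open>Words, their faces and all signs depend only on the relative order of the entries, so
  the construction is natural under order-preserving maps.\<close>

lemma word_diag_image:
  assumes f: "strict_mono_on S f"
  shows "word_diag (f ` S) = frag_extend (\<lambda>(a, b). frag_of (relabel f a, relabel f b)) (word_diag S)"
proof -
  have inj: "inj_on f S" by (rule strict_mono_on_imp_inj_on[OF f])
  have "words (f ` S) = map f ` words S"
  proof (intro equalityI subsetI)
    fix w assume w: "w \<in> words (f ` S)"
    define v where "v = map (inv_into S f) w"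
    have "map f v = w" using w by (auto simp: v_def words_def f_inv_into_f intro!: map_idI)
    moreover have "set v = S" using w inj by (simp add: v_def words_def)
    moreover have "distinct v" using \<open>map f v = w\<close> w by (auto simp: words_def distinct_map)
    ultimately show "w \<in> map f ` words S" by (auto simp: words_def)
  next
    fix w assume "w \<in> map f ` words S"
    then show "w \<in> words (f ` S)" using inj by (auto simp: words_def distinct_map)
  qed
  moreover have "inj_on (map f) (words S)"
    by (rule inj_onI) (metis (mono_tags, lifting) inj inj_on_map_eq_map words_def mem_Collect_eq Un_absorb)
  moreover have "word_chain (map f w) =
      frag_extend (\<lambda>(a, b). frag_of (relabel f a, relabel f b)) (word_chain w)" if "w \<in> words S" for w
  proof -
    have w: "distinct w" "set w = S" using that by (auto simp: words_def)
    have fw: "strict_mono_on (set w) f" using f w by simp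
    have "\<Union>(set a) = S" if "a \<in> cols w \<or> a \<in> rows w" for a
      using that cols_faces[OF w(1)] rows_faces[OF w(1)] faces_Union w(2) by blast
    then have ic: "inj_on (relabel f) (cols w)" "inj_on (relabel f) (rows w)"
      by (auto intro!: inj_on_subset[OF relabel_inj_on[OF inj]] simp del: Union_iff)
    show ?thesis
      unfolding word_chain_def cols_map[OF fw] rows_map[OF fw]
      by (simp add: sum.reindex ic linear coef_map[OF fw w(1)] cong: sum.cong)
  qed
  ultimately show ?thesis
    unfolding word_diag_def by (simp add: sum.reindex linear)
qed

lemma order_label_image:
  assumes "finite U"
  shows "strict_mono_on {1..card U} (order_label U)" "order_label U ` {1..card U} = U"
proof -
  let ?l = "sorted_list_of_set U"
  have l: "length ?l = card U" "sorted ?l" "distinct ?l" "set ?l = U" using assms by auto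
  show "strict_mono_on {1..card U} (order_label U)"
  proof (rule strict_mono_onI)
    fix i j assume "i \<in> {1..card U}" "j \<in> {1..card U}" "i < j"
    then show "order_label U i < order_label U j"
      unfolding order_label_def using l
      by (intro sorted_wrt_nth_less[of "(<)"]) (auto simp: strict_sorted_iff)
  qed
  have "order_label U ` {1..card U} = (\<lambda>i. ?l ! i) ` {..<card U}"
  proof -
    have "{1..card U} = Suc ` {..<card U}" by (simp add: image_Suc_lessThan)
    then show ?thesis by (simp add: image_image order_label_def)
  qed
  also have "\<dots> = set ?l" unfolding l(1)[symmetric] by (auto simp: set_conv_nth)
  also have "\<dots> = U" by (rule l(4))
  finally show "order_label U ` {1..card U} = U" .
qed

section \<open>Configuration matrices and words\<close>

text \<open>Only non-zero values are mentioned: a non-zero value occurs exactly at its prescribed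
  position, which forces 0 everywhere else and so determines the matrix.\<close>

definition placed :: "mtx \<Rightarrow> nat set \<Rightarrow> (nat \<Rightarrow> nat) \<Rightarrow> (nat \<Rightarrow> nat) \<Rightarrow> bool" where
  "placed X S r c \<longleftrightarrow> (\<forall>i j x. x \<noteq> 0 \<longrightarrow> (X i j = x \<longleftrightarrow> x \<in> S \<and> r x = i \<and> c x = j))"

lemma placedD: "placed X S r c \<Longrightarrow> X i j \<noteq> 0 \<Longrightarrow> X i j \<in> S \<and> r (X i j) = i \<and> c (X i j) = j"
  unfolding placed_def by metis

lemma placedI: "placed X S r c \<Longrightarrow> 0 \<notin> S \<Longrightarrow> x \<in> S \<Longrightarrow> X (r x) (c x) = x"
  unfolding placed_def by metis

lemma placed_unique: "placed X S r c \<Longrightarrow> placed Y S r c \<Longrightarrow> X = Y"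
  unfolding placed_def by (intro ext) metis

lemma placed_cong:
  "placed X S r c \<Longrightarrow> (\<And>x. x \<in> S \<Longrightarrow> r x = r' x) \<Longrightarrow> (\<And>x. x \<in> S \<Longrightarrow> c x = c' x) \<Longrightarrow> placed X S r' c'"
  unfolding placed_def by metis

lemma ex_placed:
  assumes "\<And>x y. x \<in> S \<Longrightarrow> y \<in> S \<Longrightarrow> r x = r y \<Longrightarrow> c x = c y \<Longrightarrow> x = y"
  shows "\<exists>X. placed X S r c"
proof -
  define X where "X i j = (if \<exists>x\<in>S. r x = i \<and> c x = j then (THE x. x \<in> S \<and> r x = i \<and> c x = j) else 0)" for i j
  have "X (r x) (c x) = x" if "x \<in> S" for x
  proof -
    have "(THE y. y \<in> S \<and> r y = r x \<and> c y = c x) = x" using that assms by blast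
    then show ?thesis using that by (auto simp: X_def)
  qed
  moreover have "X i j = 0" if "\<not> (\<exists>x\<in>S. r x = i \<and> c x = j)" for i j
    using that by (auto simp: X_def)
  ultimately have "placed X S r c" unfolding placed_def by metis
  then show ?thesis by blast
qed

lemma col_set_placed:
  assumes "placed X S r c" "0 \<notin> S" shows "col_set X j = {x \<in> S. c x = j}"
proof (intro equalityI subsetI)
  fix x assume "x \<in> col_set X j"
  then obtain i where "x = X i j" "X i j \<noteq> 0" by (auto simp: col_set_def)
  then show "x \<in> {x \<in> S. c x = j}" using placedD[OF assms(1), of i j] by simp
next
  fix x assume "x \<in> {x \<in> S. c x = j}"
  then have "X (r x) j = x" "x \<noteq> 0" using placedI[OF assms, of x] assms(2) by (cases "x = 0"; simp)+
  then show "x \<in> col_set X j" unfolding col_set_def by (intro CollectI exI[of _ "r x"]) simp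
qed

lemma row_set_placed:
  assumes "placed X S r c" "0 \<notin> S" shows "row_set X i = {x \<in> S. r x = i}"
proof (intro equalityI subsetI)
  fix x assume "x \<in> row_set X i"
  then obtain j where "x = X i j" "X i j \<noteq> 0" by (auto simp: row_set_def)
  then show "x \<in> {x \<in> S. r x = i}" using placedD[OF assms(1), of i j] by simp
next
  fix x assume "x \<in> {x \<in> S. r x = i}"
  then have "X i (c x) = x" "x \<noteq> 0" using placedI[OF assms, of x] assms(2) by (cases "x = 0"; simp)+
  then show "x \<in> row_set X i" unfolding row_set_def by (intro CollectI exI[of _ "c x"]) simp
qed

section \<open>Geometry of the lattice path of a word\<close>

lemma cix_nth: "distinct w \<Longrightarrow> t < length w \<Longrightarrow> cix w (w ! t) = asc (take (Suc t) w)"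
  and rix_nth: "distinct w \<Longrightarrow> t < length w \<Longrightarrow> rix w (w ! t) = des (take (Suc t) w)"
proof -
  assume d: "distinct w" and t: "t < length w"
  have w: "w = take t w @ w ! t # drop (Suc t) w" using t by (rule id_take_nth_drop)
  have "w ! t \<notin> set (take t w)"
    using d by (subst (asm) w) simp
  then have "takeWhile (\<lambda>y. y \<noteq> w ! t) w = take t w"
    by (subst w) (rule takeWhile_peak(1))
  then show "cix w (w ! t) = asc (take (Suc t) w)" "rix w (w ! t) = des (take (Suc t) w)"
    by (simp_all add: cix_def rix_def take_Suc_conv_app_nth t)
qed

lemma cix_rix_0: "distinct w \<Longrightarrow> w \<noteq> [] \<Longrightarrow> cix w (w ! 0) = 0 \<and> rix w (w ! 0) = 0"
  by (simp add: cix_nth rix_nth take_Suc)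

lemma cix_rix_Suc:
  assumes "distinct w" "Suc t < length w"
  shows "cix w (w ! Suc t) = cix w (w ! t) + (if w ! t < w ! Suc t then 1 else 0)"
    and "rix w (w ! Suc t) = rix w (w ! t) + (if w ! Suc t < w ! t then 1 else 0)"
proof -
  have "take (Suc (Suc t)) w = take t w @ w ! t # [w ! Suc t]" "take (Suc t) w = take t w @ [w ! t]"
    using assms(2) by (simp_all add: take_Suc_conv_app_nth)
  then show "cix w (w ! Suc t) = cix w (w ! t) + (if w ! t < w ! Suc t then 1 else 0)"
    "rix w (w ! Suc t) = rix w (w ! t) + (if w ! Suc t < w ! t then 1 else 0)"
    using assms asc_append[of "take t w" "w ! t" "[w ! Suc t]"] des_append[of "take t w" "w ! t" "[w ! Suc t]"]
    by (simp_all add: cix_nth rix_nth)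
qed

text \<open>Every step of the path leads to the next diagonal, so the index of an entry in the word
  is the number of its diagonal, counted from the bottom left corner.\<close>

lemma cix_rix_sum: "distinct w \<Longrightarrow> t < length w \<Longrightarrow> cix w (w ! t) + rix w (w ! t) = t"
proof (induction t)
  case 0
  then show ?case using cix_rix_0 by auto
next
  case (Suc t)
  then have "w ! t \<noteq> w ! Suc t" by (simp add: nth_eq_iff_index_eq)
  then show ?case using Suc cix_rix_Suc[of w t] by auto
qed

lemma cix_rix_mono:
  assumes "distinct w" "t \<le> t'" "t' < length w"
  shows "cix w (w ! t) \<le> cix w (w ! t') \<and> rix w (w ! t) \<le> rix w (w ! t')"
  using assms(2,3)
proof (induction t' rule: dec_induct)
  case (step s)
  then show ?case using cix_rix_Suc[OF assms(1), of s] by auto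
qed simp

lemma row_increasing:
  assumes "distinct w" "t < t'" "t' < length w" "rix w (w ! t) = rix w (w ! t')"
  shows "w ! t < w ! t'"
  using assms(2-4)
proof (induction t' rule: less_Suc_induct)
  case (1 i)
  then have "w ! i \<noteq> w ! Suc i" using assms(1) by (simp add: nth_eq_iff_index_eq)
  then show ?case using 1 cix_rix_Suc(2)[OF assms(1), of i] by (auto split: if_splits)
next
  case (2 i j k)
  have "rix w (w ! i) \<le> rix w (w ! j)" "rix w (w ! j) \<le> rix w (w ! k)"
    using cix_rix_mono[OF assms(1), of i j] cix_rix_mono[OF assms(1), of j k] 2 by auto
  then show ?case using 2 by auto
qed

lemma col_increasing:
  assumes "distinct w" "t < t'" "t' < length w" "cix w (w ! t) = cix w (w ! t')"
  shows "w ! t' < w ! t"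
  using assms(2-4)
proof (induction t' rule: less_Suc_induct)
  case (1 i)
  then have "w ! i \<noteq> w ! Suc i" using assms(1) by (simp add: nth_eq_iff_index_eq)
  then show ?case using 1 cix_rix_Suc(1)[OF assms(1), of i] by (auto split: if_splits)
next
  case (2 i j k)
  have "cix w (w ! i) \<le> cix w (w ! j)" "cix w (w ! j) \<le> cix w (w ! k)"
    using cix_rix_mono[OF assms(1), of i j] cix_rix_mono[OF assms(1), of j k] 2 by auto
  then show ?case using 2 by auto
qed

lemma word_order:
  assumes w: "distinct w" "x \<in> set w" "y \<in> set w"
  shows "cix w x = cix w y \<Longrightarrow> rix w x = rix w y \<Longrightarrow> x = y"
    and "rix w x = rix w y \<Longrightarrow> cix w x < cix w y \<Longrightarrow> x < y"
    and "cix w x = cix w y \<Longrightarrow> rix w y < rix w x \<Longrightarrow> x < y"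
    and "rix w y < rix w x \<Longrightarrow> cix w y \<le> cix w x"
proof -
  obtain s t where st: "x = w ! s" "y = w ! t" "s < length w" "t < length w"
    using w by (metis in_set_conv_nth)
  have sums: "cix w x + rix w x = s" "cix w y + rix w y = t"
    using cix_rix_sum[OF w(1) st(3)] cix_rix_sum[OF w(1) st(4)] st by auto
  show "cix w x = cix w y \<Longrightarrow> rix w x = rix w y \<Longrightarrow> x = y"
    using sums st by metis
  show "x < y" if "rix w x = rix w y" "cix w x < cix w y"
  proof -
    have "s < t" using that sums st by linarith
    then show ?thesis using row_increasing[OF w(1) _ st(4)] that st by blast
  qed
  show "x < y" if "cix w x = cix w y" "rix w y < rix w x"
  proof -
    have "t < s" using that sums st by linarith
    then show ?thesis using col_increasing[OF w(1) _ st(3)] that st by metis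
  qed
  show "cix w y \<le> cix w x" if "rix w y < rix w x"
  proof (rule ccontr)
    assume "\<not> cix w y \<le> cix w x"
    then have "s \<le> t \<or> t \<le> s" "\<not> cix w (w ! t) \<le> cix w (w ! s)" "\<not> rix w (w ! s) \<le> rix w (w ! t)"
      using that st by auto
    then show False using cix_rix_mono[OF w(1)] st by blast
  qed
qed

text \<open>Matrix rows are numbered from the top beginning with 1 and \<open>rix\<close> counts
  from the bottom beginning with 0, hence the subtraction; columns are only shifted by one.\<close>

definition word_matrix :: "nat list \<Rightarrow> mtx \<Rightarrow> bool" where
  "word_matrix w E \<longleftrightarrow> placed E (set w) (\<lambda>x. nrow w - rix w x) (\<lambda>x. Suc (cix w x))"

lemma step_matrix_word_matrix:
  assumes w: "w \<in> words {1..p + q - 1}" "nrow w = q" "ncol w = p" "w \<noteq> []" and E: "word_matrix w E"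
  shows "step_matrix q p E"
proof -
  have d: "distinct w" "set w = {1..p + q - 1}" using w(1) by (auto simp: words_def)
  have len: "length w = p + q - 1" using d distinct_card by fastforce
  have z: "0 \<notin> set w" using d by auto
  have pl: "placed E (set w) (\<lambda>x. q - rix w x) (\<lambda>x. Suc (cix w x))"
    using E w by (simp add: word_matrix_def)
  have rl: "rix w x < q" "cix w x < p" if "x \<in> set w" for x
    using that rix_less_nrow cix_less_ncol d w by auto
  have E1: "E i j \<in> set w \<and> q - rix w (E i j) = i \<and> Suc (cix w (E i j)) = j" if "E i j \<noteq> 0" for i j
    using placedD[OF pl that] .
  have E2: "E (q - rix w x) (Suc (cix w x)) = x" if "x \<in> set w" for x
    using placedI[OF pl z that] .
  have nz: "x \<noteq> 0" if "x \<in> set w" for x using that z by metis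
  have ordered: "ordered_matrix q p E"
    unfolding ordered_matrix_def
  proof (intro conjI allI ballI impI)
    fix i j assume "E i j \<noteq> 0"
    then have "E i j \<in> set w" "i = q - rix w (E i j)" "j = Suc (cix w (E i j))" using E1 by auto
    then show "i \<in> {1..q}" "j \<in> {1..p}" using rl[of "E i j"] by auto
  next
    show "bij_betw (\<lambda>(i, j). E i j) {(i, j). E i j \<noteq> 0} {1..p + q - 1}"
    proof (rule bij_betw_byWitness[where f' = "\<lambda>x. (q - rix w x, Suc (cix w x))"])
      show "\<forall>a\<in>{(i, j). E i j \<noteq> 0}. (q - rix w (case a of (i, j) \<Rightarrow> E i j), Suc (cix w (case a of (i, j) \<Rightarrow> E i j))) = a"
        using E1 by auto
      show "\<forall>x\<in>{1..p + q - 1}. (case (q - rix w x, Suc (cix w x)) of (i, j) \<Rightarrow> E i j) = x"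
        using E2 d by auto
      show "(\<lambda>(i, j). E i j) ` {(i, j). E i j \<noteq> 0} \<subseteq> {1..p + q - 1}" using E1 d(2) by auto
      show "(\<lambda>x. (q - rix w x, Suc (cix w x))) ` {1..p + q - 1} \<subseteq> {(i, j). E i j \<noteq> 0}"
        using E2 nz d(2) by fastforce
    qed
  next
    fix i assume i: "i \<in> {1..q}"
    have "rowok w (rix w)" by (auto simp: rowok_def)
    moreover have "q - i < nrow w" using i w by auto
    ultimately obtain x where "x \<in> set w" "rix w x = q - i"
      using rowok_surj[OF d(1)] by blast
    then show "row_set E i \<noteq> {}" using i by (auto simp: row_set_placed[OF pl z])
  next
    fix j assume j: "j \<in> {1..p}"
    have "j - 1 < ncol w" using j w by auto
    then obtain x where "x \<in> set w" "cix w x = j - 1"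
      using colok_surj[OF d(1) colok_cix[OF d(1)]] by blast
    then show "col_set E j \<noteq> {}" using j by (auto simp: col_set_placed[OF pl z])
  next
    fix i j j' assume "j < j' \<and> E i j \<noteq> 0 \<and> E i j' \<noteq> 0"
    then have *: "j < j'" "E i j \<in> set w" "E i j' \<in> set w" "q - rix w (E i j) = i" "q - rix w (E i j') = i"
      "Suc (cix w (E i j)) = j" "Suc (cix w (E i j')) = j'" using E1 by auto
    then have "rix w (E i j) = rix w (E i j')" using rl(1)[OF *(2)] rl(1)[OF *(3)] by linarith
    then show "E i j < E i j'" using word_order(2)[OF d(1) *(2,3)] * by linarith
  next
    fix i i' j assume "i < i' \<and> E i j \<noteq> 0 \<and> E i' j \<noteq> 0"
    then have *: "i < i'" "E i j \<in> set w" "E i' j \<in> set w" "q - rix w (E i j) = i" "q - rix w (E i' j) = i'"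
      "Suc (cix w (E i j)) = j" "Suc (cix w (E i' j)) = j" using E1 by auto
    then have "rix w (E i' j) < rix w (E i j)" using rl(1)[OF *(2)] rl(1)[OF *(3)] by linarith
    then show "E i j < E i' j" using word_order(3)[OF d(1) *(2,3)] * by linarith
  qed
  have row: "E i k \<noteq> 0" if h: "j \<le> k" "k \<le> j'" "E i j \<noteq> 0" "E i j' \<noteq> 0" for i j k j'
  proof -
    obtain s t where st: "E i j = w ! s" "E i j' = w ! t" "s < length w" "t < length w"
      using E1[OF h(3)] E1[OF h(4)] by (metis in_set_conv_nth)
    have e: "q - rix w (w ! s) = i" "Suc (cix w (w ! s)) = j" "q - rix w (w ! t) = i" "Suc (cix w (w ! t)) = j'"
      using E1[OF h(3)] E1[OF h(4)] st by auto
    have r: "rix w (w ! s) = rix w (w ! t)" using e rl(1)[of "w ! s"] rl(1)[of "w ! t"] st by auto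
    note sums = cix_rix_sum[OF d(1) st(3)] cix_rix_sum[OF d(1) st(4)]
    \<comment> \<open>Between indices \<open>s\<close> and \<open>t\<close> the path stays in one
      row and advances one column per step, so column \<open>k\<close> is reached after
      \<open>k - j\<close> steps.\<close>
    define u where "u = s + (k - j)"
    have u: "s \<le> u" "u \<le> t" "u < length w" using sums e r h st by (auto simp: u_def)
    have "rix w (w ! u) = rix w (w ! s)"
      using cix_rix_mono[OF d(1) u(1,3)] cix_rix_mono[OF d(1) u(2) st(4)] r by auto
    moreover have "cix w (w ! u) = k - 1"
      using cix_rix_sum[OF d(1) u(3)] calculation sums e h unfolding u_def by linarith
    ultimately have "E i k = w ! u" using E2[of "w ! u"] u e h by auto
    then show ?thesis using nz u by auto
  qed
  have col: "E k j \<noteq> 0" if h: "i \<le> k" "k \<le> i'" "E i j \<noteq> 0" "E i' j \<noteq> 0" for i k i' j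
  proof -
    obtain s t where st: "E i j = w ! s" "E i' j = w ! t" "s < length w" "t < length w"
      using E1[OF h(3)] E1[OF h(4)] by (metis in_set_conv_nth)
    have e: "q - rix w (w ! s) = i" "Suc (cix w (w ! s)) = j" "q - rix w (w ! t) = i'" "Suc (cix w (w ! t)) = j"
      using E1[OF h(3)] E1[OF h(4)] st by auto
    have rl': "rix w (w ! s) < q" "rix w (w ! t) < q" using rl(1) st by auto
    have c: "cix w (w ! s) = cix w (w ! t)" using e by simp
    note sums = cix_rix_sum[OF d(1) st(3)] cix_rix_sum[OF d(1) st(4)]
    \<comment> \<open>Within a column the path runs upwards, so the lower row \<open>i'\<close>
      comes first and row \<open>k\<close> is reached \<open>i' - k\<close> steps later.\<close>
    define u where "u = t + (i' - k)"
    have u: "t \<le> u" "u \<le> s" "u < length w" using sums e c h st rl' by (auto simp: u_def)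
    have "cix w (w ! u) = cix w (w ! t)"
      using cix_rix_mono[OF d(1) u(1,3)] cix_rix_mono[OF d(1) u(2) st(3)] c by auto
    moreover have "rix w (w ! u) = q - k"
      using cix_rix_sum[OF d(1) u(3)] calculation sums e h rl' unfolding u_def by linarith
    moreover have "k \<le> q" using h e by auto
    ultimately have "E k j = w ! u" using E2[of "w ! u"] u e h by auto
    then show ?thesis using nz u by auto
  qed
  have diag: "\<exists>!z. E (fst z) (snd z) \<noteq> 0 \<and> int (snd z) - int (fst z) = \<delta>"
    if \<delta>: "\<delta> \<in> {1 - int q..int p - 1}" for \<delta>
  proof -
    \<comment> \<open>The diagonal \<open>1 - q\<close> is that of the bottom left corner and
      corresponds to index 0.\<close>
    define t where "t = nat (\<delta> + int q - 1)"
    have t: "t < length w" "int t = \<delta> + int q - 1" using \<delta> len by (auto simp: t_def)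
    have r: "rix w (w ! t) < q" using rl t by auto
    show ?thesis
    proof (rule ex1I[of _ "(q - rix w (w ! t), Suc (cix w (w ! t)))"], goal_cases)
      case 1
      have "E (q - rix w (w ! t)) (Suc (cix w (w ! t))) = w ! t" using E2 t by simp
      then show ?case using nz[of "w ! t"] t r cix_rix_sum[OF d(1) t(1)] by (auto simp: of_nat_diff)
    next
      case (2 z)
      obtain i j where zij: "z = (i, j)" by fastforce
      have nzE: "E i j \<noteq> 0" using 2 zij by simp
      obtain s where s: "E i j = w ! s" "s < length w" using E1[OF nzE] by (metis in_set_conv_nth)
      have e: "q - rix w (w ! s) = i" "Suc (cix w (w ! s)) = j" using E1[OF nzE] s by auto
      have "rix w (w ! s) < q" using rl s by auto
      then have "int s = \<delta> + int q - 1"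
        using 2 zij e cix_rix_sum[OF d(1) s(2)] by auto
      then have "s = t" using t by simp
      then show ?case using zij e by simp
    qed
  qed
  show ?thesis
    unfolding step_matrix_def
  proof (intro conjI allI impI ballI)
    fix i j k j' assume "j \<le> k \<and> k \<le> j' \<and> E i j \<noteq> 0 \<and> E i j' \<noteq> 0"
    then show "E i k \<noteq> 0" by (elim conjE) (rule row)
  next
    fix i k i' j assume "i \<le> k \<and> k \<le> i' \<and> E i j \<noteq> 0 \<and> E i' j \<noteq> 0"
    then show "E k j \<noteq> 0" by (elim conjE) (rule col)
  qed (fact ordered, rule diag)
qed

text \<open>The entries of a step matrix, read along the diagonals, form a lattice path from the bottom
  left to the top right corner: two consecutive entries which were not adjacent would leave a gap of
  at least two diagonals.\<close>
lemma ex_word_matrix: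
  assumes step: "step_matrix q p E" and pos: "q \<ge> 1" "p \<ge> 1"
  shows "\<exists>w\<in>words {1..p + q - 1}. nrow w = q \<and> ncol w = p \<and> word_matrix w E"
proof -
  define m where "m = p + q - 1"
  have ord: "ordered_matrix q p E" using step by (simp add: step_matrix_def)
  note o = ord[unfolded ordered_matrix_def] and st = step[unfolded step_matrix_def]
  have supp: "i \<in> {1..q} \<and> j \<in> {1..p}" if "E i j \<noteq> 0" for i j
    using o[THEN conjunct1] that by (elim allE impE)
  have bij: "bij_betw (\<lambda>(i, j). E i j) {(i, j). E i j \<noteq> 0} {1..m}"
    unfolding m_def by (rule o[THEN conjunct2, THEN conjunct1])
  have rowinc: "E i j < E i j'" if "j < j'" "E i j \<noteq> 0" "E i j' \<noteq> 0" for i j j'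
    using o[THEN conjunct2, THEN conjunct2, THEN conjunct2, THEN conjunct2, THEN conjunct1] that by simp
  have colinc: "E i j < E i' j" if "i < i'" "E i j \<noteq> 0" "E i' j \<noteq> 0" for i i' j
    using o[THEN conjunct2, THEN conjunct2, THEN conjunct2, THEN conjunct2, THEN conjunct2] that by simp
  have rowc: "E i k \<noteq> 0" if "j \<le> k" "k \<le> j'" "E i j \<noteq> 0" "E i j' \<noteq> 0" for i j k j'
    by (rule st[THEN conjunct2, THEN conjunct1, rule_format]) (use that in blast)
  have colc: "E k j \<noteq> 0" if "i \<le> k" "k \<le> i'" "E i j \<noteq> 0" "E i' j \<noteq> 0" for i k i' j
    by (rule st[THEN conjunct2, THEN conjunct2, THEN conjunct1, rule_format]) (use that in blast)
  have ex1: "\<exists>!z. E (fst z) (snd z) \<noteq> 0 \<and> int (snd z) - int (fst z) = \<delta>"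
    if "\<delta> \<in> {1 - int q..int p - 1}" for \<delta>
    by (rule st[THEN conjunct2, THEN conjunct2, THEN conjunct2, rule_format, OF that])
  have ex: "\<exists>i j. E i j \<noteq> 0 \<and> j + q = i + t + 1" if "t < m" for t
  proof -
    have "int t + 1 - int q \<in> {1 - int q..int p - 1}" using that by (auto simp: m_def)
    then obtain z where "E (fst z) (snd z) \<noteq> 0" "int (snd z) - int (fst z) = int t + 1 - int q"
      using ex1 by blast
    then show ?thesis by (intro exI[of _ "fst z"] exI[of _ "snd z"]) linarith
  qed
  have uniq: "i = i' \<and> j = j'" if "E i j \<noteq> 0" "E i' j' \<noteq> 0" "j + i' = j' + i" for i j i' j'
  proof -
    have "int j - int i \<in> {1 - int q..int p - 1}" using supp[OF that(1)] by auto
    moreover have "int j - int i = int j' - int i'" using that(3) by linarith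
    ultimately show ?thesis using ex1[of "int j - int i"] that(1,2)
      by (metis fst_conv snd_conv)
  qed
  \<comment> \<open>The position of the entry on the diagonal \<open>j - i = t + 1 - q\<close>,
    written additively to stay in the natural numbers; \<open>t = 0\<close> is the bottom left
    corner.\<close>
  define ri ci where "ri t = (SOME i. \<exists>j. E i j \<noteq> 0 \<and> j + q = i + t + 1)"
    and "ci t = ri t + t + 1 - q" for t
  have cell: "E (ri t) (ci t) \<noteq> 0" "ci t + q = ri t + t + 1" if "t < m" for t
  proof -
    note ex = ex[OF that]
    obtain j where "E (ri t) j \<noteq> 0" "j + q = ri t + t + 1"
      using someI_ex[OF ex] unfolding ri_def by blast
    moreover from this(2) have "j = ci t" unfolding ci_def by linarith
    ultimately show "E (ri t) (ci t) \<noteq> 0" "ci t + q = ri t + t + 1" by auto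
  qed
  have cellD: "i = ri t \<and> j = ci t" if "t < m" "E i j \<noteq> 0" "j + q = i + t + 1" for i j t
    using uniq[OF that(2) cell(1)[OF that(1)]] cell(2)[OF that(1)] that(3) by linarith
  have m0: "m > 0" using pos by (simp add: m_def)
  have start: "ri 0 = q" "ci 0 = 1"
    using supp[OF cell(1)[OF m0]] cell(2)[OF m0] by auto
  \<comment> \<open>The rows from \<open>ri t\<close> down and the columns up to \<open>ci t\<close>
    are already occupied. If the next cell lay in one of them, contiguity would connect it to an
    earlier entry.\<close>
  define inv where "inv t \<longleftrightarrow> (\<forall>i'. ri t \<le> i' \<and> i' \<le> q \<longrightarrow> (\<exists>j2\<le>ci t. E i' j2 \<noteq> 0)) \<and>
     (\<forall>j'. 1 \<le> j' \<and> j' \<le> ci t \<longrightarrow> (\<exists>i2\<ge>ri t. E i2 j' \<noteq> 0))" for t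
  have next_cell: "(ri (Suc t) = ri t \<and> ci (Suc t) = Suc (ci t)) \<or> (Suc (ri (Suc t)) = ri t \<and> ci (Suc t) = ci t)"
    if t: "Suc t < m" and inv: "inv t" for t
  proof -
    let ?i = "ri t" and ?j = "ci t" and ?i' = "ri (Suc t)" and ?j' = "ci (Suc t)"
    note c = cell[of t, OF Suc_lessD[OF t]] and c' = cell[OF t]
    have dg: "?j' + ?i = ?j + ?i' + 1" using c(2) c'(2) by linarith
    have i1: "1 \<le> ?i'" "?i' \<le> q" "1 \<le> ?j'" using supp[OF c'(1)] by auto
    \<comment> \<open>In the first two cases the neighbour of the next cell on the way to the
      earlier entry is non-zero and lies on diagonal \<open>t\<close>, so it is the current cell. In
      the third case both coordinates advance, which skips a diagonal.\<close>
    consider "?j' \<le> ?j" | "?i' \<ge> ?i" | "?j' > ?j" "?i' < ?i" by linarith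
    then show ?thesis
    proof cases
      case 1
      then obtain i2 where i2: "i2 \<ge> ?i" "E i2 ?j' \<noteq> 0" using inv i1 unfolding inv_def by blast
      have "E (Suc ?i') ?j' \<noteq> 0"
        by (rule colc[OF _ _ c'(1) i2(2)]) (use i2 1 dg in linarith)+
      then have "Suc ?i' = ?i \<and> ?j' = ?j" using uniq[OF _ c(1)] dg by (metis add.commute add_Suc_right plus_1_eq_Suc)
      then show ?thesis by simp
    next
      case 2
      then obtain j2 where j2: "j2 \<le> ?j" "E ?i' j2 \<noteq> 0" using inv i1 unfolding inv_def by blast
      have "E ?i' (?j' - 1) \<noteq> 0"
        by (rule rowc[OF _ _ j2(2) c'(1)]) (use j2 2 dg in linarith)+
      then have "?i' = ?i \<and> ?j' - 1 = ?j"
        by (rule uniq[OF _ c(1)]) (use dg i1 in linarith)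
      then show ?thesis using i1 by linarith
    next
      case 3
      then show ?thesis using dg by linarith
    qed
  qed
  have inv: "inv t" if "t < m" for t
    using that
  proof (induction t)
    case 0
    have "E q 1 \<noteq> 0" using cell(1)[OF m0] start by simp
    then show ?case unfolding inv_def start by (metis le_antisym order_refl)
  next
    case (Suc t)
    then have IH: "inv t" by simp
    note c' = cell(1)[OF Suc.prems]
    from next_cell[OF Suc.prems IH] show ?case
    proof
      assume *: "ri (Suc t) = ri t \<and> ci (Suc t) = Suc (ci t)"
      show ?thesis unfolding inv_def
      proof (intro conjI allI impI)
        fix i' assume "ri (Suc t) \<le> i' \<and> i' \<le> q"
        then show "\<exists>j2\<le>ci (Suc t). E i' j2 \<noteq> 0" using IH * unfolding inv_def by (metis le_SucI)
      next
        fix j' assume j': "1 \<le> j' \<and> j' \<le> ci (Suc t)"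
        show "\<exists>i2\<ge>ri (Suc t). E i2 j' \<noteq> 0"
        proof (cases "j' = ci (Suc t)")
          case True
          then show ?thesis using c' by blast
        next
          case False
          then have "1 \<le> j' \<and> j' \<le> ci t" using j' * by linarith
          then show ?thesis using IH * unfolding inv_def by simp
        qed
      qed
    next
      assume *: "Suc (ri (Suc t)) = ri t \<and> ci (Suc t) = ci t"
      show ?thesis unfolding inv_def
      proof (intro conjI allI impI)
        fix i' assume i': "ri (Suc t) \<le> i' \<and> i' \<le> q"
        show "\<exists>j2\<le>ci (Suc t). E i' j2 \<noteq> 0"
        proof (cases "i' = ri (Suc t)")
          case True
          then show ?thesis using c' by blast
        next
          case False
          then have "ri t \<le> i' \<and> i' \<le> q" using i' * by linarith
          then show ?thesis using IH * unfolding inv_def by simp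
        qed
      next
        fix j' assume "1 \<le> j' \<and> j' \<le> ci (Suc t)"
        then obtain i2 where "i2 \<ge> ri t" "E i2 j' \<noteq> 0" using IH * unfolding inv_def by metis
        moreover have "ri (Suc t) \<le> ri t" using * by linarith
        ultimately show "\<exists>i2\<ge>ri (Suc t). E i2 j' \<noteq> 0" using order_trans by blast
      qed
    qed
  qed
  define v where "v t = E (ri t) (ci t)" for t
  define w where "w = map v [0..<m]"
  have lw: "length w = m" and nw: "\<And>t. t < m \<Longrightarrow> w ! t = v t" by (simp_all add: w_def)
  have vinj: "s = t" if "s < m" "t < m" "v s = v t" for s t
  proof -
    have "(ri s, ci s) = (ri t, ci t)"
      using inj_onD[OF bij_betw_imp_inj_on[OF bij], of "(ri s, ci s)" "(ri t, ci t)"] cell(1) that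
      by (simp add: v_def)
    then have "ri s = ri t" "ci s = ci t" by simp_all
    then show "s = t" using cell(2)[OF that(1)] cell(2)[OF that(2)] by linarith
  qed
  have dw: "distinct w" unfolding w_def distinct_map using vinj by (auto intro: inj_onI)
  have tE: "\<exists>t<m. i = ri t \<and> j = ci t" if "E i j \<noteq> 0" for i j
  proof -
    have s: "i \<in> {1..q}" "j \<in> {1..p}" using supp[OF that] by auto
    define t where "t = j + q - i - 1"
    have "t < m" "j + q = i + t + 1" using s by (auto simp: t_def m_def)
    then show ?thesis using cellD[OF _ that] by blast
  qed
  have setw: "set w = {1..m}"
  proof (intro equalityI subsetI)
    fix x assume "x \<in> set w"
    then obtain t where "t < m" "x = v t" by (auto simp: w_def)
    then show "x \<in> {1..m}" using bij_betwE[OF bij] cell(1) by (auto simp: v_def Suc_le_eq)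
  next
    fix x assume "x \<in> {1..m}"
    then obtain i j where "E i j \<noteq> 0" "x = E i j"
      using bij_betw_imp_surj_on[OF bij] by (fastforce simp: image_iff)
    moreover from this(1) obtain t where "t < m" "i = ri t" "j = ci t" using tE by blast
    ultimately show "x \<in> set w" by (auto simp: w_def v_def)
  qed
  have pos_t: "ri t + rix w (w ! t) = q \<and> ci t = Suc (cix w (w ! t))" if "t < m" for t
    using that
  proof (induction t)
    case 0
    have "w \<noteq> []" using lw m0 by auto
    then show ?case using start cix_rix_0[OF dw] by simp
  next
    case (Suc t)
    then have t: "t < m" "Suc t < length w" by (auto simp: lw)
    note c = cell(1)[OF t(1)] and c' = cell(1)[OF Suc.prems]
    note IH = Suc.IH[OF t(1)]
    from next_cell[OF Suc.prems inv[OF t(1)]] show ?case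
    proof
      assume *: "ri (Suc t) = ri t \<and> ci (Suc t) = Suc (ci t)"
      then have "v t < v (Suc t)" using rowinc[of "ci t" "Suc (ci t)" "ri t"] c c' by (simp add: v_def)
      then show ?thesis using cix_rix_Suc[OF dw t(2)] IH * nw t(1) Suc.prems by auto
    next
      assume *: "Suc (ri (Suc t)) = ri t \<and> ci (Suc t) = ci t"
      then have "v (Suc t) < v t" using colinc[of "ri (Suc t)" "ri t" "ci t"] c c' by (simp add: v_def)
      then show ?thesis using cix_rix_Suc[OF dw t(2)] IH * nw t(1) Suc.prems by auto
    qed
  qed
  define l where "l = m - 1"
  have l: "l < m" "m = Suc l" using m0 by (auto simp: l_def)
  \<comment> \<open>The last diagonal is \<open>j - i = p - 1\<close>, which meets the matrix only
    in the top right corner.\<close>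
  have endp: "ri l = 1" "ci l = p"
    using supp[OF cell(1)[OF l(1)]] cell(2)[OF l(1)] l(2) by (auto simp: m_def)
  have "take (Suc l) w = w" using lw l by simp
  then have "cix w (w ! l) = asc w" "rix w (w ! l) = des w" using cix_nth[OF dw] rix_nth[OF dw] lw l by auto
  moreover have "w \<noteq> []" using lw m0 by auto
  ultimately have pq: "nrow w = q" "ncol w = p"
    using pos_t[OF l(1)] endp by (auto simp: nrow_def ncol_def)
  have "placed E (set w) (\<lambda>x. q - rix w x) (\<lambda>x. Suc (cix w x))"
    unfolding placed_def
  proof (intro allI impI)
    fix i j x :: nat assume x: "x \<noteq> 0"
    show "E i j = x \<longleftrightarrow> x \<in> set w \<and> q - rix w x = i \<and> Suc (cix w x) = j"
    proof
      assume e: "E i j = x"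
      then obtain t where t: "t < m" "i = ri t" "j = ci t" using tE x by blast
      then have "x = w ! t" using e nw by (simp add: v_def)
      then show "x \<in> set w \<and> q - rix w x = i \<and> Suc (cix w x) = j"
        using t pos_t[OF t(1)] lw by auto
    next
      assume h: "x \<in> set w \<and> q - rix w x = i \<and> Suc (cix w x) = j"
      then obtain t where t: "t < m" "x = w ! t" using lw by (metis in_set_conv_nth)
      then have "i = ri t" "j = ci t" using h pos_t[OF t(1)] by auto
      then show "E i j = x" using t nw by (simp add: v_def)
    qed
  qed
  then have "word_matrix w E" by (simp add: word_matrix_def pq)
  moreover have "w \<in> words {1..p + q - 1}" using dw setw by (simp add: words_def m_def)
  ultimately show ?thesis using pq by blast
qed

section \<open>Moving entries to the right and down\<close>

lemma placed_move_right:
  assumes X: "placed X S r c" and z: "0 \<notin> S" and T: "T \<subseteq> S" "\<forall>x\<in>T. c x = k" and k: "k \<ge> 1"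
    and free: "\<And>x y. x \<in> T \<Longrightarrow> y \<in> S \<Longrightarrow> c y = Suc k \<Longrightarrow> r y \<noteq> r x"
  shows "placed (move_right T X) S r (\<lambda>x. if x \<in> T then Suc k else c x)"
  unfolding placed_def
proof (intro allI impI)
  fix i j x :: nat assume x: "x \<noteq> 0"
  have XD: "X i j \<in> S \<and> r (X i j) = i \<and> c (X i j) = j" if "X i j \<in> T" for i j
  proof -
    have "X i j \<noteq> 0" using that T(1) z by (metis subsetD)
    then show ?thesis using placedD[OF X] by blast
  qed
  have Xx: "X i j = x \<longleftrightarrow> x \<in> S \<and> r x = i \<and> c x = j" for i j
    using X x unfolding placed_def by blast
  show "move_right T X i j = x \<longleftrightarrow> x \<in> S \<and> r x = i \<and> (if x \<in> T then Suc k else c x) = j"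
  proof
    assume m: "move_right T X i j = x"
    show "x \<in> S \<and> r x = i \<and> (if x \<in> T then Suc k else c x) = j"
    proof (cases "X i (j - 1) \<in> T")
      case True
      then have e: "X i (j - 1) = x" using m by (simp add: move_right_def)
      then have "c x = j - 1" "c x = k" "x \<in> S" "r x = i" using True T XD by auto
      then show ?thesis using True e k by auto
    next
      case False
      then have "X i j \<notin> T" "X i j = x" using m x by (auto simp: move_right_def split: if_splits)
      then show ?thesis using Xx by auto
    qed
  next
    assume h: "x \<in> S \<and> r x = i \<and> (if x \<in> T then Suc k else c x) = j"
    show "move_right T X i j = x"
    proof (cases "x \<in> T")
      case True
      then have "j = Suc k" "c x = k" using h T by auto
      then have "X i (j - 1) = x" using Xx h by simp
      then show ?thesis using True by (simp add: move_right_def)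
    next
      case False
      then have e: "X i j = x" using Xx h by simp
      have "X i (j - 1) \<notin> T"
      proof
        assume y: "X i (j - 1) \<in> T"
        then have "c (X i (j - 1)) = k" "c (X i (j - 1)) = j - 1" "r (X i (j - 1)) = i" using XD T by auto
        then have "j = Suc k" using k by linarith
        then show False using free[OF y, of x] h False \<open>r (X i (j - 1)) = i\<close> by auto
      qed
      then show ?thesis using e False by (simp add: move_right_def)
    qed
  qed
qed

text \<open>After the first \<open>k\<close> moves, \<open>x\<close> is in column
  \<open>min (\<phi> x) (max (c x) (Suc k))\<close>. The target cell of the next move is free: an
  entry in it would lie to the right of \<open>x\<close> in the same row, hence be larger than
  \<open>x\<close> by \<open>inc\<close>, while \<open>valid\<close> makes it smaller.\<close>

lemma placed_fold_move_right:
  assumes X: "placed X S r c" and z: "0 \<notin> S"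
    and c: "\<And>x. x \<in> S \<Longrightarrow> 1 \<le> c x \<and> c x \<le> \<phi> x \<and> \<phi> x \<le> p"
    and M: "\<And>j. j \<in> {1..<p} \<Longrightarrow> M j = {x \<in> S. c x \<le> j \<and> j < \<phi> x}"
    and valid: "\<And>x y. x \<in> S \<Longrightarrow> y \<in> S \<Longrightarrow> c x < c y \<Longrightarrow> c y \<le> \<phi> x \<Longrightarrow> y < x"
    and inc: "\<And>x y. x \<in> S \<Longrightarrow> y \<in> S \<Longrightarrow> r x = r y \<Longrightarrow> c x < c y \<Longrightarrow> x < y"
    and p: "p \<ge> 1"
  shows "placed (fold (\<lambda>j. move_right (M j)) [1..<p] X) S r \<phi>"
proof -
  have *: "placed (fold (\<lambda>j. move_right (M j)) [1..<Suc k] X) S r (\<lambda>x. min (\<phi> x) (max (c x) (Suc k)))"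
    if "Suc k \<le> p" for k
    using that
  proof (induction k)
    case 0
    show ?case by (simp, rule placed_cong[OF X]) (use c in \<open>fastforce simp: min_def max_def\<close>)+
  next
    case (Suc k)
    let ?c = "\<lambda>x. min (\<phi> x) (max (c x) (Suc k))"
    have Mk: "M (Suc k) = {x \<in> S. c x \<le> Suc k \<and> Suc k < \<phi> x}" using Suc.prems by (intro M) auto
    have "placed (move_right (M (Suc k)) (fold (\<lambda>j. move_right (M j)) [1..<Suc k] X)) S r
       (\<lambda>x. if x \<in> M (Suc k) then Suc (Suc k) else ?c x)"
    proof (rule placed_move_right)
      show "placed (fold (\<lambda>j. move_right (M j)) [1..<Suc k] X) S r ?c" using Suc by simp
      show "\<forall>x\<in>M (Suc k). ?c x = Suc k" unfolding Mk by auto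
      fix x y assume x: "x \<in> M (Suc k)" and y: "y \<in> S" "?c y = Suc (Suc k)"
      \<comment> \<open>The moves made so far lead no further than column \<open>Suc k\<close>, so
        \<open>y\<close> is still in its original place.\<close>
      then have "c y = Suc (Suc k)" using c[OF y(1)] by (auto simp: min_def max_def split: if_splits)
      then have "c x < c y" "c y \<le> \<phi> x" "x \<in> S" using x unfolding Mk by auto
      then show "r y \<noteq> r x" using valid inc y(1) by (metis less_asym)
    qed (auto simp: z Mk)
    moreover have "fold (\<lambda>j. move_right (M j)) [1..<Suc (Suc k)] X =
        move_right (M (Suc k)) (fold (\<lambda>j. move_right (M j)) [1..<Suc k] X)" by simp
    ultimately have "placed (fold (\<lambda>j. move_right (M j)) [1..<Suc (Suc k)] X) S r
       (\<lambda>x. if x \<in> M (Suc k) then Suc (Suc k) else ?c x)" by (simp only:)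
    then show ?case
    proof (rule placed_cong)
      fix x assume "x \<in> S"
      then show "(if x \<in> M (Suc k) then Suc (Suc k) else ?c x) = min (\<phi> x) (max (c x) (Suc (Suc k)))"
        using c[of x] unfolding Mk by (auto simp: min_def max_def)
    qed (rule refl)
  qed
  have "placed (fold (\<lambda>j. move_right (M j)) [1..<Suc (p - 1)] X) S r (\<lambda>x. min (\<phi> x) (max (c x) (Suc (p - 1))))"
    by (rule *) (use p in simp)
  then have "placed (fold (\<lambda>j. move_right (M j)) [1..<p] X) S r (\<lambda>x. min (\<phi> x) (max (c x) p))"
    using p by simp
  then show ?thesis
  proof (rule placed_cong)
    fix x assume "x \<in> S"
    then show "min (\<phi> x) (max (c x) p) = \<phi> x" using c[of x] by simp
  qed (rule refl)
qed

definition mtranspose :: "mtx \<Rightarrow> mtx" where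
  "mtranspose X = (\<lambda>i j. X j i)"

lemma placed_mtranspose: "placed (mtranspose X) S r c \<longleftrightarrow> placed X S c r"
  unfolding placed_def mtranspose_def by blast

text \<open>Transposition lets the analysis of moves to the right serve for the moves down.\<close>

lemma fold_move_down:
  "fold (\<lambda>i. move_down (N i)) xs X = mtranspose (fold (\<lambda>i. move_right (N i)) xs (mtranspose X))"
proof (induction xs arbitrary: X)
  case (Cons i xs)
  have "mtranspose (move_down (N i) X) = move_right (N i) (mtranspose X)"
    by (intro ext) (simp add: mtranspose_def move_down_def move_right_def)
  then show ?case using Cons by simp
qed (simp add: mtranspose_def)

text \<open>The sets \<open>M\<^sub>1, \<dots>, M\<^sub>p\<^sub>-\<^sub>1\<close> of moved elements are encoded by the final positions of all elements.\<close>
lemma ex_final_position: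
  fixes c :: "nat \<Rightarrow> nat"
  assumes M0: "M 0 = {}" "M p = {}"
    and M: "\<And>j. j \<in> {1..<p} \<Longrightarrow> M j \<subseteq> {x \<in> S. c x = j} \<union> M (j - 1)"
    and c: "\<And>x. x \<in> S \<Longrightarrow> 1 \<le> c x \<and> c x \<le> p"
  shows "\<exists>\<phi>. (\<forall>x\<in>S. c x \<le> \<phi> x \<and> \<phi> x \<le> p) \<and> (\<forall>j\<in>{1..<p}. M j = {x \<in> S. c x \<le> j \<and> j < \<phi> x})"
proof -
  \<comment> \<open>The first column from \<open>c x\<close> on that \<open>x\<close> does not
    leave; it exists because nothing leaves column \<open>p\<close>.\<close>
  define \<phi> where "\<phi> x = (LEAST k. c x \<le> k \<and> x \<notin> M k)" for x
  have L: "c x \<le> \<phi> x \<and> x \<notin> M (\<phi> x)" if "x \<in> S" for x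
    unfolding \<phi>_def by (rule LeastI[of _ p]) (use c[OF that] M0 in auto)
  have Lp: "\<phi> x \<le> p" if "x \<in> S" for x
    unfolding \<phi>_def by (rule Least_le) (use c[OF that] M0 in auto)
  have L2: "x \<in> M k" if "c x \<le> k" "k < \<phi> x" for x k
    using not_less_Least[of k "\<lambda>k. c x \<le> k \<and> x \<notin> M k"] that unfolding \<phi>_def by blast
  have "x \<in> S \<and> c x \<le> j \<and> j < \<phi> x" if "j < p" "x \<in> M j" for j x
    using that
  proof (induction j)
    case 0
    then show ?case using M0 by simp
  next
    case (Suc j)
    then consider "x \<in> S" "c x = Suc j" | "x \<in> M j" using M[of "Suc j"] by auto
    then show ?case
    proof cases
      case 1
      then show ?thesis using L[OF 1(1)] Suc.prems(2) by (metis le_neq_implies_less order_refl)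
    next
      case 2
      then have *: "x \<in> S \<and> c x \<le> j \<and> j < \<phi> x" using Suc by simp
      then have "\<phi> x \<noteq> Suc j" using L[of x] Suc.prems(2) by metis
      then show ?thesis using * by simp
    qed
  qed
  then have "\<forall>j\<in>{1..<p}. M j = {x \<in> S. c x \<le> j \<and> j < \<phi> x}" using L2 by auto
  then show ?thesis using L Lp by blast
qed

text \<open>The successive moves are replaced by a static condition: the sets that are moved and the
  final positions determine each other, and each bound by a maximum concerns exactly the columns or
  rows that an entry enters on its way.\<close>

lemma derived_from_word:
  assumes w: "w \<in> words {1..p + q - 1}" "nrow w = q" "ncol w = p" "w \<noteq> []"
    and E: "word_matrix w E"
  shows "derived_from q p E F \<longleftrightarrow>
    (\<exists>\<phi> \<psi>. colok w \<phi> \<and> rowok w \<psi> \<and> placed F (set w) (\<lambda>x. q - \<psi> x) (\<lambda>x. Suc (\<phi> x)))" (is "?L \<longleftrightarrow> ?R")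
proof -
  define S where "S = set w"
  define c r where "c x = Suc (cix w x)" and "r x = q - rix w x" for x
  have d: "distinct w" "S = {1..p + q - 1}" using w(1) by (auto simp: words_def S_def)
  have z: "0 \<notin> S" and fS: "finite S" using d by auto
  have pl: "placed E S r c" using E w by (simp add: word_matrix_def S_def c_def[abs_def] r_def[abs_def])
  have rl: "rix w x < q" "cix w x < p" if "x \<in> S" for x
    using that rix_less_nrow cix_less_ncol d w by (auto simp: S_def)
  have pq: "p \<ge> 1" "q \<ge> 1" using w by (auto simp: ncol_def nrow_def)
  have cs: "col_set E j = {x \<in> S. c x = j}" and rs: "row_set E i = {x \<in> S. r x = i}" for i j
    using pl z by (simp_all add: col_set_placed row_set_placed)
  note o = step_matrix_word_matrix[OF w E, unfolded step_matrix_def, THEN conjunct1, unfolded ordered_matrix_def]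
  have ne: "col_set E j \<noteq> {}" if "j \<in> {1..p}" for j
    by (rule o[THEN conjunct2, THEN conjunct2, THEN conjunct2, THEN conjunct1, rule_format, OF that])
  have ne': "row_set E i \<noteq> {}" if "i \<in> {1..q}" for i
    by (rule o[THEN conjunct2, THEN conjunct2, THEN conjunct1, rule_format, OF that])
  have cb: "1 \<le> c x \<and> c x \<le> p" and rb: "1 \<le> r x \<and> r x \<le> q" if "x \<in> S" for x
    using rl[OF that] by (auto simp: c_def r_def)
  have rr: "r x = r y \<longleftrightarrow> rix w x = rix w y" "r x < r y \<longleftrightarrow> rix w y < rix w x" if "x \<in> S" "y \<in> S" for x y
    using rl(1)[OF that(1)] rl(1)[OF that(2)] by (auto simp: r_def)
  have inc1: "x < y" if "x \<in> S" "y \<in> S" "r x = r y" "c x < c y" for x y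
    using word_order(2)[OF d(1), of x y] that rr by (auto simp: S_def c_def)
  have placedF: "placed (fold (\<lambda>i. move_down (N i)) [1..<q] (fold (\<lambda>j. move_right (M j)) [1..<p] E)) S \<rho> \<gamma>"
    if \<gamma>: "\<And>x. x \<in> S \<Longrightarrow> c x \<le> \<gamma> x \<and> \<gamma> x \<le> p" and \<rho>: "\<And>x. x \<in> S \<Longrightarrow> r x \<le> \<rho> x \<and> \<rho> x \<le> q"
      and M: "\<And>j. j \<in> {1..<p} \<Longrightarrow> M j = {x \<in> S. c x \<le> j \<and> j < \<gamma> x}"
      and N: "\<And>i. i \<in> {1..<q} \<Longrightarrow> N i = {x \<in> S. r x \<le> i \<and> i < \<rho> x}"
      and v1: "\<And>x y. x \<in> S \<Longrightarrow> y \<in> S \<Longrightarrow> c x < c y \<Longrightarrow> c y \<le> \<gamma> x \<Longrightarrow> y < x"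
      and v2: "\<And>x y. x \<in> S \<Longrightarrow> y \<in> S \<Longrightarrow> r x < r y \<Longrightarrow> r y \<le> \<rho> x \<Longrightarrow> y < x" for \<gamma> \<rho> M N
  proof -
    have 1: "placed (fold (\<lambda>j. move_right (M j)) [1..<p] E) S r \<gamma>"
      using \<gamma> cb by (intro placed_fold_move_right[OF pl z _ M v1 inc1 pq(1)]) auto
    \<comment> \<open>Columns still increase downwards after the moves to the right. If
      \<open>x\<close> ends above \<open>y\<close> in the same column, then by monotonicity of the
      path \<open>y\<close> did not start to the right of \<open>x\<close>. Either they started in
      the same column, or \<open>y\<close> has entered or passed the column of \<open>x\<close> and
      therefore exceeds it.\<close>
    have inc2: "x < y" if "x \<in> S" "y \<in> S" "\<gamma> x = \<gamma> y" "r x < r y" for x y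
    proof -
      have rx: "rix w y < rix w x" using rr that by simp
      have "cix w y \<le> cix w x" using word_order(4)[OF d(1), of x y] that rx by (simp add: S_def)
      then consider "cix w x = cix w y" | "c y < c x" unfolding c_def by linarith
      then show ?thesis
      proof cases
        case 1
        then show ?thesis using word_order(3)[OF d(1), of x y] that rx by (simp add: S_def)
      next
        case 2
        then show ?thesis using v1[OF that(2,1) 2] \<gamma>[OF that(1)] that(3) by simp
      qed
    qed
    have "placed (fold (\<lambda>i. move_right (N i)) [1..<q]
        (mtranspose (fold (\<lambda>j. move_right (M j)) [1..<p] E))) S \<gamma> \<rho>"
    proof (rule placed_fold_move_right[OF _ z _ N v2 inc2 pq(2)])
      show "placed (mtranspose (fold (\<lambda>j. move_right (M j)) [1..<p] E)) S \<gamma> r"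
        using 1 by (simp add: placed_mtranspose)
    qed (use rb \<rho> in auto)
    then show ?thesis unfolding fold_move_down placed_mtranspose .
  qed
  \<comment> \<open>Columns of the step matrix are finite and non-empty, so the bound by
    \<open>Max\<close> becomes the pointwise condition in \<open>colok\<close>.\<close>
  have maxc: "(\<forall>x\<in>A. Max (col_set E j) < x) \<longleftrightarrow> (\<forall>x\<in>A. \<forall>y\<in>S. c y = j \<longrightarrow> y < x)" if "j \<in> {1..p}" for j A
    using ne[OF that] fS unfolding cs by (auto simp: Max_less_iff)
  have maxr: "(\<forall>x\<in>A. Max (row_set E i) < x) \<longleftrightarrow> (\<forall>x\<in>A. \<forall>y\<in>S. r y = i \<longrightarrow> y < x)" if "i \<in> {1..q}" for i A
    using ne'[OF that] fS unfolding rs by (auto simp: Max_less_iff)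
  show ?thesis
  proof
    assume ?L
    then obtain M N where MN: "M 0 = {}" "M p = {}" "N 0 = {}" "N q = {}"
      "\<forall>j\<in>{1..<p}. M j \<subset> col_set E j \<union> M (j - 1) \<and> (\<forall>x\<in>M j. Max (col_set E (j + 1)) < x)"
      "\<forall>i\<in>{1..<q}. N i \<subset> row_set E i \<union> N (i - 1) \<and> (\<forall>x\<in>N i. Max (row_set E (i + 1)) < x)"
      "F = fold (\<lambda>i. move_down (N i)) [1..<q] (fold (\<lambda>j. move_right (M j)) [1..<p] E)"
      unfolding derived_from_def by blast
    have Msub: "M j \<subseteq> {x \<in> S. c x = j} \<union> M (j - 1)" if "j \<in> {1..<p}" for j
      using MN(5) that unfolding cs by blast
    have Nsub: "N i \<subseteq> {x \<in> S. r x = i} \<union> N (i - 1)" if "i \<in> {1..<q}" for i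
      using MN(6) that unfolding rs by blast
    obtain \<gamma> where \<gamma>: "\<And>x. x \<in> S \<Longrightarrow> c x \<le> \<gamma> x \<and> \<gamma> x \<le> p" "\<And>j. j \<in> {1..<p} \<Longrightarrow> M j = {x \<in> S. c x \<le> j \<and> j < \<gamma> x}"
      using ex_final_position[of M p S c, OF MN(1,2) Msub cb] by blast
    obtain \<rho> where \<rho>: "\<And>x. x \<in> S \<Longrightarrow> r x \<le> \<rho> x \<and> \<rho> x \<le> q" "\<And>i. i \<in> {1..<q} \<Longrightarrow> N i = {x \<in> S. r x \<le> i \<and> i < \<rho> x}"
      using ex_final_position[of N q S r, OF MN(3,4) Nsub rb] by blast
    have v1: "y < x" if xy: "x \<in> S" "y \<in> S" "c x < c y" "c y \<le> \<gamma> x" for x y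
    proof -
      have j: "c y - 1 \<in> {1..<p}" "c y - 1 + 1 = c y" "c y \<in> {1..p}"
        using xy cb[OF xy(1)] cb[OF xy(2)] by auto
      \<comment> \<open>To enter the column of \<open>y\<close>, the entry \<open>x\<close> has to
        be among those moved out of the preceding column.\<close>
      have "x \<in> M (c y - 1)" unfolding \<gamma>(2)[OF j(1)] using xy by auto
      moreover have "\<forall>x\<in>M (c y - 1). Max (col_set E (c y)) < x" using MN(5) j by fastforce
      ultimately show ?thesis using maxc[OF j(3), of "M (c y - 1)"] xy(2) by blast
    qed
    have v2: "y < x" if xy: "x \<in> S" "y \<in> S" "r x < r y" "r y \<le> \<rho> x" for x y
    proof -
      have j: "r y - 1 \<in> {1..<q}" "r y - 1 + 1 = r y" "r y \<in> {1..q}"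
        using xy rb[OF xy(1)] rb[OF xy(2)] by auto
      have "x \<in> N (r y - 1)" unfolding \<rho>(2)[OF j(1)] using xy by auto
      moreover have "\<forall>x\<in>N (r y - 1). Max (row_set E (r y)) < x" using MN(6) j by fastforce
      ultimately show ?thesis using maxr[OF j(3), of "N (r y - 1)"] xy(2) by blast
    qed
    have F: "placed F S \<rho> \<gamma>"
      unfolding MN(7) using placedF[OF \<gamma>(1) \<rho>(1) \<gamma>(2) \<rho>(2) v1 v2] by blast
    define \<phi> \<psi> where "\<phi> x = \<gamma> x - 1" and "\<psi> x = q - \<rho> x" for x
    have \<gamma>b: "Suc (\<phi> x) = \<gamma> x" and \<rho>b: "q - \<psi> x = \<rho> x" if "x \<in> S" for x
      using \<gamma>(1)[OF that] \<rho>(1)[OF that] cb[OF that] by (auto simp: \<phi>_def \<psi>_def)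
    have "colok w \<phi>"
      unfolding colok_def S_def[symmetric]
    proof (intro ballI conjI impI)
      fix x assume x: "x \<in> S"
      show "cix w x \<le> \<phi> x" "\<phi> x < ncol w" using \<gamma>(1)[OF x] \<gamma>b[OF x] w(3) by (auto simp: c_def)
      fix y assume y: "y \<in> S" "cix w x < cix w y \<and> cix w y \<le> \<phi> x"
      then show "y < x" using v1[OF x y(1)] \<gamma>b[OF x] by (simp add: c_def)
    qed
    moreover have "rowok w \<psi>"
      unfolding rowok_def S_def[symmetric]
    proof (intro ballI conjI impI)
      fix x assume x: "x \<in> S"
      show "\<psi> x \<le> rix w x" using \<rho>(1)[OF x] rl[OF x] by (auto simp: r_def \<psi>_def)
      fix y assume y: "y \<in> S" "\<psi> x \<le> rix w y \<and> rix w y < rix w x"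
      then have "r x < r y" "r y \<le> \<rho> x" using rr[OF x y(1)] \<rho>b[OF x] by (auto simp: r_def)
      then show "y < x" using v2[OF x y(1)] by simp
    qed
    moreover have "placed F (set w) (\<lambda>x. q - \<psi> x) (\<lambda>x. Suc (\<phi> x))"
      unfolding S_def[symmetric] using F \<gamma>b \<rho>b by (auto intro: placed_cong)
    ultimately show ?R by blast
  next
    assume ?R
    then obtain \<phi> \<psi> where ok: "colok w \<phi>" "rowok w \<psi>" and F: "placed F S (\<lambda>x. q - \<psi> x) (\<lambda>x. Suc (\<phi> x))"
      unfolding S_def by blast
    define \<gamma> \<rho> where "\<gamma> x = Suc (\<phi> x)" and "\<rho> x = q - \<psi> x" for x
    have \<gamma>: "c x \<le> \<gamma> x \<and> \<gamma> x \<le> p" if "x \<in> S" for x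
      using ok(1) that w(3) unfolding colok_def S_def[symmetric] by (auto simp: c_def \<gamma>_def)
    have \<rho>: "r x \<le> \<rho> x \<and> \<rho> x \<le> q" if "x \<in> S" for x
      using ok(2) that unfolding rowok_def S_def[symmetric] by (auto simp: r_def \<rho>_def)
    have v1: "y < x" if xy: "x \<in> S" "y \<in> S" "c x < c y" "c y \<le> \<gamma> x" for x y
      using ok(1) xy unfolding colok_def S_def[symmetric] by (auto simp: c_def \<gamma>_def)
    have v2: "y < x" if xy: "x \<in> S" "y \<in> S" "r x < r y" "r y \<le> \<rho> x" for x y
    proof -
      have "\<psi> x < q" using rowok_bound[OF d(1) ok(2), of x] xy w(2) by (simp add: S_def)
      then have "\<psi> x \<le> rix w y" using xy(4) rl(1)[OF xy(2)] by (simp add: r_def \<rho>_def)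
      moreover have "rix w y < rix w x" using rr xy by simp
      ultimately show ?thesis using ok(2) xy(1,2) unfolding rowok_def S_def[symmetric] by blast
    qed
    define M N where "M j = {x \<in> S. c x \<le> j \<and> j < \<gamma> x}" and "N i = {x \<in> S. r x \<le> i \<and> i < \<rho> x}" for i j
    have mj: "M j \<subset> col_set E j \<union> M (j - 1) \<and> (\<forall>x\<in>M j. Max (col_set E (j + 1)) < x)" if j: "j \<in> {1..<p}" for j
    proof
      have "M j \<subseteq> col_set E j \<union> M (j - 1)"
      proof
        fix x assume "x \<in> M j"
        then have "x \<in> S" "c x \<le> j" "j < \<gamma> x" by (auto simp: M_def)
        then show "x \<in> col_set E j \<union> M (j - 1)" unfolding cs M_def by (cases "c x = j") auto
      qed
      \<comment> \<open>An entry whose final column is \<open>j\<close> belongs to the set from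
        which \<open>M j\<close> is chosen but is not moved on, so \<open>M j\<close> is
        proper.\<close>
      moreover have "\<exists>y. y \<in> col_set E j \<union> M (j - 1) \<and> y \<notin> M j"
      proof -
        have "j - 1 < ncol w" using j w by auto
        then obtain y where y: "y \<in> S" "\<phi> y = j - 1" using colok_surj[OF d(1) ok(1)] by (auto simp: S_def)
        then have "\<gamma> y = j" using j by (simp add: \<gamma>_def)
        then show ?thesis using \<gamma>[OF y(1)] y(1) j unfolding cs M_def
          by (intro exI[of _ y]) (cases "c y = j"; auto)
      qed
      ultimately show "M j \<subset> col_set E j \<union> M (j - 1)" by blast
      have "j + 1 \<in> {1..p}" using j by auto
      then show "\<forall>x\<in>M j. Max (col_set E (j + 1)) < x"
        unfolding maxc[OF \<open>j + 1 \<in> _\<close>] using v1 by (auto simp: M_def)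
    qed
    have ni: "N i \<subset> row_set E i \<union> N (i - 1) \<and> (\<forall>x\<in>N i. Max (row_set E (i + 1)) < x)" if i: "i \<in> {1..<q}" for i
    proof
      have "N i \<subseteq> row_set E i \<union> N (i - 1)"
      proof
        fix x assume "x \<in> N i"
        then have "x \<in> S" "r x \<le> i" "i < \<rho> x" by (auto simp: N_def)
        then show "x \<in> row_set E i \<union> N (i - 1)" unfolding rs N_def by (cases "r x = i") auto
      qed
      moreover have "\<exists>y. y \<in> row_set E i \<union> N (i - 1) \<and> y \<notin> N i"
      proof -
        have "q - i < nrow w" using i w by auto
        then obtain y where y: "y \<in> S" "\<psi> y = q - i" using rowok_surj[OF d(1) ok(2)] by (auto simp: S_def)
        then have "\<rho> y = i" using i by (simp add: \<rho>_def)
        then show ?thesis using \<rho>[OF y(1)] y(1) i unfolding rs N_def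
          by (intro exI[of _ y]) (cases "r y = i"; auto)
      qed
      ultimately show "N i \<subset> row_set E i \<union> N (i - 1)" by blast
      have "i + 1 \<in> {1..q}" using i by auto
      then show "\<forall>x\<in>N i. Max (row_set E (i + 1)) < x"
        unfolding maxr[OF \<open>i + 1 \<in> _\<close>] using v2 by (auto simp: N_def)
    qed
    have e: "M 0 = {}" "M p = {}" "N 0 = {}" "N q = {}"
      using \<gamma> \<rho> cb rb by (fastforce simp: M_def N_def)+
    have Ff: "F = fold (\<lambda>i. move_down (N i)) [1..<q] (fold (\<lambda>j. move_right (M j)) [1..<p] E)"
    proof (rule placed_unique)
      show "placed F S \<rho> \<gamma>" using F by (simp add: \<rho>_def[abs_def] \<gamma>_def[abs_def])
      show "placed (fold (\<lambda>i. move_down (N i)) [1..<q] (fold (\<lambda>j. move_right (M j)) [1..<p] E)) S \<rho> \<gamma>"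
        by (rule placedF[OF \<gamma> \<rho> _ _ v1 v2]) (auto simp: M_def N_def)
    qed
    show ?L
      unfolding derived_from_def
    proof (rule conjI, rule step_matrix_word_matrix[OF w E], rule exI[of _ M], rule exI[of _ N], intro conjI)
      show "\<forall>j\<in>{1..<p}. M j \<subset> col_set E j \<union> M (j - 1) \<and> (\<forall>x\<in>M j. Max (col_set E (j + 1)) < x)"
        by (rule ballI) (rule mj)
      show "\<forall>i\<in>{1..<q}. N i \<subset> row_set E i \<union> N (i - 1) \<and> (\<forall>x\<in>N i. Max (row_set E (i + 1)) < x)"
        by (rule ballI) (rule ni)
    qed (fact e Ff)+
  qed
qed

section \<open>Configuration matrices as words with a pair of faces\<close>

lemma cols_rows_word_unique:
  assumes "w \<in> words S" "w' \<in> words S" "a \<in> cols w" "a \<in> cols w'" "b \<in> rows w" "b \<in> rows w'"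
  shows "w = w'"
proof -
  have d: "distinct w" "distinct w'" "set w = S" "set w' = S" using assms(1,2) by (auto simp: words_def)
  obtain \<phi> \<phi>' where \<phi>: "colok w \<phi>" "a = face_of (ncol w) S \<phi>" "colok w' \<phi>'" "a = face_of (ncol w') S \<phi>'"
    using assms(3,4) d by (auto simp: cols_def)
  obtain \<psi> \<psi>' where \<psi>: "rowok w \<psi>" "b = face_of (nrow w) S \<psi>" "rowok w' \<psi>'" "b = face_of (nrow w') S \<psi>'"
    using assms(5,6) d by (auto simp: rows_def)
  have l: "ncol w = ncol w'" "nrow w = nrow w'" using \<phi>(2,4) \<psi>(2,4) by (metis length_face_of)+
  have "\<phi> x = \<phi>' x" if "x \<in> S" for x
    using \<phi>(2,4) l colok_bound[OF \<phi>(1)] d that by (intro face_of_inj[of "ncol w" S \<phi> \<phi>' x]) auto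
  moreover have "\<psi> x = \<psi>' x" if "x \<in> S" for x
    using \<psi>(2,4) l rowok_bound[OF d(1) \<psi>(1)] d that by (intro face_of_inj[of "nrow w" S \<psi> \<psi>' x]) auto
  ultimately have "colok w' \<phi>" "rowok w' \<psi>"
    using colok_cong[of w' \<phi> \<phi>'] rowok_cong[of w' \<psi> \<psi>'] \<phi>(3) \<psi>(3) d by auto
  then show ?thesis using word_unique[OF d(1,2) _ \<phi>(1) _ \<psi>(1)] d by simp
qed

text \<open>The reversed order of rows in \<open>row_part\<close> agrees with counting rows from
  below, so both faces are given directly by the position functions.\<close>

lemma placed_parts:
  assumes F: "placed F S (\<lambda>x. q - \<psi> x) (\<lambda>x. Suc (\<phi> x))" and z: "0 \<notin> S" and \<psi>: "\<And>x. x \<in> S \<Longrightarrow> \<psi> x < q"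
  shows "col_part p F = face_of p S \<phi>" "row_part q F = face_of q S \<psi>"
proof -
  show "col_part p F = face_of p S \<phi>"
    by (rule nth_equalityI) (simp_all add: col_part_def col_set_placed[OF F z] del: upt_Suc)
  show "row_part q F = face_of q S \<psi>"
  proof (rule nth_equalityI)
    fix i assume "i < length (row_part q F)"
    then have i: "i < q" by (simp add: row_part_def del: upt_Suc)
    have "row_part q F ! i = row_set F (q - i)"
      using i by (simp add: row_part_def rev_nth Suc_diff_Suc del: upt_Suc)
    also have "\<dots> = {x \<in> S. \<psi> x = i}"
      unfolding row_set_placed[OF F z] using \<psi> i by force
    finally show "row_part q F ! i = face_of q S \<psi> ! i" using i by simp
  qed (simp add: row_part_def del: upt_Suc)
qed

lemma word_matrix_unique: "word_matrix w E \<Longrightarrow> word_matrix w E' \<Longrightarrow> E = E'"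
  unfolding word_matrix_def by (rule placed_unique)

lemma ex_matrix_of_word:
  assumes "distinct w" shows "\<exists>E. word_matrix w E"
  unfolding word_matrix_def
proof (rule ex_placed)
  fix x y assume "x \<in> set w" "y \<in> set w" "nrow w - rix w x = nrow w - rix w y" "Suc (cix w x) = Suc (cix w y)"
  then show "x = y"
    using word_order(1)[OF assms, of x y] rix_less_nrow[OF assms, of x] rix_less_nrow[OF assms, of y] by simp
qed

text \<open>Entries that share a final column are both in \<open>u\<close> or both outside it, and
  sharing a final row separates \<open>m\<close> from \<open>v\<close>, so the claim descends to the
  two sides of the cut. It ensures that a matrix with the prescribed final positions exists.\<close>

lemma config_positions_inj:
  assumes "distinct w" "colok w \<phi>" "rowok w \<psi>" "x \<in> set w" "y \<in> set w" "\<phi> x = \<phi> y" "\<psi> x = \<psi> y"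
  shows "x = y"
  using assms
proof (induction w arbitrary: \<phi> \<psi> rule: peak_induct)
  case (peak u m v)
  note c = peak(5)[unfolded colok_peak[OF peak(1,2)]]
  note r = peak(6)[unfolded rowok_peak[OF peak(1,2)]]
  have d: "distinct u" using peak(1) by simp
  have *: False if "z \<in> set u" "z' \<in> set v \<union> {m}" "\<phi> z = \<phi> z'" for z z'
    using that c colok_bound[of u \<phi> z] by auto
  have **: False if "z \<in> set v" "\<psi> z = \<psi> m" for z
    using that r by auto
  consider "x \<in> set u" "y \<in> set u" | "x \<in> set v" "y \<in> set v" | "x = m" "y = m"
    using peak(7-10) *[of x y] *[of y x] **[of x] **[of y] by auto
  then show ?case
  proof cases
    case 1
    then show ?thesis using peak(3)[of \<phi> \<psi>] c r peak(9,10) by blast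
  next
    case 2
    then show ?thesis
      using peak(4)[of "\<lambda>x. \<phi> x - ncol u" "\<lambda>x. \<psi> x - max 1 (nrow u)"] c r peak(9,10) by simp
  qed simp
qed simp

lemma config_matrix_cases:
  assumes "F \<in> config_matrices q p" "q \<ge> 1" "p \<ge> 1"
  obtains w \<phi> \<psi> E where "w \<in> words {1..p + q - 1}" "nrow w = q" "ncol w = p" "word_matrix w E"
    "colok w \<phi>" "rowok w \<psi>" "placed F (set w) (\<lambda>x. q - \<psi> x) (\<lambda>x. Suc (\<phi> x))" "derived_from q p E F"
proof -
  obtain E where E: "derived_from q p E F" using assms(1) by (auto simp: config_matrices_def)
  then have "step_matrix q p E" by (simp add: derived_from_def)
  then obtain w where w: "w \<in> words {1..p + q - 1}" "nrow w = q" "ncol w = p" "word_matrix w E"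
    using ex_word_matrix assms(2,3) by blast
  then have "w \<noteq> []" using assms(3) by auto
  then obtain \<phi> \<psi> where "colok w \<phi>" "rowok w \<psi>" "placed F (set w) (\<lambda>x. q - \<psi> x) (\<lambda>x. Suc (\<phi> x))"
    using derived_from_word[OF w(1-3) _ w(4)] E by blast
  then show ?thesis using that w E by blast
qed

lemma config_matrix_word:
  assumes F: "F \<in> config_matrices q p" and pos: "q \<ge> 1" "p \<ge> 1"
  shows "\<exists>w. w \<in> words {1..p + q - 1} \<and> nrow w = q \<and> col_part p F \<in> cols w \<and> row_part q F \<in> rows w \<and>
    csgn q p F = coef w (col_part p F) (row_part q F)"
proof -
  obtain w \<phi> \<psi> E where w: "w \<in> words {1..p + q - 1}" "nrow w = q" "ncol w = p" "word_matrix w E"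
    "colok w \<phi>" "rowok w \<psi>" "placed F (set w) (\<lambda>x. q - \<psi> x) (\<lambda>x. Suc (\<phi> x))" "derived_from q p E F"
    using config_matrix_cases[OF assms] .
  have d: "distinct w" "0 \<notin> set w" "w \<noteq> []" using w(1,3) pos by (auto simp: words_def)
  have parts: "col_part p F = face_of p (set w) \<phi>" "row_part q F = face_of q (set w) \<psi>"
    using placed_parts[OF w(7) d(2)] rowok_bound[OF d(1) w(6)] w(2) by auto
  have mem: "col_part p F \<in> cols w" "row_part q F \<in> rows w"
    unfolding parts cols_def rows_def using w by blast+
  \<comment> \<open>The words of two step matrices that yield \<open>F\<close> admit the same column
    and row faces, so they coincide by \<open>cols_rows_word_unique\<close>.\<close>
  have "(THE E. derived_from q p E F) = E"
  proof (rule the_equality)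
    show "derived_from q p E F" by (rule w(8))
  next
    fix E' assume E': "derived_from q p E' F"
    then have "step_matrix q p E'" by (simp add: derived_from_def)
    then obtain w' where w': "w' \<in> words {1..p + q - 1}" "nrow w' = q" "ncol w' = p" "word_matrix w' E'"
      using ex_word_matrix pos by blast
    then have "w' \<noteq> []" using pos by auto
    then obtain \<phi>' \<psi>' where ok': "colok w' \<phi>'" "rowok w' \<psi>'" "placed F (set w') (\<lambda>x. q - \<psi>' x) (\<lambda>x. Suc (\<phi>' x))"
      using derived_from_word[OF w'(1-3) _ w'(4)] E' by blast
    have d': "distinct w'" "0 \<notin> set w'" using w'(1) by (auto simp: words_def)
    have "col_part p F = face_of p (set w') \<phi>'" "row_part q F = face_of q (set w') \<psi>'"
      using placed_parts[OF ok'(3) d'(2)] rowok_bound[OF d'(1) ok'(2)] w'(2) by auto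
    then have "col_part p F \<in> cols w'" "row_part q F \<in> rows w'"
      unfolding cols_def rows_def using ok' w' by blast+
    then have "w = w'" using cols_rows_word_unique[OF w(1) w'(1)] mem by blast
    then show "E' = E" using word_matrix_unique w'(4) w(4) by blast
  qed
  moreover have "col_part p E = step_cols w"
    using placed_parts(1)[of E "set w" q "rix w" "cix w" p] w(2-4) d rix_less_nrow[OF d(1)]
    by (simp add: word_matrix_def step_cols_def)
  ultimately have "csgn q p F = coef w (col_part p F) (row_part q F)"
    by (simp add: csgn_def coef_def w(2) Let_def)
  then show ?thesis using w mem by blast
qed

lemma config_matrix_of_word:
  assumes w: "w \<in> words {1..p + q - 1}" "nrow w = q" "w \<noteq> []" "p \<ge> 1" and ab: "a \<in> cols w" "b \<in> rows w"
  shows "\<exists>F\<in>config_matrices q p. col_part p F = a \<and> row_part q F = b"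
proof -
  have d: "distinct w" "0 \<notin> set w" "set w = {1..p + q - 1}" using w(1) by (auto simp: words_def)
  have "length w = p + q - 1" using d distinct_card by fastforce
  then have p: "ncol w = p" using ncol_nrow[OF d(1) w(3)] w(2,4) by linarith
  obtain \<phi> where \<phi>: "colok w \<phi>" "a = face_of p (set w) \<phi>" using ab(1) p by (auto simp: cols_def)
  obtain \<psi> where \<psi>: "rowok w \<psi>" "b = face_of q (set w) \<psi>" using ab(2) w(2) by (auto simp: rows_def)
  obtain E where E: "word_matrix w E" using ex_matrix_of_word[OF d(1)] by blast
  have "\<exists>F. placed F (set w) (\<lambda>x. q - \<psi> x) (\<lambda>x. Suc (\<phi> x))"
  proof (rule ex_placed)
    fix x y assume xy: "x \<in> set w" "y \<in> set w" "q - \<psi> x = q - \<psi> y" "Suc (\<phi> x) = Suc (\<phi> y)"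
    then have "\<psi> x = \<psi> y" using rowok_bound[OF d(1) \<psi>(1)] w(2) by (metis diff_diff_cancel less_imp_le)
    then show "x = y" using config_positions_inj[OF d(1) \<phi>(1) \<psi>(1) xy(1,2)] xy(4) by simp
  qed
  then obtain F where F: "placed F (set w) (\<lambda>x. q - \<psi> x) (\<lambda>x. Suc (\<phi> x))" by blast
  then have "derived_from q p E F"
    using derived_from_word[OF w(1,2) p w(3) E] \<phi>(1) \<psi>(1) by blast
  then have "F \<in> config_matrices q p" by (auto simp: config_matrices_def)
  moreover have "col_part p F = a" "row_part q F = b"
    using placed_parts[OF F d(2)] rowok_bound[OF d(1) \<psi>(1)] w(2) \<phi>(2) \<psi>(2) by auto
  ultimately show ?thesis by blast
qed

lemma config_matrix_parts_inj:
  assumes F: "F \<in> config_matrices q p" "F' \<in> config_matrices q p" and pos: "q \<ge> 1" "p \<ge> 1"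
    and eq: "col_part p F = col_part p F'" "row_part q F = row_part q F'"
  shows "F = F'"
proof -
  obtain w \<phi> \<psi> E where w: "w \<in> words {1..p + q - 1}" "nrow w = q" "ncol w = p" "word_matrix w E"
    "colok w \<phi>" "rowok w \<psi>" "placed F (set w) (\<lambda>x. q - \<psi> x) (\<lambda>x. Suc (\<phi> x))"
    using config_matrix_cases[OF F(1) pos] .
  obtain w' \<phi>' \<psi>' E' where w': "w' \<in> words {1..p + q - 1}" "nrow w' = q" "ncol w' = p" "word_matrix w' E'"
    "colok w' \<phi>'" "rowok w' \<psi>'" "placed F' (set w') (\<lambda>x. q - \<psi>' x) (\<lambda>x. Suc (\<phi>' x))"
    using config_matrix_cases[OF F(2) pos] .
  define S where "S = {1..p + q - 1}"
  have d: "distinct w" "distinct w'" "set w = S" "set w' = S" "0 \<notin> S"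
    using w(1) w'(1) by (auto simp: words_def S_def)
  have b: "\<psi> x < q" "\<psi>' x < q" "\<phi> x < p" if "x \<in> S" for x
    using rowok_bound[OF d(1) w(6)] rowok_bound[OF d(2) w'(6)] colok_bound[OF w(5)] that d w(2,3) w'(2) by auto
  note P = w(7)[unfolded d] and P' = w'(7)[unfolded d]
  have "face_of p S \<phi> = face_of p S \<phi>'" "face_of q S \<psi> = face_of q S \<psi>'"
    using placed_parts[OF P d(5)] placed_parts[OF P' d(5)] b eq by auto
  then have "\<phi> x = \<phi>' x \<and> \<psi> x = \<psi>' x" if "x \<in> S" for x
    using face_of_inj[of p S \<phi> \<phi>' x] face_of_inj[of q S \<psi> \<psi>' x] b that by blast
  then have "placed F S (\<lambda>x. q - \<psi>' x) (\<lambda>x. Suc (\<phi>' x))"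
    using P by (auto intro: placed_cong)
  then show ?thesis using P' by (rule placed_unique)
qed

text \<open>For each number of rows, sending \<open>F\<close> to its word and its two faces is a
  bijection onto the terms of \<open>word_diag\<close> with that number of rows; the number of
  columns is then fixed by the length of the word.\<close>

lemma diag_top_word_diag: "diag_top n = word_diag {1..n + 1}"
proof -
  define S where "S = {1..n + 1}"
  define W where "W q = {w \<in> words S. nrow w = q}" for q
  define Z where "Z q = Sigma (W q) (\<lambda>w. cols w \<times> rows w)" for q
  define g where "g = (\<lambda>(w, a, b). frag_cmul (coef w a b) (frag_of (a, b)))"
  have fW: "finite (words S)" by (rule finite_words) (simp add: S_def)
  have fin: "finite (cols w)" "finite (rows w)" if "w \<in> words S" for w
    using that finite_cols finite_rows by (auto simp: words_def)
  have ne: "w \<noteq> []" "nrow w \<in> {1..n + 1}" if "w \<in> words S" for w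
  proof -
    have w: "distinct w" "set w = S" using that by (auto simp: words_def)
    then show "w \<noteq> []" by (auto simp: S_def)
    then have "ncol w \<noteq> 0" "nrow w \<noteq> 0" "ncol w + nrow w = Suc (length w)"
      using ncol_nrow[OF w(1)] by simp_all
    moreover have "length w = n + 1" using distinct_card[OF w(1)] w(2) by (simp add: S_def)
    ultimately have "1 \<le> nrow w" "nrow w \<le> n + 1" by linarith+
    then show "nrow w \<in> {1..n + 1}" by simp
  qed
  have "(\<Sum>F\<in>config_matrices q (n + 2 - q). frag_cmul (csgn q (n + 2 - q) F)
       (frag_of (col_part (n + 2 - q) F, row_part q F))) = sum g (Z q)" if q: "q \<in> {1..n + 1}" for q
  proof -
    define p where "p = n + 2 - q"
    have pq: "q \<ge> 1" "p \<ge> 1" "{1..p + q - 1} = S" using q by (auto simp: p_def S_def)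
    have ex: "\<exists>w. w \<in> W q \<and> col_part p F \<in> cols w \<and> row_part q F \<in> rows w \<and>
      csgn q p F = coef w (col_part p F) (row_part q F)" if "F \<in> config_matrices q p" for F
      using config_matrix_word[OF that pq(1,2)] unfolding W_def pq by blast
    \<comment> \<open>The choice is unique: the two faces determine the word.\<close>
    define f where "f F = (SOME w. w \<in> W q \<and> col_part p F \<in> cols w \<and> row_part q F \<in> rows w \<and>
      csgn q p F = coef w (col_part p F) (row_part q F))" for F
    have f: "f F \<in> W q" "col_part p F \<in> cols (f F)" "row_part q F \<in> rows (f F)"
      "csgn q p F = coef (f F) (col_part p F) (row_part q F)" if "F \<in> config_matrices q p" for F
      using someI_ex[OF ex[OF that]] unfolding f_def by blast+
    define h where "h F = (f F, col_part p F, row_part q F)" for F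
    have "bij_betw h (config_matrices q p) (Z q)"
    proof (rule bij_betw_imageI)
      show "inj_on h (config_matrices q p)"
        using config_matrix_parts_inj[OF _ _ pq(1,2)] by (auto intro: inj_onI simp: h_def)
      show "h ` config_matrices q p = Z q"
      proof (intro equalityI subsetI)
        fix z assume "z \<in> h ` config_matrices q p"
        then show "z \<in> Z q" using f by (auto simp: h_def Z_def)
      next
        fix z assume "z \<in> Z q"
        then obtain w a b where z: "z = (w, a, b)" "w \<in> words S" "nrow w = q" "a \<in> cols w" "b \<in> rows w"
          by (auto simp: Z_def W_def)
        obtain F where F: "F \<in> config_matrices q p" "col_part p F = a" "row_part q F = b"
          using config_matrix_of_word[of w p q a b] z ne[of w] pq by auto
        have "f F = w"
          using cols_rows_word_unique[of "f F" S w a b] f[OF F(1)] F z by (auto simp: W_def)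
        then have "z = h F" by (simp add: h_def z F)
        then show "z \<in> h ` config_matrices q p" using F(1) by blast
      qed
    qed
    then have "sum g (Z q) = (\<Sum>F\<in>config_matrices q p. g (h F))"
      by (rule sum.reindex_bij_betw[symmetric])
    also have "\<dots> = (\<Sum>F\<in>config_matrices q p. frag_cmul (csgn q p F) (frag_of (col_part p F, row_part q F)))"
      by (intro sum.cong refl) (simp add: g_def h_def f(4))
    finally show ?thesis by (simp add: p_def)
  qed
  then have "diag_top n = (\<Sum>q\<in>{1..n + 1}. sum g (Z q))"
    unfolding diag_top_def by (intro sum.cong refl)
  also have "\<dots> = (\<Sum>q\<in>{1..n + 1}. \<Sum>w\<in>W q. word_chain w)"
  proof (intro sum.cong refl)
    fix q
    have "sum g (Z q) = (\<Sum>w\<in>W q. \<Sum>(a, b)\<in>cols w \<times> rows w. frag_cmul (coef w a b) (frag_of (a, b)))"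
      unfolding Z_def g_def using fW fin by (subst sum.Sigma) (auto simp: W_def)
    then show "sum g (Z q) = (\<Sum>w\<in>W q. word_chain w)"
      by (simp add: word_chain_def sum.cartesian_product)
  qed
  also have "\<dots> = (\<Sum>w\<in>words S. word_chain w)"
    unfolding W_def using fW ne by (intro sum.group) auto
  finally show ?thesis by (simp add: word_diag_def S_def)
qed

section \<open>Comultiplicative extension\<close>

lemma diag_block_word_diag:
  assumes "finite U" "U \<noteq> {}" shows "diag_block U = word_diag U"
proof -
  have "card U > 0" using assms by (simp add: card_gt_0_iff)
  then have "diag_top (card U - 1) = word_diag {1..card U}"
    by (simp add: diag_top_word_diag)
  then show ?thesis
    unfolding diag_block_def using word_diag_image[OF order_label_image(1)[OF assms(1)]]
      order_label_image(2)[OF assms(1)] by simp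
qed

lemma diag_linear [linear]:
  "diag 0 = 0" "diag (x + y) = diag x + diag y" "diag (x - y) = diag x - diag y"
  "diag (frag_cmul c x) = frag_cmul c (diag x)" "diag (sum g I) = (\<Sum>i\<in>I. diag (g i))"
  by (simp_all add: diag_def frag_extend_linear)

lemma diag_of [simp]: "diag (frag_of u) = diag_face u"
  by (simp add: diag_def)

lemma diag_face_Cons: "diag_face (U # u) = bar (diag_block U) (diag_face u)"
  by (simp add: diag_face_def)

lemma diag_cat_block: "diag (cat (frag_of [U]) y) = bar (diag_block U) (diag y)"
  by (induction y rule: chain_induct) (simp_all add: linear diag_face_Cons)

lemma good_chain2_bar:
  assumes "good_chain2 x" "good_chain2 y" shows "good_chain2 (bar x y)"
  unfolding good_chain2_def
proof
  fix z assume "z \<in> Poly_Mapping.keys (bar x y)"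
  then obtain a b a' b' where "(a, b) \<in> Poly_Mapping.keys x" "(a', b') \<in> Poly_Mapping.keys y"
    "z = (a @ a', b @ b')"
    unfolding bar_def by (fastforce dest!: subsetD[OF keys_frag_extend])
  then show "good_face (fst z) \<and> good_face (snd z)"
    using assms by (force simp: good_chain2_def)
qed

lemma good_chain2_diag_face: "good_face u \<Longrightarrow> good_chain2 (diag_face u)"
proof (induction u)
  case Nil
  then show ?case by (simp add: diag_face_def good_chain2_def)
next
  case (Cons U u)
  then have "good_chain2 (word_diag U)"
    using word_diag_face_chains2 by (intro face_chains2_good) auto
  then show ?case using Cons by (simp add: diag_face_Cons diag_block_word_diag good_chain2_bar)
qed

text \<open>The boundary sign times the shuffle sign is the coefficient in
  \<open>bd2_word_diag\<close>, where the subsets \<open>{}\<close> and \<open>U\<close>, absent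
  from the boundary, have coefficient 0.\<close>

lemma diag_split_block:
  assumes U: "finite U" "U \<noteq> {}"
  shows "diag (cat (split_block U) (frag_of u)) = bar (bd2 (word_diag U)) (diag_face u)"
proof -
  have "diag (cat (split_block U) (frag_of u)) = (\<Sum>M\<in>{M. M \<noteq> {} \<and> M \<subset> U}.
     frag_cmul ((-1) ^ (card M + crossings M (U - M)))
       (bar (bar (word_diag M) (word_diag (U - M))) (diag_face u)))"
  proof -
    have "frag_cmul ((-1) ^ card M * shuff M (U - M)) (diag_face (M # (U - M) # u)) =
       frag_cmul ((-1) ^ (card M + crossings M (U - M)))
       (bar (bar (word_diag M) (word_diag (U - M))) (diag_face u))"
      if M: "M \<noteq> {} \<and> M \<subset> U" for M
    proof -
      have "finite M" "finite (U - M)" "U - M \<noteq> {}" using M U finite_subset by auto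
      then show ?thesis using M
        by (simp add: diag_face_Cons diag_block_word_diag bar_assoc shuff_crossings power_add)
    qed
    then show ?thesis
      by (simp add: split_block_def linear)
  qed
  also have "\<dots> = (\<Sum>M\<in>Pow U. frag_cmul (if M \<noteq> {} \<and> U - M \<noteq> {} then
        (-1) ^ (card M + crossings M (U - M)) else 0)
       (bar (bar (word_diag M) (word_diag (U - M))) (diag_face u)))"
    using U by (intro sum.mono_neutral_cong_left) auto
  also have "\<dots> = bar (bd2 (word_diag U)) (diag_face u)"
    by (simp add: bd2_word_diag[OF U(1)] linear)
  finally show ?thesis .
qed

text \<open>Both sides obey the same derivation rule along the blocks, because the diagonal of a
  block has the degree of the block; so the statement reduces to single blocks.\<close>

lemma diag_bd_face: "good_face u \<Longrightarrow> diag (bd_face u) = bd2 (diag_face u)"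
proof (induction u)
  case Nil
  show ?case by (simp add: linear diag_face_def bd2_single_entries)
next
  case (Cons U u)
  then have U: "finite U" "U \<noteq> {}" "good_face u" by auto
  have "card U > 0" using U by (simp add: card_gt_0_iff)
  then have s: "(-1 :: int) ^ (card U - 1) = (-1) ^ Suc (card U)"
    by (intro neg_one_power_cong) auto
  have "diag (bd_face (U # u)) = bar (bd2 (word_diag U)) (diag_face u)
     + frag_cmul ((-1) ^ (card U - 1)) (bar (word_diag U) (bd2 (diag_face u)))"
    using Cons U by (simp add: bd_face_Cons linear diag_split_block diag_cat_block diag_block_word_diag)
  also have "\<dots> = bd2 (bar (word_diag U) (diag_face u))"
    unfolding s using U by (intro bd2_bar[symmetric] hom_chain2_word_diag good_chain2_diag_face
      face_chains2_good[OF word_diag_face_chains2])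
  finally show ?case using U by (simp add: diag_face_Cons diag_block_word_diag)
qed

theorem theorem1:
  fixes n :: nat
  assumes "n \<ge> 1" and "x \<in> perm_chains {1..n + 1}"
  shows "diag (bd x) = bd_tensor_id (diag x) + id_tensor_bd (diag x)"
proof -
  have "Poly_Mapping.keys x \<subseteq> faces {1..n + 1}" using assms(2) by (simp add: perm_chains_def)
  then have "diag (bd x) = bd2 (diag x)"
    by (induction x rule: frag_induction) (simp_all add: linear diag_bd_face faces_good)
  then show ?thesis by (simp add: bd2_def)
qed

end
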